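(* Let $d=1$, and let $p\in(1,\infty)$ and $m>0$ satisfy $m(p-1)>1$ and $p>2$. Let $o\in\mathbb{R}$ and $r^o(y):=|y-o|$. For every $x\in\mathbb{R}\setminus\{o\}$ and every probabilistically weak solution $X$ (as defined in the context) starting at $x$, on a stochastic basis $(\Omega,\mathscr{F},\mathscr{F}_\bullet,\mathbf{P}^x)$, there exist a standard $\mathscr{F}_\bullet$-Brownian motion $B$ on $\mathbb{R}$ and a nonnegative, nondecreasing, $\mathscr{F}_\bullet$-adapted process $L^o$ with locally bounded variation such that, $\mathbf{P}^x$-a.s. (in integrated form over $[0,t]$ for all $t\ge0$), $$\mathrm{d}r^o(X_t)=\sqrt{2a(t,|X_t-x|)}\,\mathrm{d}B_t+a_r(t,|X_t-x|)\,\mathrm{sgn}(X_t-x)\,\mathrm{sgn}(X_t-o)\,\mathrm{d}t+\mathrm{d}L_t^o$$ $$=\sqrt{2a(t,|X_t-x|)}\,\mathrm{d}B_t+\mathsf{L}_{p,m}^xr^o(X_t)\,\mathrm{d}t+\mathrm{d}L_t^o.$$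
   Context: Here $d=1$, and $p>2$ is the condition $dp>d+1$ for $d=1$. Parameters: $\beta:=p+m(p-1)-1$, $\gamma:=\frac{p-1}{m(p-1)-1}$, $\kappa:=\frac{m(p-1)-1}{mp}\beta^{-1/(p-1)}$, all positive. Barenblatt profile: for $t>0$, $r\ge 0$, $S(t,r):=C-\kappa[t^{-1/\beta}r]^{p/(p-1)}$ and $U(t,r):=t^{-1/\beta}\,\max\{S(t,r),0\}^\gamma$, where $C>0$ is the unique constant (depending only on $p,m$) such that $2\int_0^\infty U(t,r)\,\mathrm{d}r=1$ for every $t>0$. Put $\rho:=(C/\kappa)^{(p-1)/p}$; the support of $U(t,\cdot)$ is $[0,\rho t^{1/\beta}]$. The Barenblatt solution is $w^x(t,y):=U(t,|y-x|)$. Coefficients: for $0<r<\rho t^{1/\beta}$ let $a(t,r):=m^{p-1}|\partial_rU(t,r)|^{p-2}U(t,r)^{(m-1)(p-1)}$ and $a_r:=\partial_r a$; set $a(t,r):=a_r(t,r):=0$ for $r\ge\rho t^{1/\beta}$ and for $r=0$. For $z\in\mathbb{R}$, $\mathrm{sgn}\,z:=z/|z|$ if $z\ne0$, $\mathrm{sgn}\,0:=0$. Generator (in dimension one, $\nabla$, $\mathrm{div}$ are $\partial_y$ and $\Delta=\partial_y^2$): $\mathsf{L}_{p,m}^xu:=m^{p-1}\Delta[|\nabla w^x|^{p-2}(w^x)^{(m-1)(p-1)}u]-m^{p-1}\mathrm{div}[\nabla[|\nabla w^x|^{p-2}(w^x)^{(m-1)(p-1)}]\,u]$ whenever this makes sense;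 here $m^{p-1}|\nabla w^x(t,y)|^{p-2}w^x(t,y)^{(m-1)(p-1)}$ means $a(t,|y-x|)$. In the claim, $\mathsf{L}^x_{p,m}r^o(X_t)$ is the pointwise value at time $t$ and position $y=X_t$, with $y\notin\{x,o\}$ and $|y-x|\ne\rho t^{1/\beta}$ (the remaining points are visited only for a set of times of zero Lebesgue measure, a.s.). A stochastic basis is a complete probability space $(\Omega,\mathscr{F},\mathbf{P}^x)$ with a right-continuous filtration $\mathscr{F}_\bullet$ augmented by null sets; $\mathbf{E}^x$ denotes expectation. A probabilistically weak solution starting at $x\in\mathbb{R}$ is a continuous $\mathscr{F}_\bullet$-adapted real process $X$ on a stochastic basis carrying a standard $\mathscr{F}_\bullet$-Brownian motion $W$ on $\mathbb{R}$ such that (a) $\mathbf{E}^x[\int_0^t a(s,|X_s-x|)\,\mathrm{d}s]<\infty$ and $\mathbf{E}^x[\int_0^t|a_r(s,|X_s-x|)|\,\mathrm{d}s]<\infty$ for every $t>0$; (b) $\mathbf{P}^x$-a.s., for all $t\ge0$, $X_t=X_0+\int_0^t\sqrt{2a(s,|X_s-x|)}\,\mathrm{d}W_s+\int_0^t a_r(s,|X_s-x|)\,\mathrm{sgn}(X_s-x)\,\mathrm{d}s$; (c) for every $t>0$ the law of $X_t$ is $w^x(t,\cdot)\,\mathscr{L}^1$; consequently $X_0=x$ a.s. *)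

theory Defs
  imports "HOL-Probability.Probability"
begin

section \<open>Stochastic bases and Brownian motion\<close>

text \<open>Time is the half line \<open>[0,\<infinity>)\<close>, encoded as the nonnegative reals; processes and
  filtrations are functions on all of \<open>real\<close> whose values at negative times are never used.\<close>

locale stochastic_basis = prob_space M + complete_measure M
  for M :: "'a measure" and F :: "real \<Rightarrow> 'a measure" +
  assumes subalg: "0 \<le> t \<Longrightarrow> subalgebra M (F t)"
    and filt_mono: "0 \<le> s \<Longrightarrow> s \<le> t \<Longrightarrow> sets (F s) \<subseteq> sets (F t)"
    and right_continuous: "0 \<le> t \<Longrightarrow> sets (F t) = (\<Inter>s\<in>{t<..}. sets (F s))"
    and augmented: "0 \<le> t \<Longrightarrow> null_sets M \<subseteq> sets (F t)"

definition adapted_process :: "(real \<Rightarrow> 'a measure) \<Rightarrow> (real \<Rightarrow> 'a \<Rightarrow> real) \<Rightarrow> bool" where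
  "adapted_process F Z \<longleftrightarrow> (\<forall>t\<ge>0. Z t \<in> borel_measurable (F t))"

definition continuous_paths :: "'a measure \<Rightarrow> (real \<Rightarrow> 'a \<Rightarrow> real) \<Rightarrow> bool" where
  "continuous_paths M Z \<longleftrightarrow> (\<forall>\<omega>\<in>space M. continuous_on {0..} (\<lambda>t. Z t \<omega>))"

definition progressively_measurable ::
    "(real \<Rightarrow> 'a measure) \<Rightarrow> (real \<Rightarrow> 'a \<Rightarrow> real) \<Rightarrow> bool" where
  "progressively_measurable F H \<longleftrightarrow>
     (\<forall>t\<ge>0. (\<lambda>(s, \<omega>). H s \<omega>) \<in> borel_measurable (restrict_space borel {0..t} \<Otimes>\<^sub>M F t))"

definition brownian_motion ::
    "'a measure \<Rightarrow> (real \<Rightarrow> 'a measure) \<Rightarrow> (real \<Rightarrow> 'a \<Rightarrow> real) \<Rightarrow> bool" where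
  "brownian_motion M F W \<longleftrightarrow>
     adapted_process F W \<and> continuous_paths M W \<and> (AE \<omega> in M. W 0 \<omega> = 0) \<and>
     (\<forall>s t. 0 \<le> s \<and> s < t \<longrightarrow>
        distributed M lborel (\<lambda>\<omega>. W t \<omega> - W s \<omega>)
          (\<lambda>z. ennreal (normal_density 0 (sqrt (t - s)) z)) \<and>
        prob_space.indep_set M (sets (F s))
          {(\<lambda>\<omega>. W t \<omega> - W s \<omega>) -` A \<inter> space M | A. A \<in> sets borel})"


section \<open>The Ito integral\<close>

text \<open>A list of triples \<open>(u, v, \<xi>)\<close> represents the simple predictable process
  \<open>\<Sum> \<xi> 1\<^bsub>(u,v]\<^esub>\<close>; the intervals are allowed to overlap.\<close>

type_synonym 'a simple_steps = "(real \<times> real \<times> ('a \<Rightarrow> real)) list"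

definition simple_steps :: "(real \<Rightarrow> 'a measure) \<Rightarrow> 'a simple_steps \<Rightarrow> bool" where
  "simple_steps F es \<longleftrightarrow>
     (\<forall>(u, v, \<xi>)\<in>set es. 0 \<le> u \<and> u \<le> v \<and> \<xi> \<in> borel_measurable (F u) \<and>
        (\<exists>K. \<forall>\<omega>\<in>space (F u). \<bar>\<xi> \<omega>\<bar> \<le> K))"

definition simple_value :: "'a simple_steps \<Rightarrow> real \<Rightarrow> 'a \<Rightarrow> real" where
  "simple_value es s \<omega> = (\<Sum>(u, v, \<xi>)\<leftarrow>es. \<xi> \<omega> * indicator {u<..v} s)"

definition simple_integral ::
    "'a simple_steps \<Rightarrow> (real \<Rightarrow> 'a \<Rightarrow> real) \<Rightarrow> real \<Rightarrow> 'a \<Rightarrow> real" where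
  "simple_integral es W t \<omega> = (\<Sum>(u, v, \<xi>)\<leftarrow>es. \<xi> \<omega> * (W (min v t) \<omega> - W (min u t) \<omega>))"

text \<open>\<open>ito_integral M F W H I\<close> means that \<open>I\<close> is (a continuous version of) the process
  \<open>t \<mapsto> \<integral>\<^sub>0\<^sup>t H dW\<close>, for progressively measurable \<open>H\<close> with \<open>E \<integral>\<^sub>0\<^sup>t H\<^sup>2 ds < \<infinity>\<close> for all \<open>t\<close>: the
  \<open>L\<^sup>2\<close> limit of the elementary integrals of simple processes converging to \<open>H\<close>. By the Ito
  isometry, \<open>I\<close> does not depend on the approximating sequence, up to indistinguishability.\<close>

definition ito_integral :: "'a measure \<Rightarrow> (real \<Rightarrow> 'a measure) \<Rightarrow> (real \<Rightarrow> 'a \<Rightarrow> real) \<Rightarrow>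
    (real \<Rightarrow> 'a \<Rightarrow> real) \<Rightarrow> (real \<Rightarrow> 'a \<Rightarrow> real) \<Rightarrow> bool" where
  "ito_integral M F W H I \<longleftrightarrow>
     progressively_measurable F H \<and>
     (\<forall>t\<ge>0. (\<integral>\<^sup>+\<omega>. (\<integral>\<^sup>+s\<in>{0..t}. ennreal ((H s \<omega>)\<^sup>2) \<partial>lborel) \<partial>M) < \<infinity>) \<and>
     adapted_process F I \<and> continuous_paths M I \<and>
     (\<exists>es :: nat \<Rightarrow> 'a simple_steps.
        (\<forall>n. simple_steps F (es n)) \<and>
        (\<forall>t\<ge>0. (\<lambda>n. \<integral>\<^sup>+\<omega>. (\<integral>\<^sup>+s\<in>{0..t}. ennreal ((simple_value (es n) s \<omega> - H s \<omega>)\<^sup>2) \<partial>lborel) \<partial>M)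
           \<longlonglongrightarrow> 0) \<and>
        (\<forall>t\<ge>0. (\<lambda>n. \<integral>\<^sup>+\<omega>. ennreal ((simple_integral (es n) W t \<omega> - I t \<omega>)\<^sup>2) \<partial>M)
           \<longlonglongrightarrow> 0))"

definition locally_bounded_variation :: "(real \<Rightarrow> real) \<Rightarrow> bool" where
  "locally_bounded_variation f \<longleftrightarrow>
     (\<forall>t\<ge>0. \<exists>K. \<forall>n (\<tau> :: nat \<Rightarrow> real).
        (\<forall>i\<le>n. \<tau> i \<in> {0..t}) \<and> (\<forall>i<n. \<tau> i \<le> \<tau> (Suc i)) \<longrightarrow>
        (\<Sum>i<n. \<bar>f (\<tau> (Suc i)) - f (\<tau> i)\<bar>) \<le> K)"


section \<open>The Barenblatt solution in dimension one\<close>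

definition beta :: "real \<Rightarrow> real \<Rightarrow> real" where
  "beta p m = p + m * (p - 1) - 1"

definition gamma :: "real \<Rightarrow> real \<Rightarrow> real" where
  "gamma p m = (p - 1) / (m * (p - 1) - 1)"

definition kappa :: "real \<Rightarrow> real \<Rightarrow> real" where
  "kappa p m = (m * (p - 1) - 1) / (m * p) * beta p m powr (- 1 / (p - 1))"

definition profile_with_const :: "real \<Rightarrow> real \<Rightarrow> real \<Rightarrow> real \<Rightarrow> real \<Rightarrow> real" where
  "profile_with_const p m C t r =
     t powr (- 1 / beta p m) *
     (max (C - kappa p m * (t powr (- 1 / beta p m) * r) powr (p / (p - 1))) 0) powr gamma p m"

definition mass_const :: "real \<Rightarrow> real \<Rightarrow> real" where
  "mass_const p m =
     (THE C. C > 0 \<and> (\<forall>t>0. 2 * (LBINT r:{0..}. profile_with_const p m C t r) = 1))"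

definition profile :: "real \<Rightarrow> real \<Rightarrow> real \<Rightarrow> real \<Rightarrow> real" where
  "profile p m = profile_with_const p m (mass_const p m)"

definition barenblatt :: "real \<Rightarrow> real \<Rightarrow> real \<Rightarrow> real \<Rightarrow> real \<Rightarrow> real" where
  "barenblatt p m x t y = profile p m t \<bar>y - x\<bar>"

definition rho :: "real \<Rightarrow> real \<Rightarrow> real" where
  "rho p m = (mass_const p m / kappa p m) powr ((p - 1) / p)"

definition front :: "real \<Rightarrow> real \<Rightarrow> real \<Rightarrow> real" where
  "front p m t = rho p m * t powr (1 / beta p m)"

definition diff_coeff :: "real \<Rightarrow> real \<Rightarrow> real \<Rightarrow> real \<Rightarrow> real" where
  "diff_coeff p m t r =
     (if 0 < r \<and> r < front p m t
      then m powr (p - 1) * \<bar>deriv (profile p m t) r\<bar> powr (p - 2) *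
             profile p m t r powr ((m - 1) * (p - 1))
      else 0)"

definition diff_coeff_r :: "real \<Rightarrow> real \<Rightarrow> real \<Rightarrow> real \<Rightarrow> real" where
  "diff_coeff_r p m t r = (if 0 < r \<and> r < front p m t then deriv (diff_coeff p m t) r else 0)"

text \<open>The operator \<open>\<Delta>[A u] - div[\<nabla>A u]\<close> with \<open>A(y) = a(t,|y - x|)\<close>, as a pointwise value at time
  \<open>t\<close> and position \<open>y\<close>; meaningful where the derivatives exist.\<close>

definition generator ::
    "real \<Rightarrow> real \<Rightarrow> real \<Rightarrow> (real \<Rightarrow> real) \<Rightarrow> real \<Rightarrow> real \<Rightarrow> real" where
  "generator p m x u t y =
     deriv (deriv (\<lambda>z. diff_coeff p m t \<bar>z - x\<bar> * u z)) y
     - deriv (\<lambda>z. deriv (\<lambda>v. diff_coeff p m t \<bar>v - x\<bar>) z * u z) y"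

text \<open>The points at which the generator is evaluated on \<open>y \<mapsto> |y - o|\<close> (\<open>q\<close> stands for \<open>o\<close>,
  which is reserved for function composition).\<close>

definition regular_point :: "real \<Rightarrow> real \<Rightarrow> real \<Rightarrow> real \<Rightarrow> real \<Rightarrow> real \<Rightarrow> bool" where
  "regular_point p m x q t y \<longleftrightarrow> y \<noteq> x \<and> y \<noteq> q \<and> \<bar>y - x\<bar> \<noteq> front p m t"


section \<open>Probabilistically weak solutions\<close>

definition weak_solution :: "real \<Rightarrow> real \<Rightarrow> real \<Rightarrow> 'a measure \<Rightarrow> (real \<Rightarrow> 'a measure) \<Rightarrow>
    (real \<Rightarrow> 'a \<Rightarrow> real) \<Rightarrow> (real \<Rightarrow> 'a \<Rightarrow> real) \<Rightarrow> bool" where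
  "weak_solution p m x M F W X \<longleftrightarrow>
     stochastic_basis M F \<and> brownian_motion M F W \<and>
     adapted_process F X \<and> continuous_paths M X \<and>
     (\<forall>t>0. (\<integral>\<^sup>+\<omega>. (\<integral>\<^sup>+s\<in>{0..t}. ennreal (diff_coeff p m s \<bar>X s \<omega> - x\<bar>) \<partial>lborel) \<partial>M) < \<infinity>) \<and>
     (\<forall>t>0. (\<integral>\<^sup>+\<omega>. (\<integral>\<^sup>+s\<in>{0..t}. ennreal \<bar>diff_coeff_r p m s \<bar>X s \<omega> - x\<bar>\<bar> \<partial>lborel) \<partial>M) < \<infinity>) \<and>
     (\<exists>I. ito_integral M F W (\<lambda>s \<omega>. sqrt (2 * diff_coeff p m s \<bar>X s \<omega> - x\<bar>)) I \<and>
       (AE \<omega> in M. \<forall>t\<ge>0.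
          X t \<omega> = X 0 \<omega> + I t \<omega> +
            (LBINT s:{0..t}. diff_coeff_r p m s \<bar>X s \<omega> - x\<bar> * sgn (X s \<omega> - x)))) \<and>
     (\<forall>t>0. distributed M lborel (X t) (\<lambda>y. ennreal (barenblatt p m x t y)))"

end

theory Submission
  imports Defs
begin

text \<open>With \<open>Y = X - q\<close> and the right-continuous sign \<open>rsgn\<close>, let \<open>B = \<integral> rsgn(Y) dW\<close>. It is a Brownian motion,
  since along dyadic partitions the increments of \<open>W\<close> are multiplied by signs that are known in
  advance, which does not change their conditional characteristic function. No Ito formula is needed
  for the local time: as \<open>rsgn y\<close> is a subgradient of the absolute value at \<open>y\<close>, the sums
  \<open>\<Sum> rsgn(Y\<^bsub>t\<^esub>) (Y\<^bsub>t'\<^esub> - Y\<^bsub>t\<^esub>)\<close> over dyadic partitions grow at most as fast as \<open>|Y|\<close>, and they converge to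
  \<open>J + \<integral> rsgn(Y) dA\<close>, where \<open>A\<close> is the drift part of \<open>Y\<close> and \<open>J = \<integral> \<surd>(2a) dB\<close>; so the
  remainder \<open>L\<close> is nondecreasing. The law of \<open>X\<^bsub>t\<^esub>\<close> has a density, so almost surely \<open>Y\<close> vanishes
  only on a Lebesgue null set of times, which makes the value of the sign at \<open>0\<close> irrelevant. Inside the
  support, \<open>a(t,r)\<close> is a function of \<open>t\<close> times \<open>r\<^bsup>(p-2)/(p-1)\<^esup> S(t,r)\<close>, which gives the derivatives in
  the generator; and \<open>C > 0\<close> because otherwise the law of \<open>X\<^bsub>t\<^esub>\<close> would be zero.\<close>

section \<open>Square integrable functions\<close>

text \<open>The subgradient inequality holds between grid points, whereas stochastic integrals are
  limits in L2; dyadic grids reconcile the two. A fixed dyadic time lies on every finer grid, so at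
  two such times the discrete inequality holds for all large \<open>n\<close> and survives an almost
  sure limit along a subsequence. Countably many pairs of dyadic times cost one null set, and
  continuity of the paths does the rest. The remaining difficulty is that the sums over the
  martingale part must converge to an integral against \<open>B\<close> with the old integrand. This
  is an exchange of two limits, one in the mesh and one in the simple approximations of the
  integrand. It is possible because multiplying orthogonal increments by known signs does not
  increase second moments, whatever the mesh. Limits are known up to null sets only. Their
  adaptedness rests on the augmented filtration, and paths are set to 0 on exceptional sets to
  obtain continuity or monotonicity for every outcome.\<close>

definition sq_integrable :: "'a measure \<Rightarrow> ('a \<Rightarrow> real) \<Rightarrow> bool" where
  "sq_integrable M f \<longleftrightarrow> f \<in> borel_measurable M \<and> integrable M (\<lambda>\<omega>. (f \<omega>)\<^sup>2)"

lemma sq_integrable_measurable: "sq_integrable M f \<Longrightarrow> f \<in> borel_measurable M"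
  by (simp add: sq_integrable_def)

lemma sq_integrable_square: "sq_integrable M f \<Longrightarrow> integrable M (\<lambda>\<omega>. (f \<omega>)\<^sup>2)"
  by (simp add: sq_integrable_def)

lemma sq_integrable_mult_integrable:
  assumes "sq_integrable M f" "sq_integrable M g"
  shows "integrable M (\<lambda>\<omega>. f \<omega> * g \<omega>)"
proof (rule Bochner_Integration.integrable_bound)
  show "integrable M (\<lambda>\<omega>. (f \<omega>)\<^sup>2 + (g \<omega>)\<^sup>2)"
    using assms by (auto simp: sq_integrable_def)
  show "(\<lambda>\<omega>. f \<omega> * g \<omega>) \<in> borel_measurable M"
    using assms by (auto simp: sq_integrable_def)
  show "AE \<omega> in M. norm (f \<omega> * g \<omega>) \<le> norm ((f \<omega>)\<^sup>2 + (g \<omega>)\<^sup>2)"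
  proof (rule AE_I2)
    fix \<omega>
    have "0 \<le> (\<bar>f \<omega>\<bar> - \<bar>g \<omega>\<bar>)\<^sup>2" "0 \<le> (f \<omega>)\<^sup>2" "0 \<le> (g \<omega>)\<^sup>2" by simp_all
    moreover have "(\<bar>f \<omega>\<bar> - \<bar>g \<omega>\<bar>)\<^sup>2 = (f \<omega>)\<^sup>2 + (g \<omega>)\<^sup>2 - 2 * \<bar>f \<omega> * g \<omega>\<bar>"
      by (simp add: power2_diff abs_mult)
    ultimately show "norm (f \<omega> * g \<omega>) \<le> norm ((f \<omega>)\<^sup>2 + (g \<omega>)\<^sup>2)" by simp
  qed
qed

lemma sq_integrable_zero: "sq_integrable M (\<lambda>\<omega>. 0)"
  by (simp add: sq_integrable_def)

lemma sq_integrable_add: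
  assumes "sq_integrable M f" "sq_integrable M g"
  shows "sq_integrable M (\<lambda>\<omega>. f \<omega> + g \<omega>)"
proof -
  have "integrable M (\<lambda>\<omega>. (f \<omega>)\<^sup>2 + (g \<omega>)\<^sup>2 + 2 * (f \<omega> * g \<omega>))"
    using assms sq_integrable_mult_integrable[OF assms] by (auto simp: sq_integrable_def)
  then show ?thesis
    using assms by (auto simp: sq_integrable_def power2_sum mult.assoc)
qed

lemma sq_integrable_bounded_mult:
  assumes "sq_integrable M f" "\<xi> \<in> borel_measurable M" "\<And>\<omega>. \<omega> \<in> space M \<Longrightarrow> \<bar>\<xi> \<omega>\<bar> \<le> K"
  shows "sq_integrable M (\<lambda>\<omega>. \<xi> \<omega> * f \<omega>)"
proof -
  have "integrable M (\<lambda>\<omega>. (\<xi> \<omega> * f \<omega>)\<^sup>2)"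
  proof (rule Bochner_Integration.integrable_bound)
    show "integrable M (\<lambda>\<omega>. K\<^sup>2 * (f \<omega>)\<^sup>2)"
      using assms by (auto simp: sq_integrable_def)
    show "(\<lambda>\<omega>. (\<xi> \<omega> * f \<omega>)\<^sup>2) \<in> borel_measurable M"
      using assms by (auto simp: sq_integrable_def)
    show "AE \<omega> in M. norm ((\<xi> \<omega> * f \<omega>)\<^sup>2) \<le> norm (K\<^sup>2 * (f \<omega>)\<^sup>2)"
    proof (rule AE_I2)
      fix \<omega> assume "\<omega> \<in> space M"
      then have "\<bar>\<xi> \<omega>\<bar>\<^sup>2 \<le> K\<^sup>2" using assms(3) by (intro power_mono) auto
      then show "norm ((\<xi> \<omega> * f \<omega>)\<^sup>2) \<le> norm (K\<^sup>2 * (f \<omega>)\<^sup>2)"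
        by (simp add: power_mult_distrib mult_right_mono)
    qed
  qed
  then show ?thesis
    using assms by (auto simp: sq_integrable_def)
qed

lemma sq_integrable_cmult: "sq_integrable M f \<Longrightarrow> sq_integrable M (\<lambda>\<omega>. c * f \<omega>)"
  by (rule sq_integrable_bounded_mult[where K = "\<bar>c\<bar>"]) auto

lemma sq_integrable_diff:
  assumes "sq_integrable M f" "sq_integrable M g"
  shows "sq_integrable M (\<lambda>\<omega>. f \<omega> - g \<omega>)"
  using sq_integrable_add[OF assms(1) sq_integrable_cmult[OF assms(2), of "-1"]] by simp

lemma sq_integrable_nn_integral:
  "sq_integrable M f \<Longrightarrow> (\<integral>\<^sup>+\<omega>. ennreal ((f \<omega>)\<^sup>2) \<partial>M) = ennreal (\<integral>\<omega>. (f \<omega>)\<^sup>2 \<partial>M)"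
  by (intro nn_integral_eq_integral) (auto simp: sq_integrable_def)

lemma sq_integrableI:
  "f \<in> borel_measurable M \<Longrightarrow> (\<integral>\<^sup>+\<omega>. ennreal ((f \<omega>)\<^sup>2) \<partial>M) < \<infinity> \<Longrightarrow> sq_integrable M f"
  unfolding sq_integrable_def by (auto intro!: integrableI_nonneg)

lemma sq_integrable_cong_AE:
  assumes "sq_integrable M f" "g \<in> borel_measurable M" "AE \<omega> in M. f \<omega> = g \<omega>"
  shows "sq_integrable M g"
proof -
  have "integrable M (\<lambda>\<omega>. (g \<omega>)\<^sup>2)"
    using assms by (subst integrable_cong_AE[where g = "\<lambda>\<omega>. (f \<omega>)\<^sup>2"]) (auto simp: sq_integrable_def)
  then show ?thesis using assms by (simp add: sq_integrable_def)
qed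

section \<open>Cauchy-Schwarz inequality and mean square limits\<close>

lemma integral_Cauchy_Schwarz:
  assumes f: "sq_integrable M f" and g: "sq_integrable M g"
  shows "(\<integral>\<omega>. f \<omega> * g \<omega> \<partial>M)\<^sup>2 \<le> (\<integral>\<omega>. (f \<omega>)\<^sup>2 \<partial>M) * (\<integral>\<omega>. (g \<omega>)\<^sup>2 \<partial>M)"
proof -
  define A B C where "A = (\<integral>\<omega>. (f \<omega>)\<^sup>2 \<partial>M)" and "B = (\<integral>\<omega>. f \<omega> * g \<omega> \<partial>M)"
    and "C = (\<integral>\<omega>. (g \<omega>)\<^sup>2 \<partial>M)"
  have q: "0 \<le> x\<^sup>2 * A + 2 * x * B + C" for x :: real
  proof -
    have "0 \<le> (\<integral>\<omega>. (x * f \<omega> + g \<omega>)\<^sup>2 \<partial>M)" by simp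
    also have "(\<lambda>\<omega>. (x * f \<omega> + g \<omega>)\<^sup>2) = (\<lambda>\<omega>. x\<^sup>2 * (f \<omega>)\<^sup>2 + 2 * x * (f \<omega> * g \<omega>) + (g \<omega>)\<^sup>2)"
      by (auto simp: power2_sum power_mult_distrib algebra_simps)
    also have "(\<integral>\<omega>. x\<^sup>2 * (f \<omega>)\<^sup>2 + 2 * x * (f \<omega> * g \<omega>) + (g \<omega>)\<^sup>2 \<partial>M) = x\<^sup>2 * A + 2 * x * B + C"
      using f g sq_integrable_mult_integrable[OF f g]
      by (simp add: A_def B_def C_def sq_integrable_def)
    finally show ?thesis .
  qed
  have A0: "0 \<le> A" by (simp add: A_def)
  have C0: "0 \<le> C" by (simp add: C_def)
  have "B\<^sup>2 \<le> A * C"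
  proof (cases "A = 0")
    case True
    have "B = 0"
    proof (rule ccontr)
      assume "B \<noteq> 0"
      \<comment> \<open>With \<open>A = 0\<close> the quadratic is affine in \<open>x\<close>, and
        at this argument it equals -1.\<close>
      then show False using q[of "- (C + 1) / (2 * B)"] True by (simp add: field_simps)
    qed
    then show ?thesis using True by simp
  next
    case False
    then have "A > 0" using A0 by simp
    \<comment> \<open>\<open>- B / A\<close> minimizes the quadratic.\<close>
    then show ?thesis using q[of "- B / A"] by (simp add: field_simps power2_eq_square)
  qed
  then show ?thesis by (simp add: A_def B_def C_def)
qed

lemma integral_sq_add_le:
  assumes f: "sq_integrable M f" and g: "sq_integrable M g"
  shows "(\<integral>\<omega>. (f \<omega> + g \<omega>)\<^sup>2 \<partial>M) \<le> 2 * (\<integral>\<omega>. (f \<omega>)\<^sup>2 \<partial>M) + 2 * (\<integral>\<omega>. (g \<omega>)\<^sup>2 \<partial>M)"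
proof -
  have "(\<integral>\<omega>. (f \<omega> + g \<omega>)\<^sup>2 \<partial>M) \<le> (\<integral>\<omega>. 2 * (f \<omega>)\<^sup>2 + 2 * (g \<omega>)\<^sup>2 \<partial>M)"
  proof (rule integral_mono)
    show "integrable M (\<lambda>\<omega>. (f \<omega> + g \<omega>)\<^sup>2)"
      using sq_integrable_add[OF f g] by (simp add: sq_integrable_def)
    show "integrable M (\<lambda>\<omega>. 2 * (f \<omega>)\<^sup>2 + 2 * (g \<omega>)\<^sup>2)"
      using f g by (simp add: sq_integrable_def)
    fix \<omega> show "(f \<omega> + g \<omega>)\<^sup>2 \<le> 2 * (f \<omega>)\<^sup>2 + 2 * (g \<omega>)\<^sup>2"
      using sum_squares_ge_zero[of "f \<omega> - g \<omega>" 0] by (simp add: power2_eq_square algebra_simps)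
  qed
  also have "\<dots> = 2 * (\<integral>\<omega>. (f \<omega>)\<^sup>2 \<partial>M) + 2 * (\<integral>\<omega>. (g \<omega>)\<^sup>2 \<partial>M)"
    using f g by (simp add: sq_integrable_def)
  finally show ?thesis .
qed

text \<open>Mean square convergence gives weak convergence, by Cauchy-Schwarz. This is the form in
  which the orthogonality that defines a martingale passes to a limit.\<close>

lemma integral_mult_tendsto:
  assumes g: "sq_integrable M g" and f: "\<And>n. sq_integrable M (f n)" and l: "sq_integrable M l"
    and lim: "(\<lambda>n. \<integral>\<omega>. (f n \<omega> - l \<omega>)\<^sup>2 \<partial>M) \<longlonglongrightarrow> 0"
  shows "(\<lambda>n. \<integral>\<omega>. g \<omega> * f n \<omega> \<partial>M) \<longlonglongrightarrow> (\<integral>\<omega>. g \<omega> * l \<omega> \<partial>M)"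
proof -
  have d: "sq_integrable M (\<lambda>\<omega>. f n \<omega> - l \<omega>)" for n by (rule sq_integrable_diff[OF f l])
  have "(\<lambda>n. \<integral>\<omega>. g \<omega> * (f n \<omega> - l \<omega>) \<partial>M) \<longlonglongrightarrow> 0"
  proof (rule Lim_null_comparison)
    show "\<forall>\<^sub>F n in sequentially. norm (\<integral>\<omega>. g \<omega> * (f n \<omega> - l \<omega>) \<partial>M)
        \<le> sqrt ((\<integral>\<omega>. (g \<omega>)\<^sup>2 \<partial>M) * (\<integral>\<omega>. (f n \<omega> - l \<omega>)\<^sup>2 \<partial>M))"
      by (auto intro!: always_eventually real_le_rsqrt integral_Cauchy_Schwarz[OF g d])
    show "(\<lambda>n. sqrt ((\<integral>\<omega>. (g \<omega>)\<^sup>2 \<partial>M) * (\<integral>\<omega>. (f n \<omega> - l \<omega>)\<^sup>2 \<partial>M))) \<longlonglongrightarrow> 0"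
      using tendsto_real_sqrt[OF tendsto_mult_right_zero[OF lim, of "\<integral>\<omega>. (g \<omega>)\<^sup>2 \<partial>M"]] by simp
  qed
  then have "(\<lambda>n. (\<integral>\<omega>. g \<omega> * (f n \<omega> - l \<omega>) \<partial>M) + (\<integral>\<omega>. g \<omega> * l \<omega> \<partial>M)) \<longlonglongrightarrow> 0 + (\<integral>\<omega>. g \<omega> * l \<omega> \<partial>M)"
    by (intro tendsto_add) auto
  moreover have "(\<integral>\<omega>. g \<omega> * (f n \<omega> - l \<omega>) \<partial>M) + (\<integral>\<omega>. g \<omega> * l \<omega> \<partial>M) = (\<integral>\<omega>. g \<omega> * f n \<omega> \<partial>M)" for n
    using sq_integrable_mult_integrable[OF g f] sq_integrable_mult_integrable[OF g l]
    by (simp add: right_diff_distrib)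
  ultimately show ?thesis by simp
qed

text \<open>Turns mean square limits of stochastic integrals into pointwise ones, as needed for
  dominated convergence and for inequalities between paths.\<close>

lemma sq_tendsto_AE_subseq:
  assumes d: "\<And>n. sq_integrable M (\<lambda>\<omega>. f n \<omega> - l \<omega>)"
    and lim: "(\<lambda>n. \<integral>\<omega>. (f n \<omega> - l \<omega>)\<^sup>2 \<partial>M) \<longlonglongrightarrow> 0"
  shows "\<exists>r::nat \<Rightarrow> nat. strict_mono r \<and> (AE \<omega> in M. (\<lambda>n. f (r n) \<omega>) \<longlonglongrightarrow> l \<omega>)"
proof -
  have "\<exists>r::nat \<Rightarrow> nat. strict_mono r \<and> (AE \<omega> in M. (\<lambda>n. (f (r n) \<omega> - l \<omega>)\<^sup>2) \<longlonglongrightarrow> 0)"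
    by (rule tendsto_L1_AE_subseq) (use d lim in \<open>auto simp: sq_integrable_def\<close>)
  then obtain r :: "nat \<Rightarrow> nat" where r: "strict_mono r"
    and ae: "AE \<omega> in M. (\<lambda>n. (f (r n) \<omega> - l \<omega>)\<^sup>2) \<longlonglongrightarrow> 0" by blast
  have "AE \<omega> in M. (\<lambda>n. f (r n) \<omega>) \<longlonglongrightarrow> l \<omega>"
    using ae
  proof eventually_elim
    case (elim \<omega>)
    have "(\<lambda>n. sqrt ((f (r n) \<omega> - l \<omega>)\<^sup>2)) \<longlonglongrightarrow> sqrt 0" by (intro tendsto_real_sqrt elim)
    then have "(\<lambda>n. f (r n) \<omega> - l \<omega>) \<longlonglongrightarrow> 0" by (simp add: tendsto_rabs_zero_iff)
    then show ?case by (simp add: LIM_zero_iff)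
  qed
  with r show ?thesis by blast
qed

section \<open>Square integrable martingales\<close>

lemma simple_integral_Cons:
  "simple_integral ((u, v, \<xi>) # D) N t \<omega> = \<xi> \<omega> * (N (min v t) \<omega> - N (min u t) \<omega>) + simple_integral D N t \<omega>"
  by (simp add: simple_integral_def)

context stochastic_basis
begin

lemma space_F: "0 \<le> t \<Longrightarrow> space (F t) = space M"
  using subalg[of t] by (simp add: subalgebra_def)

lemma F_measurable_M: "0 \<le> t \<Longrightarrow> f \<in> measurable (F t) N \<Longrightarrow> f \<in> measurable M N"
  using measurable_from_subalg[OF subalg] .

lemma F_measurable_mono:
  assumes "f \<in> measurable (F s) N" "0 \<le> s" "s \<le> t"
  shows "f \<in> measurable (F t) N"
proof -
  have "subalgebra (F t) (F s)"
    using assms filt_mono[of s t] space_F[of s] space_F[of t] by (simp add: subalgebra_def)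
  then show ?thesis using assms measurable_from_subalg by blast
qed

lemma adapted_processD: "adapted_process F Z \<Longrightarrow> 0 \<le> t \<Longrightarrow> Z t \<in> borel_measurable (F t)"
  by (simp add: adapted_process_def)

lemma adapted_process_measurable: "adapted_process F Z \<Longrightarrow> 0 \<le> t \<Longrightarrow> Z t \<in> borel_measurable M"
  using F_measurable_M[OF _ adapted_processD] .

text \<open>Orthogonality of later increments to all square integrable variables known at time
  \<open>s\<close> replaces conditional expectations. In this form bounded known factors are
  absorbed into the test variable, and L2 limits follow from weak convergence.\<close>

definition l2_martingale :: "(real \<Rightarrow> 'a \<Rightarrow> real) \<Rightarrow> bool" where
  "l2_martingale N \<longleftrightarrow>
     (\<forall>t\<ge>0. N t \<in> borel_measurable (F t) \<and> sq_integrable M (N t)) \<and>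
     (\<forall>s t Z. 0 \<le> s \<longrightarrow> s \<le> t \<longrightarrow> Z \<in> borel_measurable (F s) \<longrightarrow> sq_integrable M Z \<longrightarrow>
        (\<integral>\<omega>. Z \<omega> * (N t \<omega> - N s \<omega>) \<partial>M) = 0)"

lemma l2_martingale_adapted: "l2_martingale N \<Longrightarrow> 0 \<le> t \<Longrightarrow> N t \<in> borel_measurable (F t)"
  and l2_martingale_sq: "l2_martingale N \<Longrightarrow> 0 \<le> t \<Longrightarrow> sq_integrable M (N t)"
  and l2_martingale_orth: "l2_martingale N \<Longrightarrow> 0 \<le> s \<Longrightarrow> s \<le> t \<Longrightarrow> Z \<in> borel_measurable (F s) \<Longrightarrow>
    sq_integrable M Z \<Longrightarrow> (\<integral>\<omega>. Z \<omega> * (N t \<omega> - N s \<omega>) \<partial>M) = 0"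
  by (auto simp: l2_martingale_def)

lemma l2_martingale_zero: "l2_martingale (\<lambda>t \<omega>. 0)"
  by (simp add: l2_martingale_def sq_integrable_zero)

lemma l2_martingale_add:
  assumes N: "l2_martingale N" and K: "l2_martingale K"
  shows "l2_martingale (\<lambda>t \<omega>. N t \<omega> + K t \<omega>)"
  unfolding l2_martingale_def
proof safe
  fix t :: real assume t: "0 \<le> t"
  show "(\<lambda>\<omega>. N t \<omega> + K t \<omega>) \<in> borel_measurable (F t)"
    using l2_martingale_adapted[OF N t] l2_martingale_adapted[OF K t] by simp
  show "sq_integrable M (\<lambda>\<omega>. N t \<omega> + K t \<omega>)"
    using l2_martingale_sq[OF N t] l2_martingale_sq[OF K t] by (rule sq_integrable_add)
next
  fix s t :: real and Z assume st: "0 \<le> s" "s \<le> t" and Z: "Z \<in> borel_measurable (F s)" "sq_integrable M Z"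
  have t: "0 \<le> t" using st by simp
  have i: "integrable M (\<lambda>\<omega>. Z \<omega> * (N t \<omega> - N s \<omega>))" "integrable M (\<lambda>\<omega>. Z \<omega> * (K t \<omega> - K s \<omega>))"
    using sq_integrable_mult_integrable[OF Z(2) sq_integrable_diff[OF l2_martingale_sq[OF N t] l2_martingale_sq[OF N st(1)]]]
      sq_integrable_mult_integrable[OF Z(2) sq_integrable_diff[OF l2_martingale_sq[OF K t] l2_martingale_sq[OF K st(1)]]] .
  have "(\<integral>\<omega>. Z \<omega> * (N t \<omega> + K t \<omega> - (N s \<omega> + K s \<omega>)) \<partial>M)
      = (\<integral>\<omega>. Z \<omega> * (N t \<omega> - N s \<omega>) + Z \<omega> * (K t \<omega> - K s \<omega>) \<partial>M)"
    by (simp add: algebra_simps)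
  also have "\<dots> = 0"
    using i l2_martingale_orth[OF N st Z] l2_martingale_orth[OF K st Z] by simp
  finally show "(\<integral>\<omega>. Z \<omega> * (N t \<omega> + K t \<omega> - (N s \<omega> + K s \<omega>)) \<partial>M) = 0" .
qed

lemma l2_martingale_cmult:
  assumes N: "l2_martingale N"
  shows "l2_martingale (\<lambda>t \<omega>. c * N t \<omega>)"
  unfolding l2_martingale_def
proof safe
  fix t :: real assume t: "0 \<le> t"
  show "(\<lambda>\<omega>. c * N t \<omega>) \<in> borel_measurable (F t)"
    using l2_martingale_adapted[OF N t] by simp
  show "sq_integrable M (\<lambda>\<omega>. c * N t \<omega>)"
    using l2_martingale_sq[OF N t] by (rule sq_integrable_cmult)
next
  fix s t :: real and Z assume st: "0 \<le> s" "s \<le> t" and Z: "Z \<in> borel_measurable (F s)" "sq_integrable M Z"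
  have "(\<lambda>\<omega>. Z \<omega> * (c * N t \<omega> - c * N s \<omega>)) = (\<lambda>\<omega>. c * (Z \<omega> * (N t \<omega> - N s \<omega>)))"
    by (auto simp: algebra_simps)
  then show "(\<integral>\<omega>. Z \<omega> * (c * N t \<omega> - c * N s \<omega>) \<partial>M) = 0"
    using l2_martingale_orth[OF N st Z] by simp
qed

lemma l2_martingale_diff:
  assumes "l2_martingale N" "l2_martingale K"
  shows "l2_martingale (\<lambda>t \<omega>. N t \<omega> - K t \<omega>)"
  using l2_martingale_add[OF assms(1) l2_martingale_cmult[OF assms(2), of "-1"]] by simp

text \<open>Makes martingales of Ito integrals, which are given only as L2 limits of elementary
  integrals.\<close>

lemma l2_martingale_limit:
  assumes N: "\<And>n::nat. l2_martingale (N n)"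
    and ad: "\<And>t. 0 \<le> t \<Longrightarrow> K t \<in> borel_measurable (F t)"
    and sq: "\<And>t. 0 \<le> t \<Longrightarrow> sq_integrable M (K t)"
    and lim: "\<And>t. 0 \<le> t \<Longrightarrow> (\<lambda>n. \<integral>\<omega>. (N n t \<omega> - K t \<omega>)\<^sup>2 \<partial>M) \<longlonglongrightarrow> 0"
  shows "l2_martingale K"
  unfolding l2_martingale_def
proof safe
  fix s t :: real and Z assume st: "0 \<le> s" "s \<le> t" and Z: "Z \<in> borel_measurable (F s)" "sq_integrable M Z"
  have t: "0 \<le> t" using st by simp
  have i: "integrable M (\<lambda>\<omega>. Z \<omega> * N n r \<omega>)" "integrable M (\<lambda>\<omega>. Z \<omega> * K r \<omega>)" if "0 \<le> r" for n r
    by (auto intro!: sq_integrable_mult_integrable l2_martingale_sq N Z sq that)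
  have "(\<lambda>n. (\<integral>\<omega>. Z \<omega> * N n t \<omega> \<partial>M) - (\<integral>\<omega>. Z \<omega> * N n s \<omega> \<partial>M))
     \<longlonglongrightarrow> (\<integral>\<omega>. Z \<omega> * K t \<omega> \<partial>M) - (\<integral>\<omega>. Z \<omega> * K s \<omega> \<partial>M)"
    by (intro tendsto_diff integral_mult_tendsto Z l2_martingale_sq N sq t st lim)
  moreover have "(\<integral>\<omega>. Z \<omega> * N n t \<omega> \<partial>M) - (\<integral>\<omega>. Z \<omega> * N n s \<omega> \<partial>M) = 0" for n
    using l2_martingale_orth[OF N[of n] st Z] i[OF t] i[OF st(1)] by (simp add: right_diff_distrib)
  ultimately have "(\<integral>\<omega>. Z \<omega> * K t \<omega> \<partial>M) - (\<integral>\<omega>. Z \<omega> * K s \<omega> \<partial>M) = 0"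
    by (simp add: LIMSEQ_const_iff)
  then show "(\<integral>\<omega>. Z \<omega> * (K t \<omega> - K s \<omega>) \<partial>M) = 0"
    using i[OF t] i[OF st(1)] by (simp add: right_diff_distrib)
qed (use ad sq in auto)

section \<open>Martingale transforms by simple processes\<close>

lemma adapted_step:
  fixes N :: "real \<Rightarrow> 'a \<Rightarrow> real"
  assumes N: "\<And>t. 0 \<le> t \<Longrightarrow> N t \<in> borel_measurable (F t)" and u: "0 \<le> u" "u \<le> v"
    and \<xi>: "\<xi> \<in> borel_measurable (F u)" and t: "0 \<le> t"
  shows "(\<lambda>\<omega>. \<xi> \<omega> * (N (min v t) \<omega> - N (min u t) \<omega>)) \<in> borel_measurable (F t)"
proof (cases "u \<le> t")
  case True
  have "N (min v t) \<in> borel_measurable (F t)" "N (min u t) \<in> borel_measurable (F t)"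
    using u t by (auto intro!: F_measurable_mono[OF N])
  then show ?thesis
    by (rule borel_measurable_times[OF F_measurable_mono[OF \<xi> u(1) True] borel_measurable_diff])
next
  case False
  \<comment> \<open>Before time \<open>u\<close> the factor \<open>\<xi>\<close> may not be known
    yet, but the increment vanishes.\<close>
  then have "min v t = t" "min u t = t" using u by auto
  then show ?thesis by simp
qed

text \<open>If \<open>s \<le> u < t\<close> or \<open>u < s < v\<close>, what remains is an
  increment of \<open>N\<close> after the later of \<open>s\<close> and \<open>u\<close>, multiplied
  by \<open>\<xi> * Z\<close>, which is known at that time; boundedness of \<open>\<xi>\<close>
  keeps this product square integrable. In the other two cases the transform does not move between
  \<open>s\<close> and \<open>t\<close>.\<close>

lemma l2_martingale_step:
  assumes N: "l2_martingale N" and u: "0 \<le> u" "u \<le> v" and \<xi>: "\<xi> \<in> borel_measurable (F u)"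
    and bd: "\<And>\<omega>. \<omega> \<in> space M \<Longrightarrow> \<bar>\<xi> \<omega>\<bar> \<le> K"
  shows "l2_martingale (\<lambda>t \<omega>. \<xi> \<omega> * (N (min v t) \<omega> - N (min u t) \<omega>))"
  unfolding l2_martingale_def
proof safe
  fix t :: real assume t: "0 \<le> t"
  show "(\<lambda>\<omega>. \<xi> \<omega> * (N (min v t) \<omega> - N (min u t) \<omega>)) \<in> borel_measurable (F t)"
    by (rule adapted_step[OF l2_martingale_adapted[OF N] u \<xi> t])
  show "sq_integrable M (\<lambda>\<omega>. \<xi> \<omega> * (N (min v t) \<omega> - N (min u t) \<omega>))"
    by (rule sq_integrable_bounded_mult[OF sq_integrable_diff[OF l2_martingale_sq[OF N] l2_martingale_sq[OF N]]
        F_measurable_M[OF u(1) \<xi>] bd]) (use u t in auto)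
next
  fix s t :: real and Z assume st: "0 \<le> s" "s \<le> t" and Z: "Z \<in> borel_measurable (F s)" "sq_integrable M Z"
  let ?D = "\<lambda>\<omega>. Z \<omega> * (\<xi> \<omega> * (N (min v t) \<omega> - N (min u t) \<omega>) - \<xi> \<omega> * (N (min v s) \<omega> - N (min u s) \<omega>))"
  have Z\<xi>: "sq_integrable M (\<lambda>\<omega>. \<xi> \<omega> * Z \<omega>)"
    by (rule sq_integrable_bounded_mult[OF Z(2) F_measurable_M[OF u(1) \<xi>] bd])
  consider "t \<le> u" | "s \<le> u" "u < t" | "u < s" "v \<le> s" | "u < s" "s < v" by linarith
  then show "(\<integral>\<omega>. ?D \<omega> \<partial>M) = 0"
  proof cases
    case 1
    then have "min v t = t" "min u t = t" "min v s = s" "min u s = s" using u st by auto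
    then show ?thesis by simp
  next
    case 2
    have "?D = (\<lambda>\<omega>. (\<xi> \<omega> * Z \<omega>) * (N (min v t) \<omega> - N u \<omega>))"
    proof -
      have "min v s = s" "min u s = s" "min u t = u" using 2 u by auto
      then show ?thesis by (simp add: algebra_simps)
    qed
    moreover have "(\<lambda>\<omega>. \<xi> \<omega> * Z \<omega>) \<in> borel_measurable (F u)"
      using F_measurable_mono[OF Z(1) st(1) 2(1)] \<xi> by simp
    ultimately show ?thesis using l2_martingale_orth[OF N u(1) _ _ Z\<xi>, of "min v t"] u 2 by simp
  next
    case 3
    then have "min v t = v" "min u t = u" "min v s = v" "min u s = u" using u st by auto
    then show ?thesis by simp
  next
    case 4
    have "?D = (\<lambda>\<omega>. (\<xi> \<omega> * Z \<omega>) * (N (min v t) \<omega> - N s \<omega>))"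
    proof -
      have "min v s = s" "min u s = u" "min u t = u" using 4 u st by auto
      then show ?thesis by (simp add: algebra_simps)
    qed
    moreover have "(\<lambda>\<omega>. \<xi> \<omega> * Z \<omega>) \<in> borel_measurable (F s)"
      using F_measurable_mono[OF \<xi> u(1), of s] Z 4 by simp
    ultimately show ?thesis using l2_martingale_orth[OF N st(1) _ _ Z\<xi>, of "min v t"] st 4 by simp
  qed
qed

lemma simple_steps_Nil: "simple_steps F []"
  by (simp add: simple_steps_def)

lemma simple_steps_Cons: "simple_steps F ((u, v, \<xi>) # D) \<longleftrightarrow>
  0 \<le> u \<and> u \<le> v \<and> \<xi> \<in> borel_measurable (F u) \<and> (\<exists>K. \<forall>\<omega>\<in>space M. \<bar>\<xi> \<omega>\<bar> \<le> K) \<and> simple_steps F D"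
  by (auto 0 3 simp: simple_steps_def space_F)

lemma simple_integral_adapted:
  assumes N: "\<And>t. 0 \<le> t \<Longrightarrow> N t \<in> borel_measurable (F t)" and D: "simple_steps F D" and t: "0 \<le> t"
  shows "simple_integral D N t \<in> borel_measurable (F t)"
  using D
proof (induction D)
  case Nil
  then show ?case by (simp add: simple_integral_def[abs_def])
next
  case (Cons e D)
  obtain u v \<xi> where e: "e = (u, v, \<xi>)" by (cases e) auto
  have u: "0 \<le> u" "u \<le> v" "\<xi> \<in> borel_measurable (F u)" and D: "simple_steps F D"
    using Cons.prems unfolding e simple_steps_Cons by auto
  have "(\<lambda>\<omega>. \<xi> \<omega> * (N (min v t) \<omega> - N (min u t) \<omega>)) \<in> borel_measurable (F t)"
    by (rule adapted_step[OF N u t])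
  then show ?case using Cons.IH[OF D] by (simp add: e simple_integral_Cons[abs_def])
qed

lemma l2_martingale_simple_integral:
  assumes N: "l2_martingale N" and D: "simple_steps F D"
  shows "l2_martingale (simple_integral D N)"
  using D
proof (induction D)
  case Nil
  show ?case using l2_martingale_zero by (simp add: simple_integral_def[abs_def])
next
  case (Cons e D)
  obtain u v \<xi> where e: "e = (u, v, \<xi>)" by (cases e) auto
  obtain K where K: "0 \<le> u" "u \<le> v" "\<xi> \<in> borel_measurable (F u)" "\<And>\<omega>. \<omega> \<in> space M \<Longrightarrow> \<bar>\<xi> \<omega>\<bar> \<le> K"
    and D: "simple_steps F D"
    using Cons.prems unfolding e simple_steps_Cons by blast
  show ?case
    using l2_martingale_add[OF l2_martingale_step[OF N K(1-3), of K] Cons.IH[OF D]] K(4)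
    by (simp add: e simple_integral_def[abs_def])
qed

section \<open>Brownian increments\<close>

lemma brownian_motionD:
  assumes "brownian_motion M F W"
  shows "0 \<le> t \<Longrightarrow> W t \<in> borel_measurable (F t)"
    and "\<omega> \<in> space M \<Longrightarrow> continuous_on {0..} (\<lambda>t. W t \<omega>)"
    and "AE \<omega> in M. W 0 \<omega> = 0"
    and "0 \<le> s \<Longrightarrow> s < t \<Longrightarrow> distributed M lborel (\<lambda>\<omega>. W t \<omega> - W s \<omega>)
          (\<lambda>z. ennreal (normal_density 0 (sqrt (t - s)) z))"
    and "0 \<le> s \<Longrightarrow> s < t \<Longrightarrow> indep_set (sets (F s))
          {(\<lambda>\<omega>. W t \<omega> - W s \<omega>) -` A \<inter> space M | A. A \<in> sets borel}"
  using assms by (auto simp: brownian_motion_def adapted_process_def continuous_paths_def)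

text \<open>The preimages under an increment already form a sigma-algebra, so independence passes to
  generated sigma-algebras without a Dynkin argument. The function \<open>h\<close> is general
  because the identity, the square and the complex exponential are all used.\<close>

lemma brownian_indep_var:
  fixes Z :: "'a \<Rightarrow> 'b::topological_space" and h :: "real \<Rightarrow> 'b"
  assumes W: "brownian_motion M F W" and st: "0 \<le> s" "s < t"
    and Z: "Z \<in> borel_measurable (F s)" and h[measurable]: "h \<in> borel_measurable borel"
  shows "indep_var borel Z borel (\<lambda>\<omega>. h (W t \<omega> - W s \<omega>))"
proof -
  let ?D = "\<lambda>\<omega>. W t \<omega> - W s \<omega>"
  have [measurable]: "W s \<in> borel_measurable M" "W t \<in> borel_measurable M" "Z \<in> borel_measurable M"
    using st Z by (auto intro!: F_measurable_M[OF _ brownian_motionD(1)[OF W]] intro: F_measurable_M)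
  have "sigma_sets (space M) {Z -` A \<inter> space M | A. A \<in> sets borel} \<subseteq> sets (F s)"
    using sets.sigma_sets_subset[of "{Z -` A \<inter> space M | A. A \<in> sets borel}" "F s"] st
      measurable_sets[OF Z] by (auto simp: space_F)
  moreover have "sigma_sets (space M) {(\<lambda>\<omega>. h (?D \<omega>)) -` A \<inter> space M | A. A \<in> sets borel}
      \<subseteq> {?D -` A \<inter> space M | A. A \<in> sets borel}"
  proof -
    let ?V = "vimage_algebra (space M) ?D borel"
    have V: "sets ?V = {?D -` A \<inter> space M | A. A \<in> sets borel}"
      by (rule sets_vimage_algebra2) auto
    have "(\<lambda>\<omega>. h (?D \<omega>)) -` A \<inter> space M \<in> sets ?V" if "A \<in> sets borel" for A
    proof -
      have "h -` A \<in> sets borel" using measurable_sets[OF h that] by simp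
      moreover have "(\<lambda>\<omega>. h (?D \<omega>)) -` A \<inter> space M = ?D -` (h -` A) \<inter> space M" by auto
      ultimately show ?thesis unfolding V by blast
    qed
    then have "sigma_sets (space ?V) {(\<lambda>\<omega>. h (?D \<omega>)) -` A \<inter> space M | A. A \<in> sets borel} \<subseteq> sets ?V"
      by (intro sets.sigma_sets_subset) auto
    then show ?thesis by (simp add: V)
  qed
  ultimately have "indep_set (sigma_sets (space M) {Z -` A \<inter> space M | A. A \<in> sets borel})
      (sigma_sets (space M) {(\<lambda>\<omega>. h (?D \<omega>)) -` A \<inter> space M | A. A \<in> sets borel})"
    using brownian_motionD(5)[OF W st] unfolding indep_sets2_eq by (meson subset_iff)
  then show ?thesis
    unfolding indep_var_eq by simp
qed

lemma brownian_increment_moments: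
  assumes W: "brownian_motion M F W" and st: "0 \<le> s" "s < t"
  shows "sq_integrable M (\<lambda>\<omega>. W t \<omega> - W s \<omega>)"
    and "(\<integral>\<omega>. W t \<omega> - W s \<omega> \<partial>M) = 0"
    and "(\<integral>\<omega>. (W t \<omega> - W s \<omega>)\<^sup>2 \<partial>M) = t - s"
proof -
  have pos: "0 < sqrt (t - s)" using st by simp
  note D = brownian_motionD(4)[OF W st]
  have [measurable]: "W s \<in> borel_measurable M" "W t \<in> borel_measurable M"
    using st by (auto intro!: F_measurable_M[OF _ brownian_motionD(1)[OF W]])
  have "integrable M (\<lambda>\<omega>. (W t \<omega> - W s \<omega>)\<^sup>2)"
    using distributed_integrable[OF D, of "\<lambda>z. z\<^sup>2"] integrable_normal_moment[OF pos, of 0 2] by simp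
  then show "sq_integrable M (\<lambda>\<omega>. W t \<omega> - W s \<omega>)" by (simp add: sq_integrable_def)
  show e: "(\<integral>\<omega>. W t \<omega> - W s \<omega> \<partial>M) = 0"
    by (rule normal_distributed_expectation[OF pos D])
  show "(\<integral>\<omega>. (W t \<omega> - W s \<omega>)\<^sup>2 \<partial>M) = t - s"
    using normal_distributed_variance[OF pos D] st by (simp add: e)
qed

lemma sq_integrable_integrable: "sq_integrable M f \<Longrightarrow> integrable M f"
  using sq_integrable_mult_integrable[of M f "\<lambda>_. 1"] by (simp add: sq_integrable_def)

lemma brownian_l2_martingale:
  assumes W: "brownian_motion M F W"
  shows "l2_martingale W"
  unfolding l2_martingale_def
proof safe
  fix t :: real assume t: "0 \<le> t"
  show m: "W t \<in> borel_measurable (F t)" by (rule brownian_motionD(1)[OF W t])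
  have [measurable]: "W t \<in> borel_measurable M" "W 0 \<in> borel_measurable M"
    using t by (auto intro!: F_measurable_M[OF _ brownian_motionD(1)[OF W]])
  \<comment> \<open>The definition controls increments only, and \<open>W 0\<close> vanishes almost
    surely, so \<open>W t\<close> is compared with its increment from time 0.\<close>
  have "sq_integrable M (\<lambda>\<omega>. W t \<omega> - W 0 \<omega>)"
  proof (cases "t = 0")
    case True then show ?thesis by (simp add: sq_integrable_zero)
  next
    case False then show ?thesis using brownian_increment_moments(1)[OF W, of 0 t] t by simp
  qed
  then show "sq_integrable M (W t)"
    by (rule sq_integrable_cong_AE) (use brownian_motionD(3)[OF W] in auto)
next
  fix s t :: real and Z assume st: "0 \<le> s" "s \<le> t" and Z: "Z \<in> borel_measurable (F s)" "sq_integrable M Z"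
  show "(\<integral>\<omega>. Z \<omega> * (W t \<omega> - W s \<omega>) \<partial>M) = 0"
  proof (cases "s = t")
    case False
    then have "s < t" using st by simp
    note mom = brownian_increment_moments[OF W st(1) this]
    show ?thesis
      using indep_var_lebesgue_integral[OF brownian_indep_var[OF W st(1) \<open>s < t\<close> Z(1), of "\<lambda>x. x"]]
        sq_integrable_integrable[OF Z(2)] sq_integrable_integrable[OF mom(1)] mom(2) by simp
  qed simp
qed

end

section \<open>The Ito isometry for simple processes\<close>

lemma simple_integral_nth:
  "simple_integral D W t \<omega> = (\<Sum>i<length D. snd (snd (D ! i)) \<omega> *
     (W (min (fst (snd (D ! i))) t) \<omega> - W (min (fst (D ! i)) t) \<omega>))"
  by (simp add: simple_integral_def sum_list_sum_nth atLeast0LessThan case_prod_unfold)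

lemma simple_value_nth:
  "simple_value D s \<omega> = (\<Sum>i<length D. snd (snd (D ! i)) \<omega> *
     indicator {fst (D ! i)<..fst (snd (D ! i))} s)"
  by (simp add: simple_value_def sum_list_sum_nth atLeast0LessThan case_prod_unfold)

lemma integral_double_sum:
  fixes f :: "nat \<Rightarrow> nat \<Rightarrow> 'a \<Rightarrow> real"
  assumes "\<And>i j. i < n \<Longrightarrow> j < n \<Longrightarrow> integrable M (f i j)"
  shows "(\<integral>x. (\<Sum>i<n. \<Sum>j<n. f i j x) \<partial>M) = (\<Sum>i<n. \<Sum>j<n. \<integral>x. f i j x \<partial>M)"
proof -
  have "(\<integral>x. (\<Sum>i<n. \<Sum>j<n. f i j x) \<partial>M) = (\<Sum>i<n. \<integral>x. (\<Sum>j<n. f i j x) \<partial>M)"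
    using assms by (intro Bochner_Integration.integral_sum Bochner_Integration.integrable_sum) auto
  also have "\<dots> = (\<Sum>i<n. \<Sum>j<n. \<integral>x. f i j x \<partial>M)"
    using assms by (intro sum.cong refl Bochner_Integration.integral_sum) auto
  finally show ?thesis .
qed

context stochastic_basis
begin

lemma simple_steps_nth:
  assumes "simple_steps F D" "i < length D"
  shows "0 \<le> fst (D ! i)" "fst (D ! i) \<le> fst (snd (D ! i))"
    "snd (snd (D ! i)) \<in> borel_measurable (F (fst (D ! i)))"
    "\<exists>K. \<forall>\<omega>\<in>space M. \<bar>snd (snd (D ! i)) \<omega>\<bar> \<le> K"
proof -
  obtain u v \<xi> where e: "D ! i = (u, v, \<xi>)" by (cases "D ! i") auto
  have "D ! i \<in> set D" using assms by simp
  then have "0 \<le> u \<and> u \<le> v \<and> \<xi> \<in> borel_measurable (F u) \<and> (\<exists>K. \<forall>\<omega>\<in>space (F u). \<bar>\<xi> \<omega>\<bar> \<le> K)"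
    using assms(1) unfolding simple_steps_def e by blast
  then show "0 \<le> fst (D ! i)" "fst (D ! i) \<le> fst (snd (D ! i))"
    "snd (snd (D ! i)) \<in> borel_measurable (F (fst (D ! i)))"
    "\<exists>K. \<forall>\<omega>\<in>space M. \<bar>snd (snd (D ! i)) \<omega>\<bar> \<le> K"
    using space_F[of u] by (simp_all add: e)
qed

lemma bounded_mult_bounded:
  assumes "\<exists>K. \<forall>\<omega>\<in>space M. \<bar>f \<omega>\<bar> \<le> (K::real)" "\<exists>K. \<forall>\<omega>\<in>space M. \<bar>g \<omega>\<bar> \<le> (K::real)"
  shows "\<exists>K. \<forall>\<omega>\<in>space M. \<bar>f \<omega> * g \<omega>\<bar> \<le> K"
proof -
  obtain K L where K: "\<forall>\<omega>\<in>space M. \<bar>f \<omega>\<bar> \<le> K" and L: "\<forall>\<omega>\<in>space M. \<bar>g \<omega>\<bar> \<le> L"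
    using assms by blast
  have "\<bar>f \<omega> * g \<omega>\<bar> \<le> K * L" if "\<omega> \<in> space M" for \<omega>
  proof -
    have "\<bar>f \<omega>\<bar> \<le> K" "\<bar>g \<omega>\<bar> \<le> L" using K L that by auto
    then have "\<bar>f \<omega>\<bar> * \<bar>g \<omega>\<bar> \<le> K * L" by (intro mult_mono) auto
    then show ?thesis by (simp add: abs_mult)
  qed
  then show ?thesis by blast
qed

lemma integrable_bounded_measurable:
  assumes "f \<in> borel_measurable M" "\<exists>K. \<forall>\<omega>\<in>space M. \<bar>f \<omega>\<bar> \<le> (K::real)"
  shows "integrable M f"
  using assms by (auto intro!: integrable_const_bound AE_I2)

text \<open>The left increment is cut at \<open>a'\<close>. What precedes \<open>a'\<close> is known
  when the right increment starts and is orthogonal to it. Of the rest only the part common to both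
  increments survives; its square is independent of \<open>\<xi> * \<eta>\<close> and has its length
  as mean. The order \<open>a \<le> a'\<close> is no loss, by symmetry.\<close>

lemma brownian_increment_covariance:
  assumes W: "brownian_motion M F W" and a: "0 \<le> a" "a \<le> b" and a': "a \<le> a'" "a' \<le> b'"
    and \<xi>: "\<xi> \<in> borel_measurable (F a)" "\<exists>K. \<forall>\<omega>\<in>space M. \<bar>\<xi> \<omega>\<bar> \<le> K"
    and \<eta>: "\<eta> \<in> borel_measurable (F a')" "\<exists>K. \<forall>\<omega>\<in>space M. \<bar>\<eta> \<omega>\<bar> \<le> K"
  shows "(\<integral>\<omega>. (\<xi> \<omega> * (W b \<omega> - W a \<omega>)) * (\<eta> \<omega> * (W b' \<omega> - W a' \<omega>)) \<partial>M)
    = (\<integral>\<omega>. \<xi> \<omega> * \<eta> \<omega> \<partial>M) * max 0 (min b b' - a')"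
proof -
  define Z where "Z = (\<lambda>\<omega>. \<xi> \<omega> * \<eta> \<omega>)"
  have a'0: "0 \<le> a'" using a a' by simp
  have Zm: "Z \<in> borel_measurable (F a')"
    using F_measurable_mono[OF \<xi>(1) a(1) a'(1)] \<eta>(1) by (simp add: Z_def)
  have ZM: "Z \<in> borel_measurable M" by (rule F_measurable_M[OF a'0 Zm])
  obtain K where K: "\<And>\<omega>. \<omega> \<in> space M \<Longrightarrow> \<bar>Z \<omega>\<bar> \<le> K"
    using bounded_mult_bounded[OF \<xi>(2) \<eta>(2)] by (auto simp: Z_def)
  note N = brownian_l2_martingale[OF W]
  have sq: "sq_integrable M (\<lambda>\<omega>. W r \<omega> - W q \<omega>)" if "0 \<le> r" "0 \<le> q" for r q
    by (rule sq_integrable_diff[OF l2_martingale_sq[OF N that(1)] l2_martingale_sq[OF N that(2)]])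
  have Zsq: "sq_integrable M (\<lambda>\<omega>. Z \<omega> * (W r \<omega> - W q \<omega>))" if "0 \<le> r" "0 \<le> q" for r q
    by (rule sq_integrable_bounded_mult[OF sq[OF that] ZM K])
  have orth: "(\<integral>\<omega>. (Z \<omega> * (W r \<omega> - W q \<omega>)) * (W z \<omega> - W y \<omega>) \<partial>M) = 0"
    if "0 \<le> r" "0 \<le> q" "r \<le> y" "q \<le> y" "a' \<le> y" "y \<le> z" for r q y z
  proof (rule l2_martingale_orth[OF N _ _ _ Zsq])
    have "W r \<in> borel_measurable (F y)" "W q \<in> borel_measurable (F y)" "Z \<in> borel_measurable (F y)"
      using that a'0 Zm by (auto intro: F_measurable_mono[OF brownian_motionD(1)[OF W]] F_measurable_mono)
    then show "(\<lambda>\<omega>. Z \<omega> * (W r \<omega> - W q \<omega>)) \<in> borel_measurable (F y)" by simp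
  qed (use that in auto)
  have eq: "(\<lambda>\<omega>. (\<xi> \<omega> * (W b \<omega> - W a \<omega>)) * (\<eta> \<omega> * (W b' \<omega> - W a' \<omega>)))
      = (\<lambda>\<omega>. (Z \<omega> * (W b \<omega> - W a \<omega>)) * (W b' \<omega> - W a' \<omega>))"
    by (auto simp: Z_def algebra_simps)
  show ?thesis
  proof (cases "b \<le> a'")
    case True
    then show ?thesis unfolding eq using orth[of b a a' b'] a a' by simp
  next
    case False
    then have ba: "a' < b" by simp
    \<comment> \<open>Two increments starting at the same time \<open>a'\<close> may be exchanged,
      so only the earlier end \<open>c\<close> and the later end \<open>d\<close> matter; the piece
      from \<open>c\<close> to \<open>d\<close> is again orthogonal.\<close>
    define c d where "c = min b b'" and "d = max b b'"
    have cd: "a' \<le> c" "c \<le> d" "0 \<le> c" "0 \<le> d" using ba a' a'0 by (auto simp: c_def d_def)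
    have b0: "0 \<le> b" "0 \<le> b'" using a a' by auto
    have "(\<integral>\<omega>. (Z \<omega> * (W b \<omega> - W a \<omega>)) * (W b' \<omega> - W a' \<omega>) \<partial>M)
        = (\<integral>\<omega>. (Z \<omega> * (W a' \<omega> - W a \<omega>)) * (W b' \<omega> - W a' \<omega>)
            + (Z \<omega> * (W b \<omega> - W a' \<omega>)) * (W b' \<omega> - W a' \<omega>) \<partial>M)"
      by (simp add: algebra_simps)
    also have "\<dots> = (\<integral>\<omega>. (Z \<omega> * (W a' \<omega> - W a \<omega>)) * (W b' \<omega> - W a' \<omega>) \<partial>M)
        + (\<integral>\<omega>. (Z \<omega> * (W b \<omega> - W a' \<omega>)) * (W b' \<omega> - W a' \<omega>) \<partial>M)"
      by (rule Bochner_Integration.integral_add)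
        (rule sq_integrable_mult_integrable[OF Zsq sq]; use a a'0 b0 in simp)+
    also have "(\<integral>\<omega>. (Z \<omega> * (W a' \<omega> - W a \<omega>)) * (W b' \<omega> - W a' \<omega>) \<partial>M) = 0"
      by (rule orth) (use a a' a'0 in auto)
    also have "(\<lambda>\<omega>. (Z \<omega> * (W b \<omega> - W a' \<omega>)) * (W b' \<omega> - W a' \<omega>))
      = (\<lambda>\<omega>. (Z \<omega> * (W c \<omega> - W a' \<omega>)) * (W c \<omega> - W a' \<omega>) + (Z \<omega> * (W c \<omega> - W a' \<omega>)) * (W d \<omega> - W c \<omega>))"
    proof (cases "b \<le> b'")
      case True
      then have "c = b" "d = b'" by (auto simp: c_def d_def)
      then show ?thesis by (auto simp: algebra_simps)
    next
      case False
      then have "c = b'" "d = b" by (auto simp: c_def d_def)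
      then show ?thesis by (auto simp: algebra_simps)
    qed
    also have "(\<integral>\<omega>. (Z \<omega> * (W c \<omega> - W a' \<omega>)) * (W c \<omega> - W a' \<omega>) + (Z \<omega> * (W c \<omega> - W a' \<omega>)) * (W d \<omega> - W c \<omega>) \<partial>M)
      = (\<integral>\<omega>. (Z \<omega> * (W c \<omega> - W a' \<omega>)) * (W c \<omega> - W a' \<omega>) \<partial>M)
        + (\<integral>\<omega>. (Z \<omega> * (W c \<omega> - W a' \<omega>)) * (W d \<omega> - W c \<omega>) \<partial>M)"
      by (rule Bochner_Integration.integral_add)
        (rule sq_integrable_mult_integrable[OF Zsq sq]; use cd a'0 in simp)+
    also have "(\<integral>\<omega>. (Z \<omega> * (W c \<omega> - W a' \<omega>)) * (W d \<omega> - W c \<omega>) \<partial>M) = 0"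
      by (rule orth) (use cd a'0 in auto)
    also have "(\<integral>\<omega>. (Z \<omega> * (W c \<omega> - W a' \<omega>)) * (W c \<omega> - W a' \<omega>) \<partial>M) = (\<integral>\<omega>. Z \<omega> \<partial>M) * (c - a')"
    proof (cases "c = a'")
      case False
      then have lt: "a' < c" using cd by simp
      note mom = brownian_increment_moments[OF W a'0 lt]
      have "integrable M Z"
        using integrable_bounded_measurable[OF ZM] K by blast
      then show ?thesis
        using indep_var_lebesgue_integral[OF brownian_indep_var[OF W a'0 lt Zm, of "\<lambda>x. x\<^sup>2"]]
          sq_integrable_square[OF mom(1)] mom(3) by (simp add: power2_eq_square mult.assoc)
    qed simp
    finally show ?thesis unfolding eq using cd by (simp add: c_def Z_def)
  qed
qed

text \<open>Stopping at \<open>t\<close> either kills one of the increments or leaves both left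
  endpoints unchanged. The two orders of the left endpoints are exchanged by commutativity.\<close>

lemma brownian_step_covariance:
  assumes W: "brownian_motion M F W" and u: "0 \<le> u" "u \<le> v" and u': "0 \<le> u'" "u' \<le> v'" and t: "0 \<le> t"
    and \<xi>: "\<xi> \<in> borel_measurable (F u)" "\<exists>K. \<forall>\<omega>\<in>space M. \<bar>\<xi> \<omega>\<bar> \<le> K"
    and \<eta>: "\<eta> \<in> borel_measurable (F u')" "\<exists>K. \<forall>\<omega>\<in>space M. \<bar>\<eta> \<omega>\<bar> \<le> K"
  shows "(\<integral>\<omega>. (\<xi> \<omega> * (W (min v t) \<omega> - W (min u t) \<omega>)) * (\<eta> \<omega> * (W (min v' t) \<omega> - W (min u' t) \<omega>)) \<partial>M)
    = (\<integral>\<omega>. \<xi> \<omega> * \<eta> \<omega> \<partial>M) * measure lborel ({u<..v} \<inter> {u'<..v'} \<inter> {0..t})"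
proof -
  have m: "measure lborel ({u<..v} \<inter> {u'<..v'} \<inter> {0..t}) = max 0 (min (min v v') t - max u u')"
  proof -
    have "{u<..v} \<inter> {u'<..v'} \<inter> {0..t} = {max u u'<..min (min v v') t}" using u u' by auto
    then show ?thesis by (cases "max u u' \<le> min (min v v') t") (auto simp: max_def)
  qed
  consider "t < u \<or> t < u'" | "u \<le> u'" "u' \<le> t" | "u' \<le> u" "u \<le> t" by linarith
  then show ?thesis
  proof cases
    case 1
    then have "(min v t = t \<and> min u t = t) \<or> (min v' t = t \<and> min u' t = t)" using u u' by linarith
    moreover have "max 0 (min (min v v') t - max u u') = 0" using 1 by linarith
    ultimately show ?thesis unfolding m by (elim disjE conjE) simp_all
  next
    case 2
    have e: "min u t = u" "min u' t = u'" using 2 by auto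
    have x: "max 0 (min (min v v') t - max u u') = max 0 (min (min v t) (min v' t) - u')"
      using 2 by linarith
    show ?thesis unfolding m e x
      by (rule brownian_increment_covariance[OF W u(1) _ 2(1) _ \<xi> \<eta>]) (use u u' 2 in auto)
  next
    case 3
    have e: "min u t = u" "min u' t = u'" using 3 by auto
    have x: "max 0 (min (min v v') t - max u u') = max 0 (min (min v' t) (min v t) - u)"
      using 3 by linarith
    have y: "(\<lambda>\<omega>. (\<xi> \<omega> * (W (min v t) \<omega> - W u \<omega>)) * (\<eta> \<omega> * (W (min v' t) \<omega> - W u' \<omega>)))
       = (\<lambda>\<omega>. (\<eta> \<omega> * (W (min v' t) \<omega> - W u' \<omega>)) * (\<xi> \<omega> * (W (min v t) \<omega> - W u \<omega>)))"
      "(\<lambda>\<omega>. \<xi> \<omega> * \<eta> \<omega>) = (\<lambda>\<omega>. \<eta> \<omega> * \<xi> \<omega>)"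
      by (simp_all only: mult.commute)
    show ?thesis unfolding m e x y
      by (rule brownian_increment_covariance[OF W u'(1) _ 3(1) _ \<eta> \<xi>]) (use u u' 3 in auto)
  qed
qed

text \<open>The intervals of a simple process may overlap, so distinct steps need not be orthogonal.
  Both sides are expanded into double sums instead: the covariance of two steps carries the length
  of the overlap of their intervals, which is also the integral of the product of their indicators.
  Nonnegative integrals match the convergence used in \<open>ito_integral\<close>.\<close>

lemma simple_integral_isometry:
  assumes W: "brownian_motion M F W" and D: "simple_steps F D" and t: "0 \<le> t"
  shows "(\<integral>\<^sup>+\<omega>. ennreal ((simple_integral D W t \<omega>)\<^sup>2) \<partial>M)
    = (\<integral>\<^sup>+\<omega>. (\<integral>\<^sup>+s\<in>{0..t}. ennreal ((simple_value D s \<omega>)\<^sup>2) \<partial>lborel) \<partial>M)"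
proof -
  define n where "n = length D"
  define u v \<xi> where "u i = fst (D ! i)" and "v i = fst (snd (D ! i))" and "\<xi> i = snd (snd (D ! i))" for i
  have st: "0 \<le> u i" "u i \<le> v i" "\<xi> i \<in> borel_measurable (F (u i))" "\<exists>K. \<forall>\<omega>\<in>space M. \<bar>\<xi> i \<omega>\<bar> \<le> K"
    if "i < n" for i
    using simple_steps_nth[OF D, of i] that by (auto simp: u_def v_def \<xi>_def n_def)
  have st': "\<xi> i \<in> borel_measurable M" if "i < n" for i
    by (rule F_measurable_M[OF st(1)[OF that] st(3)[OF that]])
  note N = brownian_l2_martingale[OF W]
  define w where "w i \<omega> = \<xi> i \<omega> * (W (min (v i) t) \<omega> - W (min (u i) t) \<omega>)" for i \<omega>
  define \<mu> where "\<mu> i j = measure lborel ({u i<..v i} \<inter> {u j<..v j} \<inter> {0..t})" for i j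
  have wsq: "sq_integrable M (w i)" if "i < n" for i
  proof -
    obtain K where K: "\<And>\<omega>. \<omega> \<in> space M \<Longrightarrow> \<bar>\<xi> i \<omega>\<bar> \<le> K" using st(4)[of i] \<open>i < n\<close> by blast
    have "sq_integrable M (\<lambda>\<omega>. \<xi> i \<omega> * (W (min (v i) t) \<omega> - W (min (u i) t) \<omega>))"
      by (rule sq_integrable_bounded_mult[OF sq_integrable_diff[OF l2_martingale_sq[OF N] l2_martingale_sq[OF N]] st'[OF that] K])
        (use st[OF that] t in auto)
    then show ?thesis by (simp add: w_def[abs_def])
  qed
  have I: "simple_integral D W t = (\<lambda>\<omega>. \<Sum>i<n. w i \<omega>)"
    by (auto simp: simple_integral_nth w_def u_def v_def \<xi>_def n_def)
  have V: "simple_value D s \<omega> = (\<Sum>i<n. \<xi> i \<omega> * indicator {u i<..v i} s)" for s \<omega>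
    by (auto simp: simple_value_nth u_def v_def \<xi>_def n_def)
  have I_sq: "sq_integrable M (simple_integral D W t)"
    by (rule l2_martingale_sq[OF l2_martingale_simple_integral[OF N D] t])
  have \<xi>int: "integrable M (\<lambda>\<omega>. \<xi> i \<omega> * \<xi> j \<omega>)" if "i < n" "j < n" for i j
    by (rule integrable_bounded_measurable[OF _ bounded_mult_bounded[OF st(4)[OF that(1)] st(4)[OF that(2)]]])
      (use st'[OF that(1)] st'[OF that(2)] in simp)
  have "(\<integral>\<omega>. (simple_integral D W t \<omega>)\<^sup>2 \<partial>M) = (\<integral>\<omega>. (\<Sum>i<n. \<Sum>j<n. w i \<omega> * w j \<omega>) \<partial>M)"
    by (simp add: I power2_eq_square sum_product)
  also have "\<dots> = (\<Sum>i<n. \<Sum>j<n. \<integral>\<omega>. w i \<omega> * w j \<omega> \<partial>M)"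
    by (rule integral_double_sum) (rule sq_integrable_mult_integrable[OF wsq wsq])
  also have "\<dots> = (\<Sum>i<n. \<Sum>j<n. (\<integral>\<omega>. \<xi> i \<omega> * \<xi> j \<omega> \<partial>M) * \<mu> i j)"
    unfolding w_def \<mu>_def by (intro sum.cong refl brownian_step_covariance[OF W _ _ _ _ t]) (use st in auto)
  also have "\<dots> = (\<integral>\<omega>. (\<Sum>i<n. \<Sum>j<n. \<xi> i \<omega> * \<xi> j \<omega> * \<mu> i j) \<partial>M)"
    using \<xi>int by (subst integral_double_sum) auto
  finally have eq: "(\<integral>\<omega>. (simple_integral D W t \<omega>)\<^sup>2 \<partial>M) = (\<integral>\<omega>. (\<Sum>i<n. \<Sum>j<n. \<xi> i \<omega> * \<xi> j \<omega> * \<mu> i j) \<partial>M)" .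
  \<comment> \<open>For each outcome the double sum is the integral of a square. This provides the
    sign needed to return to nonnegative integrals over \<open>M\<close>.\<close>
  have inner: "(\<integral>\<^sup>+s\<in>{0..t}. ennreal ((simple_value D s \<omega>)\<^sup>2) \<partial>lborel) = ennreal (\<Sum>i<n. \<Sum>j<n. \<xi> i \<omega> * \<xi> j \<omega> * \<mu> i j)
     \<and> 0 \<le> (\<Sum>i<n. \<Sum>j<n. \<xi> i \<omega> * \<xi> j \<omega> * \<mu> i j)" for \<omega>
  proof -
    have e: "(simple_value D s \<omega>)\<^sup>2 * indicator {0..t} s
        = (\<Sum>i<n. \<Sum>j<n. \<xi> i \<omega> * \<xi> j \<omega> * indicator ({u i<..v i} \<inter> {u j<..v j} \<inter> {0..t}) s)" for s
      unfolding V power2_eq_square sum_product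
      unfolding sum_distrib_right
      by (intro sum.cong refl) (simp only: indicator_inter_arith mult_ac)
    have fin: "emeasure lborel ({u i<..v i} \<inter> {u j<..v j} \<inter> {0..t}) < \<infinity>" for i j
      by (rule le_less_trans[OF emeasure_mono[of _ "{0..t}"]]) (use t in auto)
    have int1: "integrable lborel (\<lambda>s. \<xi> i \<omega> * \<xi> j \<omega> * indicator ({u i<..v i} \<inter> {u j<..v j} \<inter> {0..t}) s)" for i j
      using fin[of i j] by (intro integrable_mult_right integrable_real_indicator) auto
    have int: "integrable lborel (\<lambda>s. (simple_value D s \<omega>)\<^sup>2 * indicator {0..t} s)"
      unfolding e by (intro Bochner_Integration.integrable_sum int1)
    have val: "(\<integral>s. (simple_value D s \<omega>)\<^sup>2 * indicator {0..t} s \<partial>lborel) = (\<Sum>i<n. \<Sum>j<n. \<xi> i \<omega> * \<xi> j \<omega> * \<mu> i j)"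
      unfolding e by (subst integral_double_sum[OF int1]) (simp add: \<mu>_def)
    have "(\<integral>\<^sup>+s\<in>{0..t}. ennreal ((simple_value D s \<omega>)\<^sup>2) \<partial>lborel)
       = (\<integral>\<^sup>+s. ennreal ((simple_value D s \<omega>)\<^sup>2 * indicator {0..t} s) \<partial>lborel)"
      by (intro nn_integral_cong) (auto simp: indicator_def)
    also have "\<dots> = ennreal (\<integral>s. (simple_value D s \<omega>)\<^sup>2 * indicator {0..t} s \<partial>lborel)"
      by (rule nn_integral_eq_integral[OF int]) simp
    finally have "(\<integral>\<^sup>+s\<in>{0..t}. ennreal ((simple_value D s \<omega>)\<^sup>2) \<partial>lborel) = ennreal (\<Sum>i<n. \<Sum>j<n. \<xi> i \<omega> * \<xi> j \<omega> * \<mu> i j)"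
      by (simp add: val)
    moreover have "0 \<le> (\<integral>s. (simple_value D s \<omega>)\<^sup>2 * indicator {0..t} s \<partial>lborel)" by simp
    ultimately show ?thesis by (simp add: val)
  qed
  have "(\<integral>\<^sup>+\<omega>. (\<integral>\<^sup>+s\<in>{0..t}. ennreal ((simple_value D s \<omega>)\<^sup>2) \<partial>lborel) \<partial>M)
      = (\<integral>\<^sup>+\<omega>. ennreal (\<Sum>i<n. \<Sum>j<n. \<xi> i \<omega> * \<xi> j \<omega> * \<mu> i j) \<partial>M)"
    by (intro nn_integral_cong inner[THEN conjunct1])
  also have "\<dots> = ennreal (\<integral>\<omega>. (\<Sum>i<n. \<Sum>j<n. \<xi> i \<omega> * \<xi> j \<omega> * \<mu> i j) \<partial>M)"
  proof (rule nn_integral_eq_integral)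
    show "integrable M (\<lambda>\<omega>. \<Sum>i<n. \<Sum>j<n. \<xi> i \<omega> * \<xi> j \<omega> * \<mu> i j)"
      by (intro Bochner_Integration.integrable_sum integrable_mult_left \<xi>int) auto
    show "AE \<omega> in M. 0 \<le> (\<Sum>i<n. \<Sum>j<n. \<xi> i \<omega> * \<xi> j \<omega> * \<mu> i j)"
      by (rule AE_I2) (rule inner[THEN conjunct2])
  qed
  finally show ?thesis
    using sq_integrable_nn_integral[OF I_sq] eq by simp
qed

section \<open>The maximal inequality\<close>

text \<open>Doob's inequality by induction over time, without stopping times. On an event known at
  time \<open>\<tau> n\<close> the mean of the squared martingale cannot decrease in the next step,
  and on the newly added event \<open>G\<close> the last value itself exceeds \<open>c\<close>. The
  indicator on the right is what makes the induction close.\<close>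

lemma l2_martingale_maximal_discrete:
  fixes \<tau> :: "nat \<Rightarrow> real"
  assumes N: "l2_martingale N" and \<tau>0: "0 \<le> \<tau> 0" and \<tau>: "incseq \<tau>" and c: "0 \<le> c"
  defines "E \<equiv> \<lambda>n. {\<omega>\<in>space M. \<exists>k\<le>n. c < \<bar>N (\<tau> k) \<omega>\<bar>}"
  shows "E n \<in> sets (F (\<tau> n))"
    and "c\<^sup>2 * prob (E n) \<le> (\<integral>\<omega>. indicator (E n) \<omega> * (N (\<tau> n) \<omega>)\<^sup>2 \<partial>M)"
proof -
  have pos: "0 \<le> \<tau> k" for k using \<tau>0 incseqD[OF \<tau>, of 0 k] by simp
  have mono: "\<tau> k \<le> \<tau> n" if "k \<le> n" for k n using \<tau> that by (simp add: incseq_def)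
  have meas: "N (\<tau> k) \<in> borel_measurable (F (\<tau> n))" if "k \<le> n" for k n
    by (rule F_measurable_mono[OF l2_martingale_adapted[OF N pos] pos mono[OF that]])
  have EF: "E n \<in> sets (F (\<tau> n))" for n
  proof -
    have "E n = (\<Union>k\<in>{..n}. {\<omega>\<in>space (F (\<tau> n)). c < \<bar>N (\<tau> k) \<omega>\<bar>})"
      using space_F[OF pos] by (auto simp: E_def)
    also have "\<dots> \<in> sets (F (\<tau> n))"
    proof (rule sets.finite_UN)
      fix k assume "k \<in> {..n}"
      then have [measurable]: "N (\<tau> k) \<in> borel_measurable (F (\<tau> n))" using meas by simp
      show "{\<omega>\<in>space (F (\<tau> n)). c < \<bar>N (\<tau> k) \<omega>\<bar>} \<in> sets (F (\<tau> n))" by measurable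
    qed simp
    finally show ?thesis .
  qed
  show "E n \<in> sets (F (\<tau> n))" by (rule EF)
  have EM: "E n \<in> sets M" for n
    using EF[of n] subalg[OF pos] by (auto simp: subalgebra_def)
  have sq: "sq_integrable M (N (\<tau> k))" for k by (rule l2_martingale_sq[OF N pos])
  have ind: "sq_integrable M (\<lambda>\<omega>. indicator A \<omega> * f \<omega>)" if "A \<in> sets M" "sq_integrable M f" for A f
    by (rule sq_integrable_bounded_mult[OF that(2), where K = 1]) (use that in \<open>auto simp: indicator_def\<close>)
  have int: "integrable M (\<lambda>\<omega>. indicator A \<omega> * (f \<omega>)\<^sup>2)" if "A \<in> sets M" "sq_integrable M f" for A f
    using sq_integrable_mult_integrable[OF ind[OF that] that(2)] by (simp add: power2_eq_square mult.assoc)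
  have lower: "c\<^sup>2 * prob A \<le> (\<integral>\<omega>. indicator A \<omega> * (N (\<tau> k) \<omega>)\<^sup>2 \<partial>M)"
    if A: "A \<in> sets M" "\<And>\<omega>. \<omega> \<in> A \<Longrightarrow> c < \<bar>N (\<tau> k) \<omega>\<bar>" for A k
  proof -
    have "c\<^sup>2 * prob A = (\<integral>\<omega>. c\<^sup>2 * indicator A \<omega> \<partial>M)" using A by simp
    also have "\<dots> \<le> (\<integral>\<omega>. indicator A \<omega> * (N (\<tau> k) \<omega>)\<^sup>2 \<partial>M)"
    proof (rule integral_mono[OF _ int[OF A(1) sq]])
      show "integrable M (\<lambda>\<omega>. c\<^sup>2 * indicator A \<omega>)" using A by (auto intro!: integrable_real_indicator simp: less_top[symmetric])
      fix \<omega>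
      have "c\<^sup>2 \<le> (N (\<tau> k) \<omega>)\<^sup>2" if "\<omega> \<in> A"
        using A(2)[OF that] c power_mono[of c "\<bar>N (\<tau> k) \<omega>\<bar>" 2] by simp
      then show "c\<^sup>2 * indicator A \<omega> \<le> indicator A \<omega> * (N (\<tau> k) \<omega>)\<^sup>2"
        by (auto simp: indicator_def)
    qed
    finally show ?thesis .
  qed
  show "c\<^sup>2 * prob (E n) \<le> (\<integral>\<omega>. indicator (E n) \<omega> * (N (\<tau> n) \<omega>)\<^sup>2 \<partial>M)"
  proof (induction n)
    case 0
    show ?case by (rule lower[OF EM]) (auto simp: E_def)
  next
    case (Suc n)
    define G where "G = E (Suc n) - E n"
    have GM: "G \<in> sets M" using EM by (auto simp: G_def)
    have split: "E (Suc n) = E n \<union> G" and disj: "E n \<inter> G = {}"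
    proof -
      have "E n \<subseteq> E (Suc n)" unfolding E_def using le_SucI by blast
      then show "E (Suc n) = E n \<union> G" "E n \<inter> G = {}" by (auto simp: G_def)
    qed
    have G1: "\<omega> \<in> G \<Longrightarrow> c < \<bar>N (\<tau> (Suc n)) \<omega>\<bar>" for \<omega>
      by (auto simp: E_def G_def le_Suc_eq)
    define Z where "Z = (\<lambda>\<omega>. indicator (E n) \<omega> * N (\<tau> n) \<omega>)"
    have Zsq: "sq_integrable M Z" unfolding Z_def by (rule ind[OF EM sq])
    have ZF: "Z \<in> borel_measurable (F (\<tau> n))"
      unfolding Z_def using EF[of n] meas[of n n] by simp
    have d: "sq_integrable M (\<lambda>\<omega>. N (\<tau> (Suc n)) \<omega> - N (\<tau> n) \<omega>)" by (rule sq_integrable_diff[OF sq sq])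
    \<comment> \<open>In the expansion of this square the cross term vanishes by orthogonality,
      because \<open>Z\<close> is known at time \<open>\<tau> n\<close>.\<close>
    have "0 \<le> (\<integral>\<omega>. indicator (E n) \<omega> * (N (\<tau> (Suc n)) \<omega> - N (\<tau> n) \<omega>)\<^sup>2 \<partial>M)"
      by (intro integral_nonneg_AE) auto
    also have "(\<lambda>\<omega>. indicator (E n) \<omega> * (N (\<tau> (Suc n)) \<omega> - N (\<tau> n) \<omega>)\<^sup>2)
      = (\<lambda>\<omega>. indicator (E n) \<omega> * (N (\<tau> (Suc n)) \<omega>)\<^sup>2 - indicator (E n) \<omega> * (N (\<tau> n) \<omega>)\<^sup>2
           - 2 * (Z \<omega> * (N (\<tau> (Suc n)) \<omega> - N (\<tau> n) \<omega>)))"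
      by (auto simp: Z_def power2_eq_square algebra_simps)
    also have "(\<integral>\<omega>. indicator (E n) \<omega> * (N (\<tau> (Suc n)) \<omega>)\<^sup>2 - indicator (E n) \<omega> * (N (\<tau> n) \<omega>)\<^sup>2
           - 2 * (Z \<omega> * (N (\<tau> (Suc n)) \<omega> - N (\<tau> n) \<omega>)) \<partial>M)
      = (\<integral>\<omega>. indicator (E n) \<omega> * (N (\<tau> (Suc n)) \<omega>)\<^sup>2 \<partial>M) - (\<integral>\<omega>. indicator (E n) \<omega> * (N (\<tau> n) \<omega>)\<^sup>2 \<partial>M)"
      using int[OF EM[of n] sq[of "Suc n"]] int[OF EM[of n] sq[of n]] sq_integrable_mult_integrable[OF Zsq d]
        l2_martingale_orth[OF N pos mono[of n "Suc n"] ZF Zsq] by simp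
    finally have mono1: "(\<integral>\<omega>. indicator (E n) \<omega> * (N (\<tau> n) \<omega>)\<^sup>2 \<partial>M)
        \<le> (\<integral>\<omega>. indicator (E n) \<omega> * (N (\<tau> (Suc n)) \<omega>)\<^sup>2 \<partial>M)" by simp
    have "c\<^sup>2 * prob (E (Suc n)) = c\<^sup>2 * prob (E n) + c\<^sup>2 * prob G"
      unfolding split using EM GM disj by (subst finite_measure_Union) (auto simp: algebra_simps)
    also have "\<dots> \<le> (\<integral>\<omega>. indicator (E n) \<omega> * (N (\<tau> (Suc n)) \<omega>)\<^sup>2 \<partial>M) + (\<integral>\<omega>. indicator G \<omega> * (N (\<tau> (Suc n)) \<omega>)\<^sup>2 \<partial>M)"
      using Suc mono1 lower[OF GM G1] by simp
    also have "\<dots> = (\<integral>\<omega>. indicator (E n) \<omega> * (N (\<tau> (Suc n)) \<omega>)\<^sup>2 + indicator G \<omega> * (N (\<tau> (Suc n)) \<omega>)\<^sup>2 \<partial>M)"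
      using int[OF EM sq] int[OF GM sq] by simp
    also have "\<dots> = (\<integral>\<omega>. indicator (E (Suc n)) \<omega> * (N (\<tau> (Suc n)) \<omega>)\<^sup>2 \<partial>M)"
      using disj by (intro Bochner_Integration.integral_cong refl) (auto simp: split indicator_def)
    finally show ?case .
  qed
qed

end

text \<open>The tolerance 1 covers all roundings in use: down, up, and to the left end of a
  left-open grid interval.\<close>

lemma dyadic_tendsto:
  fixes s :: real and k :: "nat \<Rightarrow> nat"
  assumes "\<And>n. \<bar>s * 2 ^ n - real (k n)\<bar> \<le> 1"
  shows "(\<lambda>n. real (k n) / 2 ^ n) \<longlonglongrightarrow> s"
proof (rule Lim_transform2[OF tendsto_const])
  show "(\<lambda>n. s - real (k n) / 2 ^ n) \<longlonglongrightarrow> 0"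
  proof (rule Lim_null_comparison)
    show "(\<lambda>n. (1/2::real) ^ n) \<longlonglongrightarrow> 0" by (rule LIMSEQ_power_zero) simp
    show "\<forall>\<^sub>F n in sequentially. norm (s - real (k n) / 2 ^ n) \<le> (1/2) ^ n"
    proof (intro always_eventually allI)
      fix n
      have "s - real (k n) / 2 ^ n = (s * 2 ^ n - real (k n)) / 2 ^ n"
        by (simp add: diff_divide_distrib)
      then have "norm (s - real (k n) / 2 ^ n) = \<bar>s * 2 ^ n - real (k n)\<bar> / 2 ^ n"
        by (simp only: real_norm_def abs_divide) simp
      also have "\<dots> \<le> 1 / 2 ^ n" by (intro divide_right_mono assms) simp
      finally show "norm (s - real (k n) / 2 ^ n) \<le> (1/2) ^ n" by (simp add: power_divide)
    qed
  qed
qed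

lemma dyadic_floor_tendsto:
  assumes "0 \<le> (x::real)"
  shows "(\<lambda>n. real (nat \<lfloor>x * 2 ^ n\<rfloor>) / 2 ^ n) \<longlonglongrightarrow> x"
proof (rule dyadic_tendsto)
  fix n :: nat
  have "0 \<le> \<lfloor>x * 2 ^ n\<rfloor>" using assms by simp
  then show "\<bar>x * 2 ^ n - real (nat \<lfloor>x * 2 ^ n\<rfloor>)\<bar> \<le> 1" by linarith
qed

text \<open>A dyadic time of level \<open>m\<close> reappears on every finer grid, and
  \<open>l \<le> n\<close> keeps its new index within the \<open>n * 2 ^ n\<close> intervals of
  \<open>sign_steps Y n\<close>.\<close>

lemma dyadic_refine:
  assumes "m \<le> n"
  shows "real l / 2 ^ m = real (l * 2 ^ (n - m)) / 2 ^ n"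
    and "l \<le> n \<Longrightarrow> l * 2 ^ (n - m) \<le> n * 2 ^ n"
proof -
  have "(2::real) ^ n = 2 ^ m * 2 ^ (n - m)" using assms by (simp add: power_add[symmetric])
  then show "real l / 2 ^ m = real (l * 2 ^ (n - m)) / 2 ^ n" by simp
  show "l \<le> n \<Longrightarrow> l * 2 ^ (n - m) \<le> n * 2 ^ n" by (intro mult_le_mono power_increasing) auto
qed

context stochastic_basis
begin

text \<open>Exceeding \<open>c\<close> strictly is an open condition, so by continuity it already
  happens at a dyadic multiple of \<open>T\<close>. The events over these grids increase, and both
  measurability and the bound pass to their union.\<close>

lemma l2_martingale_maximal:
  assumes N: "l2_martingale N" and cont: "continuous_paths M N" and T: "0 \<le> T" and c: "0 < c"
  shows "{\<omega>\<in>space M. \<exists>s\<in>{0..T}. c < \<bar>N s \<omega>\<bar>} \<in> sets M"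
    and "prob {\<omega>\<in>space M. \<exists>s\<in>{0..T}. c < \<bar>N s \<omega>\<bar>} \<le> (\<integral>\<omega>. (N T \<omega>)\<^sup>2 \<partial>M) / c\<^sup>2"
proof -
  \<comment> \<open>Capping the index at \<open>2 ^ n\<close> freezes the grid at \<open>T\<close>,
    so that \<open>\<tau> n\<close> is monotone on all natural numbers.\<close>
  define \<tau> where "\<tau> n k = T * (real (min k (2 ^ n)) / 2 ^ n)" for n k :: nat
  define E where "E n = {\<omega>\<in>space M. \<exists>k\<le>(2::nat) ^ n. c < \<bar>N (\<tau> n k) \<omega>\<bar>}" for n :: nat
  have \<tau>: "0 \<le> \<tau> n 0" "incseq (\<tau> n)" "\<tau> n (2 ^ n) = T" for n
  proof -
    show "0 \<le> \<tau> n 0" using T by (simp add: \<tau>_def)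
    show "\<tau> n (2 ^ n) = T" by (simp add: \<tau>_def)
    show "incseq (\<tau> n)"
    proof (rule incseq_SucI)
      fix k
      have "min k (2 ^ n) \<le> min (Suc k) (2 ^ n)" by simp
      then show "\<tau> n k \<le> \<tau> n (Suc k)" unfolding \<tau>_def
        by (intro mult_left_mono divide_right_mono T) (simp_all del: of_nat_min)
    qed
  qed
  note D = l2_martingale_maximal_discrete[OF N \<tau>(1,2) less_imp_le[OF c]]
  have EM: "E n \<in> sets M" for n
  proof -
    have "E n \<in> sets (F T)" using D(1)[of "2 ^ n" n] unfolding \<tau>(3) E_def .
    then show ?thesis using subalg[OF T] unfolding subalgebra_def by blast
  qed
  have int: "integrable M (\<lambda>\<omega>. (N T \<omega>)\<^sup>2)"
    using sq_integrable_square[OF l2_martingale_sq[OF N T]] .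
  have pE: "prob (E n) \<le> (\<integral>\<omega>. (N T \<omega>)\<^sup>2 \<partial>M) / c\<^sup>2" for n
  proof -
    have "c\<^sup>2 * prob (E n) \<le> (\<integral>\<omega>. indicator (E n) \<omega> * (N T \<omega>)\<^sup>2 \<partial>M)"
      using D(2)[of "2 ^ n" n] unfolding \<tau>(3) E_def .
    also have "\<dots> \<le> (\<integral>\<omega>. (N T \<omega>)\<^sup>2 \<partial>M)"
    proof (rule integral_mono[OF _ int])
      show "integrable M (\<lambda>\<omega>. indicator (E n) \<omega> * (N T \<omega>)\<^sup>2)"
        using integrable_mult_indicator[OF EM int] by simp
    qed (auto simp: indicator_def)
    finally show ?thesis using c by (simp add: field_simps)
  qed
  have inc: "incseq E"
  proof (rule incseq_SucI)
    fix n show "E n \<subseteq> E (Suc n)"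
    proof
      fix \<omega> assume "\<omega> \<in> E n"
      then obtain k where k: "k \<le> 2 ^ n" "c < \<bar>N (\<tau> n k) \<omega>\<bar>" and \<omega>: "\<omega> \<in> space M" by (auto simp: E_def)
      have "\<tau> n k = \<tau> (Suc n) (2 * k)" using k by (simp add: \<tau>_def)
      then show "\<omega> \<in> E (Suc n)" using k \<omega> by (auto simp: E_def intro!: exI[of _ "2 * k"])
    qed
  qed
  have U: "{\<omega>\<in>space M. \<exists>s\<in>{0..T}. c < \<bar>N s \<omega>\<bar>} = (\<Union>n. E n)"
  proof (intro equalityI subsetI)
    fix \<omega> assume "\<omega> \<in> (\<Union>n. E n)"
    then obtain n k where k: "k \<le> 2 ^ n" "c < \<bar>N (\<tau> n k) \<omega>\<bar>" "\<omega> \<in> space M" by (auto simp: E_def)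
    have "\<tau> n 0 \<le> \<tau> n k" "\<tau> n k \<le> \<tau> n (2 ^ n)" using \<tau>(2)[of n] k by (auto simp: incseq_def)
    then have "\<tau> n k \<in> {0..T}" using \<tau>(1)[of n] \<tau>(3)[of n] by auto
    then show "\<omega> \<in> {\<omega>\<in>space M. \<exists>s\<in>{0..T}. c < \<bar>N s \<omega>\<bar>}" using k by blast
  next
    fix \<omega> assume "\<omega> \<in> {\<omega>\<in>space M. \<exists>s\<in>{0..T}. c < \<bar>N s \<omega>\<bar>}"
    then obtain s where \<omega>: "\<omega> \<in> space M" and s: "s \<in> {0..T}" "c < \<bar>N s \<omega>\<bar>" by blast
    \<comment> \<open>For \<open>T = 0\<close> the quotient is 0 by convention and
      \<open>s = 0\<close>, so \<open>T * x = s\<close> holds in this case too.\<close>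
    define x where "x = s / T"
    have x: "0 \<le> x" "x \<le> 1" "T * x = s" using s T by (auto simp: x_def divide_le_eq)
    define k where "k n = nat \<lfloor>x * 2 ^ n\<rfloor>" for n :: nat
    have k: "k n \<le> 2 ^ n" for n
    proof -
      have "x * 2 ^ n \<le> 2 ^ n" using x by simp
      then have "\<lfloor>x * 2 ^ n\<rfloor> \<le> \<lfloor>(2::real) ^ n\<rfloor>" by (rule floor_mono)
      also have "\<lfloor>(2::real) ^ n\<rfloor> = int (2 ^ n)" using floor_of_nat[of "2 ^ n", where 'a = real] by simp
      finally show ?thesis by (simp add: k_def)
    qed
    have "(\<lambda>n. T * (real (k n) / 2 ^ n)) \<longlonglongrightarrow> T * x"
      unfolding k_def by (intro tendsto_intros dyadic_floor_tendsto x)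
    then have lim: "(\<lambda>n. \<tau> n (k n)) \<longlonglongrightarrow> s"
      using x k by (simp add: \<tau>_def min_absorb1)
    have "0 \<le> \<tau> n (k n)" for n using T by (simp add: \<tau>_def)
    then have "(\<lambda>n. N (\<tau> n (k n)) \<omega>) \<longlonglongrightarrow> N s \<omega>"
      using cont \<omega> s by (intro continuous_on_tendsto_compose[OF _ lim, of "{0..}"]) (auto simp: continuous_paths_def)
    then have "(\<lambda>n. \<bar>N (\<tau> n (k n)) \<omega>\<bar>) \<longlonglongrightarrow> \<bar>N s \<omega>\<bar>" by (rule tendsto_rabs)
    then have "\<forall>\<^sub>F n in sequentially. c < \<bar>N (\<tau> n (k n)) \<omega>\<bar>" using s(2) by (rule order_tendstoD)
    then obtain n where "c < \<bar>N (\<tau> n (k n)) \<omega>\<bar>" by (auto simp: eventually_sequentially)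
    then have "\<omega> \<in> E n" using k \<omega> by (auto simp: E_def)
    then show "\<omega> \<in> (\<Union>n. E n)" by blast
  qed
  show "{\<omega>\<in>space M. \<exists>s\<in>{0..T}. c < \<bar>N s \<omega>\<bar>} \<in> sets M" unfolding U using EM by auto
  have "(\<lambda>n. prob (E n)) \<longlonglongrightarrow> prob (\<Union>n. E n)"
    by (rule finite_Lim_measure_incseq[OF _ inc]) (use EM in auto)
  then show "prob {\<omega>\<in>space M. \<exists>s\<in>{0..T}. c < \<bar>N s \<omega>\<bar>} \<le> (\<integral>\<omega>. (N T \<omega>)\<^sup>2 \<partial>M) / c\<^sup>2"
    unfolding U by (rule LIMSEQ_le_const2) (use pE in auto)
qed

end

section \<open>Existence of the Ito integral\<close>

lemma continuous_on_nonnegI: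
  assumes "\<And>T. 0 \<le> T \<Longrightarrow> continuous_on {0..T} (f :: real \<Rightarrow> 'b::topological_space)"
  shows "continuous_on {0..} f"
  unfolding continuous_on_eq_continuous_within
proof
  fix x :: real assume x: "x \<in> {0..}"
  have "continuous (at x within {0..x+1}) f"
    using assms[of "x+1"] x by (simp add: continuous_on_eq_continuous_within)
  moreover have "at x within {0..x+1} = at x within {0..}"
    by (rule at_within_nhd[where S = "{..<x+1}"]) auto
  ultimately show "continuous (at x within {0..}) f" by simp
qed

lemma simple_integral_append:
  "simple_integral (D @ E) W t \<omega> = simple_integral D W t \<omega> + simple_integral E W t \<omega>"
  by (simp add: simple_integral_def)

lemma simple_value_append:
  "simple_value (D @ E) s \<omega> = simple_value D s \<omega> + simple_value E s \<omega>"
  by (simp add: simple_value_def)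

text \<open>Since intervals may overlap, appending lists adds simple processes; with negated
  coefficients differences become simple as well and fall under the isometry.\<close>

definition uminus_steps :: "'a simple_steps \<Rightarrow> 'a simple_steps" where
  "uminus_steps = map (\<lambda>(u, v, \<xi>). (u, v, \<lambda>\<omega>. - \<xi> \<omega>))"

lemma simple_integral_uminus: "simple_integral (uminus_steps D) W t \<omega> = - simple_integral D W t \<omega>"
  by (induction D) (auto simp: simple_integral_def uminus_steps_def)

lemma simple_value_uminus: "simple_value (uminus_steps D) s \<omega> = - simple_value D s \<omega>"
  by (induction D) (auto simp: simple_value_def uminus_steps_def)

context stochastic_basis
begin

lemma simple_steps_append: "simple_steps F (D @ E) \<longleftrightarrow> simple_steps F D \<and> simple_steps F E"
  unfolding simple_steps_def by (simp add: ball_Un)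

lemma simple_steps_uminus: "simple_steps F D \<Longrightarrow> simple_steps F (uminus_steps D)"
  by (induction D) (auto simp: simple_steps_Nil simple_steps_Cons uminus_steps_def)

lemma simple_value_measurable:
  assumes "simple_steps F D"
  shows "(\<lambda>(\<omega>, s). simple_value D s \<omega>) \<in> borel_measurable (M \<Otimes>\<^sub>M lborel)"
proof -
  have m: "(\<lambda>x. snd (snd (D ! i)) (fst x)) \<in> borel_measurable (M \<Otimes>\<^sub>M lborel)" if "i < length D" for i
    by (rule measurable_compose[OF measurable_fst F_measurable_M[OF simple_steps_nth(1,3)[OF assms that]]])
  have "(\<lambda>x. \<Sum>i<length D. snd (snd (D ! i)) (fst x) * indicat_real {fst (D ! i)<..fst (snd (D ! i))} (snd x))
     \<in> borel_measurable (M \<Otimes>\<^sub>M lborel)"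
  proof (intro borel_measurable_sum borel_measurable_times)
    fix i assume "i \<in> {..<length D}"
    then show "(\<lambda>x. snd (snd (D ! i)) (fst x)) \<in> borel_measurable (M \<Otimes>\<^sub>M lborel)" using m by simp
    have "(\<lambda>x. indicat_real {fst (D ! i)<..fst (snd (D ! i))} x) \<in> borel_measurable lborel" by simp
    then show "(\<lambda>x. indicat_real {fst (D ! i)<..fst (snd (D ! i))} (snd x)) \<in> borel_measurable (M \<Otimes>\<^sub>M lborel)"
      by (rule measurable_compose[OF measurable_snd])
  qed
  then show ?thesis by (simp add: simple_value_nth case_prod_unfold)
qed

lemma continuous_paths_simple_integral:
  assumes "continuous_paths M W" "simple_steps F D"
  shows "continuous_paths M (simple_integral D W)"
  unfolding continuous_paths_def simple_integral_nth
proof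
  fix \<omega> assume \<omega>: "\<omega> \<in> space M"
  have c: "continuous_on {0..} (\<lambda>t. W (min u t) \<omega>)" if "0 \<le> u" for u
  proof (rule continuous_on_compose2[of "{0..}" "\<lambda>t. W t \<omega>"])
    show "continuous_on {0..} (\<lambda>t. W t \<omega>)" using assms(1) \<omega> by (simp add: continuous_paths_def)
    show "continuous_on {0..} (min u)" by (intro continuous_intros)
  qed (use that in auto)
  show "continuous_on {0..} (\<lambda>t. \<Sum>i<length D. snd (snd (D ! i)) \<omega> *
     (W (min (fst (snd (D ! i))) t) \<omega> - W (min (fst (D ! i)) t) \<omega>))"
  proof (intro continuous_intros)
    fix i assume "i \<in> {..<length D}"
    then have "0 \<le> fst (D ! i)" "fst (D ! i) \<le> fst (snd (D ! i))"
      using simple_steps_nth(1,2)[OF assms(2)] by auto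
    then show "continuous_on {0..} (\<lambda>t. W (min (fst (snd (D ! i))) t) \<omega>)"
      "continuous_on {0..} (\<lambda>t. W (min (fst (D ! i)) t) \<omega>)"
      by (auto intro: c)
  qed
qed

text \<open>Completeness of \<open>M\<close> and augmentation of the filtration put every subset of
  a null set into \<open>F t\<close>. A process can therefore be redefined on an exceptional set
  without losing adaptedness.\<close>

lemma F_measurable_AE_eq:
  assumes t: "0 \<le> t" and h: "h \<in> borel_measurable (F t)" and ae: "AE \<omega> in M. g \<omega> = h \<omega>"
  shows "(g :: 'a \<Rightarrow> 'b::topological_space) \<in> borel_measurable (F t)"
proof -
  obtain N where N: "N \<in> null_sets M" "{\<omega>\<in>space M. g \<omega> \<noteq> h \<omega>} \<subseteq> N"
    using ae by (auto elim!: AE_E simp: null_sets_def)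
  have null: "A \<in> sets (F t)" if "A \<subseteq> N" for A
  proof -
    have "A \<in> sets M" using complete[OF that N(1)] .
    then have "A \<in> null_sets M" using N(1) that null_sets_subset by blast
    then show ?thesis using augmented[OF t] by blast
  qed
  show ?thesis
  proof (rule measurableI)
    fix A :: "'b set" assume A: "A \<in> sets borel"
    have "g -` A \<inter> space (F t) = ((h -` A \<inter> space (F t)) - N) \<union> (g -` A \<inter> space (F t) \<inter> N)"
      using N(2) space_F[OF t] by auto
    also have "\<dots> \<in> sets (F t)"
      by (rule sets.Un[OF sets.Diff[OF measurable_sets[OF h A] null[OF order_refl]] null[OF Int_lower2]])
    finally show "g -` A \<inter> space (F t) \<in> sets (F t)" .
  qed simp
qed

lemma F_measurable_AE_limit:
  fixes f :: "nat \<Rightarrow> 'a \<Rightarrow> real"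
  assumes t: "0 \<le> t" and f: "\<And>n. f n \<in> borel_measurable (F t)" and ae: "AE \<omega> in M. (\<lambda>n. f n \<omega>) \<longlonglongrightarrow> g \<omega>"
  shows "g \<in> borel_measurable (F t)"
proof (rule F_measurable_AE_eq[OF t])
  show "(\<lambda>\<omega>. lim (\<lambda>n. f n \<omega>)) \<in> borel_measurable (F t)"
    using f by (rule borel_measurable_lim_metric)
  show "AE \<omega> in M. g \<omega> = lim (\<lambda>n. f n \<omega>)"
    using ae by eventually_elim (simp add: limI)
qed

text \<open>The isometry makes the elementary integrals Cauchy in mean square; Doob's inequality and
  the Borel-Cantelli lemma upgrade a fast subsequence to almost surely locally uniform convergence,
  hence to continuous paths. The sequence \<open>G\<close> is given rather than chosen, because
  later the same \<open>G\<close> is integrated against two Brownian motions. The value 0 at time 0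
  holds for every outcome, which later makes \<open>L\<close> nonnegative everywhere.\<close>

lemma ito_limit_exists:
  assumes W: "brownian_motion M F W" and G: "\<And>n::nat. simple_steps F (G n)"
    and Hm: "\<And>t. 0 \<le> t \<Longrightarrow> (\<lambda>(\<omega>, s). indicator {0..t} s * H s \<omega>) \<in> borel_measurable (M \<Otimes>\<^sub>M lborel)"
    and lim: "\<And>t. 0 \<le> t \<Longrightarrow>
      (\<lambda>n. \<integral>\<^sup>+\<omega>. (\<integral>\<^sup>+s\<in>{0..t}. ennreal ((simple_value (G n) s \<omega> - H s \<omega>)\<^sup>2) \<partial>lborel) \<partial>M) \<longlonglongrightarrow> 0"
  shows "\<exists>I. adapted_process F I \<and> continuous_paths M I \<and> (\<forall>\<omega>\<in>space M. I 0 \<omega> = 0) \<and>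
    (\<forall>t\<ge>0. (\<lambda>n. \<integral>\<^sup>+\<omega>. ennreal ((simple_integral (G n) W t \<omega> - I t \<omega>)\<^sup>2) \<partial>M) \<longlonglongrightarrow> 0)"
proof -
  define S where "S n = simple_integral (G n) W" for n
  define a where "a n t = (\<integral>\<^sup>+\<omega>. (\<integral>\<^sup>+s\<in>{0..t}. ennreal ((simple_value (G n) s \<omega> - H s \<omega>)\<^sup>2) \<partial>lborel) \<partial>M)" for n t
  note Wm = brownian_l2_martingale[OF W]
  have Wc: "continuous_paths M W" using W by (simp add: brownian_motion_def)
  have Sm: "l2_martingale (S n)" for n unfolding S_def by (rule l2_martingale_simple_integral[OF Wm G])
  have Sc: "continuous_paths M (S n)" for n unfolding S_def by (rule continuous_paths_simple_integral[OF Wc G])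
  have S0: "S n 0 \<omega> = 0" for n \<omega>
    unfolding S_def simple_integral_nth
  proof (intro sum.neutral ballI)
    fix i assume "i \<in> {..<length (G n)}"
    then have "min (fst (snd (G n ! i))) 0 = 0" "min (fst (G n ! i)) 0 = 0"
      using simple_steps_nth(1,2)[OF G[of n], of i] by auto
    then show "snd (snd (G n ! i)) \<omega> * (W (min (fst (snd (G n ! i))) 0) \<omega> - W (min (fst (G n ! i)) 0) \<omega>) = 0"
      by simp
  qed
  have dist: "(\<integral>\<^sup>+\<omega>. ennreal ((S n t \<omega> - S m t \<omega>)\<^sup>2) \<partial>M) \<le> 2 * a n t + 2 * a m t" if t: "0 \<le> t" for n m t
  proof -
    define f where "f k = (\<lambda>(\<omega>, s). ennreal ((simple_value (G k) s \<omega> - H s \<omega>)\<^sup>2) * indicator {0..t} s)" for k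
    have fm: "f k \<in> borel_measurable (M \<Otimes>\<^sub>M lborel)" for k
    proof -
      have ind: "(\<lambda>x. indicat_real {0..t} (snd x)) \<in> borel_measurable (M \<Otimes>\<^sub>M lborel)"
        by (rule measurable_compose[OF measurable_snd]) simp
      have "(\<lambda>x. ennreal ((indicat_real {0..t} (snd x) * (case x of (\<omega>, s) \<Rightarrow> simple_value (G k) s \<omega>)
           - (case x of (\<omega>, s) \<Rightarrow> indicator {0..t} s * H s \<omega>))\<^sup>2)) \<in> borel_measurable (M \<Otimes>\<^sub>M lborel)"
        using ind simple_value_measurable[OF G[of k]] Hm[OF t] by measurable
      also have "(\<lambda>x. ennreal ((indicat_real {0..t} (snd x) * (case x of (\<omega>, s) \<Rightarrow> simple_value (G k) s \<omega>)
           - (case x of (\<omega>, s) \<Rightarrow> indicator {0..t} s * H s \<omega>))\<^sup>2)) = f k"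
        by (auto simp: f_def indicator_def fun_eq_iff)
      finally show ?thesis .
    qed
    have fm1: "(\<lambda>s. f k (\<omega>, s)) \<in> borel_measurable lborel" if "\<omega> \<in> space M" for k \<omega>
      by (rule measurable_compose[OF measurable_Pair1'[OF that] fm])
    have fm2: "(\<lambda>\<omega>. \<integral>\<^sup>+s. f k (\<omega>, s) \<partial>lborel) \<in> borel_measurable M" for k
      using lborel.borel_measurable_nn_integral[of "\<lambda>\<omega> s. f k (\<omega>, s)" M] fm by simp
    have a_f: "a k t = (\<integral>\<^sup>+\<omega>. (\<integral>\<^sup>+s. f k (\<omega>, s) \<partial>lborel) \<partial>M)" for k
      by (simp add: a_def f_def)
    let ?D = "G n @ uminus_steps (G m)"
    have D: "simple_steps F ?D" using G by (simp add: simple_steps_append simple_steps_uminus)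
    have "(\<integral>\<^sup>+\<omega>. ennreal ((S n t \<omega> - S m t \<omega>)\<^sup>2) \<partial>M) = (\<integral>\<^sup>+\<omega>. ennreal ((simple_integral ?D W t \<omega>)\<^sup>2) \<partial>M)"
      by (simp add: S_def simple_integral_append simple_integral_uminus)
    also have "\<dots> = (\<integral>\<^sup>+\<omega>. (\<integral>\<^sup>+s\<in>{0..t}. ennreal ((simple_value ?D s \<omega>)\<^sup>2) \<partial>lborel) \<partial>M)"
      by (rule simple_integral_isometry[OF W D t])
    also have "\<dots> \<le> (\<integral>\<^sup>+\<omega>. (\<integral>\<^sup>+s. 2 * f n (\<omega>, s) + 2 * f m (\<omega>, s) \<partial>lborel) \<partial>M)"
    proof (intro nn_integral_mono)
      fix \<omega> s
      have sq: "(x - y)\<^sup>2 \<le> 2 * (x - h)\<^sup>2 + 2 * (y - h)\<^sup>2" for x y h :: real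
        using zero_le_power2[of "x + y - 2 * h"] by (simp add: power2_eq_square algebra_simps)
      have "ennreal ((simple_value ?D s \<omega>)\<^sup>2)
        \<le> 2 * ennreal ((simple_value (G n) s \<omega> - H s \<omega>)\<^sup>2) + 2 * ennreal ((simple_value (G m) s \<omega> - H s \<omega>)\<^sup>2)"
        using ennreal_leI[OF sq[of "simple_value (G n) s \<omega>" "simple_value (G m) s \<omega>" "H s \<omega>"]]
        by (simp add: simple_value_append simple_value_uminus ennreal_plus ennreal_mult)
      then show "ennreal ((simple_value ?D s \<omega>)\<^sup>2) * indicator {0..t} s \<le> 2 * f n (\<omega>, s) + 2 * f m (\<omega>, s)"
        by (auto simp: f_def indicator_def)
    qed
    also have "\<dots> = (\<integral>\<^sup>+\<omega>. 2 * (\<integral>\<^sup>+s. f n (\<omega>, s) \<partial>lborel) + 2 * (\<integral>\<^sup>+s. f m (\<omega>, s) \<partial>lborel) \<partial>M)"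
    proof (rule nn_integral_cong)
      fix \<omega> assume "\<omega> \<in> space M"
      then have "(\<lambda>s. f k (\<omega>, s)) \<in> borel_measurable borel" for k using fm1[of \<omega> k] by simp
      then show "(\<integral>\<^sup>+s. 2 * f n (\<omega>, s) + 2 * f m (\<omega>, s) \<partial>lborel)
          = 2 * (\<integral>\<^sup>+s. f n (\<omega>, s) \<partial>lborel) + 2 * (\<integral>\<^sup>+s. f m (\<omega>, s) \<partial>lborel)"
        by (simp add: nn_integral_add nn_integral_cmult)
    qed
    also have "\<dots> = 2 * a n t + 2 * a m t"
      unfolding a_f using fm2 by (simp add: nn_integral_add nn_integral_cmult)
    finally show ?thesis .
  qed
  have dsq: "sq_integrable M (\<lambda>\<omega>. S n t \<omega> - S m t \<omega>)" if "0 \<le> t" for n m t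
    by (rule sq_integrable_diff[OF l2_martingale_sq[OF Sm that] l2_martingale_sq[OF Sm that]])
  \<comment> \<open>Two terms this close to \<open>H\<close> differ in mean square by at most four
    times this bound, \<open>(1/8) ^ k\<close>; at level \<open>(1/2) ^ k\<close> Doob's inequality
    leaves \<open>(1/2) ^ k\<close>, which is summable. The horizon \<open>real k\<close> grows with
    \<open>k\<close>, so every bounded time interval is eventually covered.\<close>
  have "\<exists>N. \<forall>n\<ge>N. a n (real k) < ennreal ((1/8) ^ k / 4)" for k :: nat
  proof -
    have "(\<lambda>n. a n (real k)) \<longlonglongrightarrow> 0" unfolding a_def by (rule lim) simp
    moreover have "0 < ennreal ((1/8) ^ k / 4)" by simp
    ultimately have "\<forall>\<^sub>F n in sequentially. a n (real k) < ennreal ((1/8) ^ k / 4)" by (rule order_tendstoD)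
    then show ?thesis by (simp add: eventually_sequentially)
  qed
  then obtain N where N: "\<And>k n. N k \<le> n \<Longrightarrow> a n (real k) < ennreal ((1/8) ^ k / 4)" by metis
  \<comment> \<open>The sum dominates \<open>N k\<close>, and the summand \<open>k\<close> makes
    \<open>r\<close> strictly increasing.\<close>
  define r where "r k = (\<Sum>j\<le>k. N j) + k" for k :: nat
  have rN: "N k \<le> r k" for k
  proof -
    have "N k \<le> (\<Sum>j\<le>k. N j)" by (rule member_le_sum) auto
    then show ?thesis by (simp add: r_def)
  qed
  have rmono: "strict_mono r" by (rule strict_mono_Suc_iff[THEN iffD2]) (simp add: r_def)
  define D where "D k t \<omega> = S (r (Suc k)) t \<omega> - S (r k) t \<omega>" for k t \<omega>
  have Dm: "l2_martingale (D k)" for k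
    unfolding D_def by (rule l2_martingale_diff[OF Sm Sm])
  have Dc: "continuous_paths M (D k)" for k
    using Sc unfolding D_def continuous_paths_def by (auto intro!: continuous_intros)
  have Dint: "(\<integral>\<omega>. (D k (real k) \<omega>)\<^sup>2 \<partial>M) \<le> (1/8) ^ k" for k
  proof -
    have rS: "N k \<le> r (Suc k)" using rN[of k] rmono by (meson le_trans less_imp_le strict_mono_Suc_iff)
    have "2 * a (r (Suc k)) (real k) + 2 * a (r k) (real k)
        \<le> 2 * ennreal ((1/8) ^ k / 4) + 2 * ennreal ((1/8) ^ k / 4)"
      by (intro add_mono mult_left_mono less_imp_le[OF N[OF rS]] less_imp_le[OF N[OF rN]]) auto
    also have "\<dots> = ennreal (2 * ((1/8) ^ k / 4) + 2 * ((1/8) ^ k / 4))"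
    proof -
      have "2 * ennreal e + 2 * ennreal e = ennreal (2 * e + 2 * e)" if "0 \<le> e" for e :: real
      proof -
        have x: "2 * ennreal e = ennreal (2 * e)" using that by (simp add: ennreal_mult)
        show ?thesis unfolding x by (rule ennreal_plus[symmetric]) (use that in auto)
      qed
      then show ?thesis by simp
    qed
    also have "2 * ((1/8) ^ k / 4) + 2 * ((1/8) ^ k / 4) = (1/8::real) ^ k" by simp
    finally have "(\<integral>\<^sup>+\<omega>. ennreal ((D k (real k) \<omega>)\<^sup>2) \<partial>M) \<le> ennreal ((1/8) ^ k)"
      using dist[of "real k" "r (Suc k)" "r k"] by (simp add: D_def)
    then show ?thesis
      using sq_integrable_nn_integral[OF l2_martingale_sq[OF Dm, of "real k" k]] by simp
  qed
  define A where "A k = {\<omega>\<in>space M. \<exists>s\<in>{0..real k}. (1/2) ^ k < \<bar>D k s \<omega>\<bar>}" for k :: nat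
  have AM: "A k \<in> sets M" for k
    unfolding A_def by (rule l2_martingale_maximal(1)[OF Dm Dc]) auto
  have Ap: "prob (A k) \<le> (1/2) ^ k" for k
  proof -
    have "prob (A k) \<le> (\<integral>\<omega>. (D k (real k) \<omega>)\<^sup>2 \<partial>M) / ((1/2) ^ k)\<^sup>2"
      unfolding A_def by (rule l2_martingale_maximal(2)[OF Dm Dc]) auto
    also have "\<dots> \<le> (1/8) ^ k / ((1/2) ^ k)\<^sup>2" by (intro divide_right_mono Dint) auto
    also have "\<dots> = ((1/8) / (1/2)\<^sup>2) ^ k" by (simp only: power_divide power_mult[symmetric] mult.commute)
    also have "\<dots> = (1/2) ^ k" by (simp add: power2_eq_square)
    finally show ?thesis .
  qed
  have "AE \<omega> in M. eventually (\<lambda>k. \<omega> \<in> space M - A k) sequentially"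
  proof (rule borel_cantelli_AE1[OF AM])
    show "summable (\<lambda>k. prob (A k))"
      by (rule summable_comparison_test'[of "\<lambda>k. (1/2::real) ^ k"]) (use Ap in \<open>auto simp: summable_geometric_iff\<close>)
  qed (simp add: less_top[symmetric])
  then have good: "AE \<omega> in M. \<forall>\<^sub>F k in sequentially. \<omega> \<in> space M \<and> (\<forall>s\<in>{0..real k}. \<bar>D k s \<omega>\<bar> \<le> (1/2) ^ k)"
    by eventually_elim (auto elim!: eventually_mono simp: A_def not_less)
  define ok where "ok \<omega> \<longleftrightarrow> (\<forall>\<^sub>F k in sequentially. \<omega> \<in> space M \<and> (\<forall>s\<in>{0..real k}. \<bar>D k s \<omega>\<bar> \<le> (1/2) ^ k))" for \<omega>
  \<comment> \<open>The value 0 off the good event keeps every path continuous. The good event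
    involves the whole future, so adaptedness is taken from the almost sure limit in the augmented
    filtration.\<close>
  define I where "I t \<omega> = (if ok \<omega> then S (r 0) t \<omega> + (\<Sum>k. D k t \<omega>) else 0)" for t \<omega>
  \<comment> \<open>The bound on the \<open>k\<close>-th difference holds up to time
    \<open>k\<close> only, hence the Weierstrass test in its eventual form.\<close>
  have unif: "uniform_limit {0..T} (\<lambda>n t. \<Sum>k<n. D k t \<omega>) (\<lambda>t. \<Sum>k. D k t \<omega>) sequentially"
    if "ok \<omega>" for T \<omega>
  proof (rule Weierstrass_m_test_ev[where M = "\<lambda>k. (1/2) ^ k"])
    have "\<forall>\<^sub>F k in sequentially. T \<le> real k"
      using filterlim_real_sequentially by (simp add: filterlim_at_top)
    with that[unfolded ok_def] show "\<forall>\<^sub>F k in sequentially. \<forall>s\<in>{0..T}. norm (D k s \<omega>) \<le> (1/2) ^ k"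
      by eventually_elim auto
  qed (simp add: summable_geometric_iff)
  have tele: "S (r 0) t \<omega> + (\<Sum>k<n. D k t \<omega>) = S (r n) t \<omega>" for n t \<omega>
    by (induction n) (auto simp: D_def)
  have conv: "(\<lambda>n. S (r n) t \<omega>) \<longlonglongrightarrow> I t \<omega>" if "ok \<omega>" "0 \<le> t" for t \<omega>
  proof -
    have "(\<lambda>n. \<Sum>k<n. D k t \<omega>) \<longlonglongrightarrow> (\<Sum>k. D k t \<omega>)"
      by (rule tendsto_uniform_limitI[OF unif[OF that(1), of t]]) (use that in auto)
    then have "(\<lambda>n. S (r 0) t \<omega> + (\<Sum>k<n. D k t \<omega>)) \<longlonglongrightarrow> S (r 0) t \<omega> + (\<Sum>k. D k t \<omega>)"
      by (intro tendsto_intros)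
    then show ?thesis using that by (simp add: tele I_def)
  qed
  have AEconv: "AE \<omega> in M. (\<lambda>n. S (r n) t \<omega>) \<longlonglongrightarrow> I t \<omega>" if "0 \<le> t" for t
    using good by eventually_elim (use conv that in \<open>auto simp: ok_def\<close>)
  have Icont: "continuous_paths M I"
    unfolding continuous_paths_def
  proof (intro ballI continuous_on_nonnegI)
    fix \<omega> T assume \<omega>: "\<omega> \<in> space M"
    show "continuous_on {0..T} (\<lambda>t. I t \<omega>)"
    proof (cases "ok \<omega>")
      case True
      have cD: "continuous_on {0..T} (\<lambda>t. D k t \<omega>)" for k
        using Dc[of k] \<omega> by (auto simp: continuous_paths_def intro: continuous_on_subset)
      have cS: "continuous_on {0..T} (\<lambda>t. S (r 0) t \<omega>)"
        using Sc[of "r 0"] \<omega> by (auto simp: continuous_paths_def intro: continuous_on_subset)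
      have "continuous_on {0..T} (\<lambda>t. \<Sum>k. D k t \<omega>)"
        by (rule uniform_limit_theorem[OF _ unif[OF True]]) (auto intro!: always_eventually continuous_on_sum cD)
      then show ?thesis using True cS by (auto simp: I_def intro!: continuous_intros)
    qed (simp add: I_def)
  qed
  have Iad: "I t \<in> borel_measurable (F t)" if "0 \<le> t" for t
    by (rule F_measurable_AE_limit[OF that _ AEconv[OF that]]) (rule l2_martingale_adapted[OF Sm that])
  have I0: "I 0 \<omega> = 0" for \<omega>
    by (simp add: I_def S0 D_def)
  have L2: "(\<lambda>n. \<integral>\<^sup>+\<omega>. ennreal ((S n t \<omega> - I t \<omega>)\<^sup>2) \<partial>M) \<longlonglongrightarrow> 0" if t: "0 \<le> t" for t
  proof -
    have a0: "(\<lambda>n. a n t) \<longlonglongrightarrow> 0" unfolding a_def by (rule lim[OF t])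
    then have ar0: "(\<lambda>j. a (r j) t) \<longlonglongrightarrow> 0" using LIMSEQ_subseq_LIMSEQ[OF _ rmono] by (auto simp: o_def)
    have [measurable]: "S n t \<in> borel_measurable M" for n
      using l2_martingale_sq[OF Sm t] by (rule sq_integrable_measurable)
    \<comment> \<open>Fatou's lemma along the subsequence \<open>r\<close> bounds the distance to
      the limit for every index \<open>n\<close>, so the whole sequence converges and not just the
      subsequence.\<close>
    have bound: "(\<integral>\<^sup>+\<omega>. ennreal ((S n t \<omega> - I t \<omega>)\<^sup>2) \<partial>M) \<le> 2 * a n t" for n
    proof -
      have "(\<integral>\<^sup>+\<omega>. ennreal ((S n t \<omega> - I t \<omega>)\<^sup>2) \<partial>M)
          = (\<integral>\<^sup>+\<omega>. liminf (\<lambda>j. ennreal ((S n t \<omega> - S (r j) t \<omega>)\<^sup>2)) \<partial>M)"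
      proof (rule nn_integral_cong_AE)
        show "AE \<omega> in M. ennreal ((S n t \<omega> - I t \<omega>)\<^sup>2) = liminf (\<lambda>j. ennreal ((S n t \<omega> - S (r j) t \<omega>)\<^sup>2))"
          using AEconv[OF t]
        proof eventually_elim
          case (elim \<omega>)
          have "(\<lambda>j. ennreal ((S n t \<omega> - S (r j) t \<omega>)\<^sup>2)) \<longlonglongrightarrow> ennreal ((S n t \<omega> - I t \<omega>)\<^sup>2)"
            by (intro tendsto_ennrealI tendsto_intros elim)
          then show ?case using lim_imp_Liminf[of sequentially] by fastforce
        qed
      qed
      also have "\<dots> \<le> liminf (\<lambda>j. \<integral>\<^sup>+\<omega>. ennreal ((S n t \<omega> - S (r j) t \<omega>)\<^sup>2) \<partial>M)"
        by (rule nn_integral_liminf) measurable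
      also have "\<dots> \<le> liminf (\<lambda>j. 2 * a n t + 2 * a (r j) t)"
        by (rule Liminf_mono) (use dist[OF t] in auto)
      also have "\<dots> = 2 * a n t + 2 * 0"
        by (intro lim_imp_Liminf tendsto_add tendsto_const tendsto_mult_ennreal ar0) auto
      finally show ?thesis by simp
    qed
    have "(\<lambda>n. 2 * a n t) \<longlonglongrightarrow> 2 * 0" by (intro tendsto_mult_ennreal tendsto_const a0) auto
    then have "(\<lambda>n. 2 * a n t) \<longlonglongrightarrow> 0" by simp
    then show ?thesis
      by (rule tendsto_sandwich[OF always_eventually always_eventually tendsto_const, rotated 2]) (simp_all add: bound)
  qed
  show ?thesis
  proof (intro exI[of _ I] conjI)
    show "adapted_process F I" using Iad by (simp add: adapted_process_def)
    show "\<forall>\<omega>\<in>space M. I 0 \<omega> = 0" using I0 by simp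
    show "\<forall>t\<ge>0. (\<lambda>n. \<integral>\<^sup>+\<omega>. ennreal ((simple_integral (G n) W t \<omega> - I t \<omega>)\<^sup>2) \<partial>M) \<longlonglongrightarrow> 0"
      using L2 by (simp add: S_def)
  qed (rule Icont)
qed

end

section \<open>Dyadic sign processes\<close>

text \<open>The value at 0 has to be 1 or -1: only such factors preserve the law of a symmetric
  normal increment, and their squares drop out of second moments.\<close>

definition rsgn :: "real \<Rightarrow> real" where
  "rsgn y = (if y < 0 then -1 else 1)"

lemma rsgn_simps [simp]: "\<bar>rsgn y\<bar> = 1" "rsgn y * rsgn y = 1" "(rsgn y)\<^sup>2 = 1"
  by (simp_all add: rsgn_def)

lemma rsgn_mult_self: "rsgn y * y = \<bar>y\<bar>"
  by (simp add: rsgn_def)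

lemma rsgn_mult_le: "rsgn y * z \<le> \<bar>z\<bar>"
  by (auto simp: rsgn_def)

lemma rsgn_eq_sgn: "y \<noteq> 0 \<Longrightarrow> rsgn y = sgn y"
  by (auto simp: rsgn_def sgn_if)

lemma rsgn_measurable [measurable]: "rsgn \<in> borel_measurable borel"
  unfolding rsgn_def[abs_def] by measurable

lemma rsgn_tendsto:
  assumes "(f \<longlongrightarrow> y) G" "y \<noteq> 0"
  shows "((\<lambda>n. rsgn (f n)) \<longlongrightarrow> rsgn y) G"
proof (rule tendsto_eventually)
  show "\<forall>\<^sub>F n in G. rsgn (f n) = rsgn y"
  proof (cases "y < 0")
    case True
    show ?thesis using order_tendstoD(2)[OF assms(1) True] by eventually_elim (use True in \<open>simp add: rsgn_def\<close>)
  next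
    case False
    then have "0 < y" using assms by simp
    show ?thesis using order_tendstoD(1)[OF assms(1) \<open>0 < y\<close>] by eventually_elim (use False in \<open>simp add: rsgn_def\<close>)
  qed
qed

text \<open>The index \<open>n\<close> governs both the mesh \<open>1 / 2 ^ n\<close> and the
  horizon \<open>n\<close>, so a single limit refines the grid and exhausts the half line. Reading
  the sign at the left endpoint makes the process predictable.\<close>

definition sign_steps :: "(real \<Rightarrow> 'a \<Rightarrow> real) \<Rightarrow> nat \<Rightarrow> 'a simple_steps" where
  "sign_steps Y n = map (\<lambda>i. (real i / 2 ^ n, real (Suc i) / 2 ^ n, \<lambda>\<omega>. rsgn (Y (real i / 2 ^ n) \<omega>))) [0..<n * 2 ^ n]"

lemma simple_value_sign_steps_sum:
  "simple_value (sign_steps Y n) s \<omega>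
    = (\<Sum>i<n * 2 ^ n. rsgn (Y (real i / 2 ^ n) \<omega>) * indicator {real i / 2 ^ n<..real (Suc i) / 2 ^ n} s)"
  by (simp add: simple_value_def sign_steps_def o_def interv_sum_list_conv_sum_set_nat atLeast0LessThan case_prod_unfold)

lemma simple_integral_sign_steps_sum:
  "simple_integral (sign_steps Y n) N t \<omega>
    = (\<Sum>i<n * 2 ^ n. rsgn (Y (real i / 2 ^ n) \<omega>) * (N (min (real (Suc i) / 2 ^ n) t) \<omega> - N (min (real i / 2 ^ n) t) \<omega>))"
  by (simp add: simple_integral_def sign_steps_def o_def interv_sum_list_conv_sum_set_nat atLeast0LessThan case_prod_unfold)

lemma simple_value_sign_steps:
  "simple_value (sign_steps Y n) s \<omega> =
    (if 0 < s \<and> s \<le> real n then rsgn (Y (real (nat (\<lceil>s * 2 ^ n\<rceil> - 1)) / 2 ^ n) \<omega>) else 0)"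
proof -
  \<comment> \<open>The grid intervals are left-open, so the one containing \<open>s\<close> ends at
    \<open>s * 2 ^ n\<close> rounded up, in units of the mesh; its index is one less.\<close>
  define k where "k = nat (\<lceil>s * 2 ^ n\<rceil> - 1)"
  have iff: "(real i / 2 ^ n < s \<and> s \<le> real (Suc i) / 2 ^ n) \<longleftrightarrow> 0 < s \<and> i = k" for i
  proof -
    have "(real i / 2 ^ n < s \<and> s \<le> real (Suc i) / 2 ^ n) \<longleftrightarrow> (real i < s * 2 ^ n \<and> s * 2 ^ n \<le> real i + 1)"
      by (simp add: field_simps)
    also have "\<dots> \<longleftrightarrow> \<lceil>s * 2 ^ n\<rceil> = int i + 1"
      by (simp add: ceiling_eq_iff)
    also have "\<dots> \<longleftrightarrow> 0 < s \<and> i = k"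
    proof (cases "0 < s")
      case True
      then have "0 < \<lceil>s * 2 ^ n\<rceil>" by simp
      then show ?thesis using True by (auto simp: k_def)
    next
      case False
      then have "s * 2 ^ n \<le> 0" by (simp add: mult_nonpos_nonneg)
      then have "\<lceil>s * 2 ^ n\<rceil> \<noteq> int i + 1" by linarith
      then show ?thesis using False by blast
    qed
    finally show ?thesis .
  qed
  have k: "k < n * 2 ^ n \<longleftrightarrow> s \<le> real n" if "0 < s"
  proof -
    have "0 < \<lceil>s * 2 ^ n\<rceil>" using that by simp
    then have "k < n * 2 ^ n \<longleftrightarrow> \<lceil>s * 2 ^ n\<rceil> \<le> int (n * 2 ^ n)" unfolding k_def by linarith
    also have "\<dots> \<longleftrightarrow> s * 2 ^ n \<le> real (n * 2 ^ n)" by (simp add: ceiling_le_iff)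
    finally show ?thesis by simp
  qed
  have "simple_value (sign_steps Y n) s \<omega>
      = (\<Sum>i<n * 2 ^ n. if i = k then (if 0 < s then rsgn (Y (real k / 2 ^ n) \<omega>) else 0) else 0)"
    unfolding simple_value_sign_steps_sum
    using iff by (intro sum.cong refl) (auto simp: indicator_def simp del: of_nat_Suc)
  also have "\<dots> = (if k < n * 2 ^ n then (if 0 < s then rsgn (Y (real k / 2 ^ n) \<omega>) else 0) else 0)"
    by (subst sum.delta) auto
  finally show ?thesis using k by (auto simp: k_def)
qed

lemma simple_value_sign_steps_abs_le: "\<bar>simple_value (sign_steps Y n) s \<omega>\<bar> \<le> 1"
  by (simp add: simple_value_sign_steps)

lemma dyadic_ceiling_tendsto:
  assumes "0 < (s::real)"
  shows "(\<lambda>n. real (nat (\<lceil>s * 2 ^ n\<rceil> - 1)) / 2 ^ n) \<longlonglongrightarrow> s"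
proof (rule dyadic_tendsto)
  fix n :: nat
  have "0 < \<lceil>s * 2 ^ n\<rceil>" using assms by simp
  then show "\<bar>s * 2 ^ n - real (nat (\<lceil>s * 2 ^ n\<rceil> - 1))\<bar> \<le> 1" by linarith
qed

lemma simple_value_sign_steps_tendsto:
  assumes c: "continuous_on {0..} (\<lambda>t. Y t \<omega>)" and s: "0 < s" "Y s \<omega> \<noteq> 0"
  shows "(\<lambda>n. simple_value (sign_steps Y n) s \<omega>) \<longlonglongrightarrow> rsgn (Y s \<omega>)"
proof -
  have "(\<lambda>n. Y (real (nat (\<lceil>s * 2 ^ n\<rceil> - 1)) / 2 ^ n) \<omega>) \<longlonglongrightarrow> Y s \<omega>"
    by (rule continuous_on_tendsto_compose[OF c dyadic_ceiling_tendsto[OF s(1)]]) (use s in auto)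
  then have "(\<lambda>n. rsgn (Y (real (nat (\<lceil>s * 2 ^ n\<rceil> - 1)) / 2 ^ n) \<omega>)) \<longlonglongrightarrow> rsgn (Y s \<omega>)"
    by (rule rsgn_tendsto[OF _ s(2)])
  moreover have "\<forall>\<^sub>F n in sequentially. s \<le> real n"
    using filterlim_real_sequentially by (simp add: filterlim_at_top)
  then have "\<forall>\<^sub>F n in sequentially. rsgn (Y (real (nat (\<lceil>s * 2 ^ n\<rceil> - 1)) / 2 ^ n) \<omega>) = simple_value (sign_steps Y n) s \<omega>"
    by eventually_elim (use s in \<open>simp add: simple_value_sign_steps\<close>)
  ultimately show ?thesis by (rule Lim_transform_eventually)
qed

text \<open>Steps from the grid index \<open>l\<close> on have both ends stopped at the same time
  and drop out.\<close>

lemma simple_integral_sign_steps_dyadic: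
  assumes "l \<le> n * 2 ^ n"
  shows "simple_integral (sign_steps Y n) N (real l / 2 ^ n) \<omega>
    = (\<Sum>i<l. rsgn (Y (real i / 2 ^ n) \<omega>) * (N (real (Suc i) / 2 ^ n) \<omega> - N (real i / 2 ^ n) \<omega>))"
proof -
  have mm: "min (real i / 2 ^ n) (real l / 2 ^ n) = real (min i l) / 2 ^ n" for i
    by (auto simp: min_def divide_le_cancel)
  have "simple_integral (sign_steps Y n) N (real l / 2 ^ n) \<omega>
     = (\<Sum>i<n * 2 ^ n. rsgn (Y (real i / 2 ^ n) \<omega>) * (N (real (min (Suc i) l) / 2 ^ n) \<omega> - N (real (min i l) / 2 ^ n) \<omega>))"
    unfolding simple_integral_sign_steps_sum mm ..
  also have "\<dots> = (\<Sum>i<l. rsgn (Y (real i / 2 ^ n) \<omega>) * (N (real (min (Suc i) l) / 2 ^ n) \<omega> - N (real (min i l) / 2 ^ n) \<omega>))"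
    by (rule sum.mono_neutral_right) (use assms in \<open>auto simp: min_def\<close>)
  also have "\<dots> = (\<Sum>i<l. rsgn (Y (real i / 2 ^ n) \<omega>) * (N (real (Suc i) / 2 ^ n) \<omega> - N (real i / 2 ^ n) \<omega>))"
    by (intro sum.cong refl) (simp add: min_absorb1 del: of_nat_Suc)
  finally show ?thesis .
qed

text \<open>The discrete form of Tanaka's formula: \<open>|z| - |y| \<ge> rsgn y * (z - y)\<close> because \<open>rsgn y\<close> is a
  subgradient of the absolute value at \<open>y\<close>.\<close>

lemma simple_integral_sign_steps_le:
  assumes "j \<le> l" "l \<le> n * 2 ^ n"
  shows "simple_integral (sign_steps Y n) Y (real l / 2 ^ n) \<omega> - simple_integral (sign_steps Y n) Y (real j / 2 ^ n) \<omega>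
    \<le> \<bar>Y (real l / 2 ^ n) \<omega>\<bar> - \<bar>Y (real j / 2 ^ n) \<omega>\<bar>"
  using assms
proof (induction l rule: dec_induct)
  case base
  then show ?case by simp
next
  case (step l)
  let ?y = "Y (real l / 2 ^ n) \<omega>" and ?z = "Y (real (Suc l) / 2 ^ n) \<omega>"
  have "simple_integral (sign_steps Y n) Y (real (Suc l) / 2 ^ n) \<omega>
    = simple_integral (sign_steps Y n) Y (real l / 2 ^ n) \<omega> + rsgn ?y * (?z - ?y)"
    using step.prems by (simp add: simple_integral_sign_steps_dyadic del: of_nat_Suc)
  moreover have "rsgn ?y * (?z - ?y) \<le> \<bar>?z\<bar> - \<bar>?y\<bar>"
    using rsgn_mult_le[of ?y ?z] rsgn_mult_self[of ?y] by (simp add: right_diff_distrib)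
  ultimately show ?case using step.IH step.prems by simp
qed

lemma simple_integral_diff_integrator:
  "simple_integral D (\<lambda>t \<omega>. N t \<omega> - K t \<omega>) t \<omega> = simple_integral D N t \<omega> - simple_integral D K t \<omega>"
  by (simp add: simple_integral_nth sum_subtractf[symmetric] algebra_simps)

text \<open>Each side is a double sum of products of coefficients with the increment of
  \<open>W\<close> over the intersection of two intervals, stopped at \<open>t\<close>, and this
  increment is symmetric in the two intervals. It is the associativity of the integral for simple
  processes, path by path.\<close>

lemma simple_integral_commute:
  "simple_integral D (simple_integral E W) t \<omega> = simple_integral E (simple_integral D W) t \<omega>"
proof -
  have x: "d * ((\<Sum>j<n. e j * (a j - b j)) - (\<Sum>j<n. e j * (a' j - b' j)))
    = (\<Sum>j<n. d * e j * (a j - b j - a' j + b' j))" for d :: real and n :: nat and e a b a' b'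
    by (simp add: sum_subtractf[symmetric] sum_distrib_left algebra_simps)
  show ?thesis
    unfolding simple_integral_nth x
    by (subst sum.swap) (intro sum.cong refl, simp add: algebra_simps min.commute min.left_commute)
qed

context stochastic_basis
begin

lemma simple_steps_sign_steps:
  assumes "adapted_process F Y"
  shows "simple_steps F (sign_steps Y n)"
proof -
  have "(\<lambda>\<omega>. rsgn (Y (real i / 2 ^ n) \<omega>)) \<in> borel_measurable (F (real i / 2 ^ n))" for i
    using assms by (auto simp: adapted_process_def intro!: measurable_compose[OF _ rsgn_measurable])
  then show ?thesis
    by (auto simp: simple_steps_def sign_steps_def divide_right_mono intro!: exI[of _ 1])
qed

text \<open>Martingale increments are orthogonal and the signs square to 1, so the second moment of
  the sum is that of \<open>N\<close> at the final time minus that of \<open>N\<close> at time 0.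
  The bound is the same for all meshes, which later permits the exchange of limits.\<close>

lemma simple_integral_sign_steps_contraction:
  assumes N: "l2_martingale N" and Y: "adapted_process F Y" and l: "l \<le> n * 2 ^ n"
  shows "(\<integral>\<omega>. (simple_integral (sign_steps Y n) N (real l / 2 ^ n) \<omega>)\<^sup>2 \<partial>M) \<le> (\<integral>\<omega>. (N (real l / 2 ^ n) \<omega>)\<^sup>2 \<partial>M)"
proof -
  define c where "c i = real i / 2 ^ n" for i
  define S where "S l = simple_integral (sign_steps Y n) N (c l)" for l
  define e where "e i \<omega> = rsgn (Y (c i) \<omega>)" for i \<omega>
  have c: "0 \<le> c i" "c i \<le> c (Suc i)" for i by (auto simp: c_def divide_right_mono)
  have Sm: "l2_martingale (simple_integral (sign_steps Y n) N)"
    by (rule l2_martingale_simple_integral[OF N simple_steps_sign_steps[OF Y]])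
  have em: "e i \<in> borel_measurable (F (c i))" for i
    using Y c unfolding e_def adapted_process_def by (auto intro!: measurable_compose[OF _ rsgn_measurable])
  have "(\<integral>\<omega>. (S l \<omega>)\<^sup>2 \<partial>M) = (\<integral>\<omega>. (N (c l) \<omega>)\<^sup>2 \<partial>M) - (\<integral>\<omega>. (N (c 0) \<omega>)\<^sup>2 \<partial>M)"
    using l
  proof (induction l)
    case 0
    then show ?case by (simp add: S_def c_def simple_integral_sign_steps_dyadic[of 0, simplified])
  next
    case (Suc l)
    define d where "d \<omega> = N (c (Suc l)) \<omega> - N (c l) \<omega>" for \<omega>
    have S: "S (Suc l) \<omega> = S l \<omega> + e l \<omega> * d \<omega>" for \<omega>
      using Suc.prems by (simp add: S_def c_def e_def d_def simple_integral_sign_steps_dyadic del: of_nat_Suc)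
    have Ssq: "sq_integrable M (S l)" unfolding S_def by (rule l2_martingale_sq[OF Sm c(1)])
    have Nsq: "sq_integrable M (N (c l))" "sq_integrable M (N (c (Suc l)))" by (rule l2_martingale_sq[OF N c(1)])+
    have dsq: "sq_integrable M d" unfolding d_def by (rule sq_integrable_diff[OF Nsq(2,1)])
    have esq: "sq_integrable M (\<lambda>\<omega>. e l \<omega> * S l \<omega>)"
      by (rule sq_integrable_bounded_mult[OF Ssq F_measurable_M[OF c(1) em], where K = 1]) (simp add: e_def)
    have ZF: "(\<lambda>\<omega>. e l \<omega> * S l \<omega>) \<in> borel_measurable (F (c l))"
      using em[of l] l2_martingale_adapted[OF Sm c(1)[of l]] by (simp add: S_def)
    have "(\<integral>\<omega>. (S (Suc l) \<omega>)\<^sup>2 \<partial>M) = (\<integral>\<omega>. (S l \<omega>)\<^sup>2 + 2 * ((e l \<omega> * S l \<omega>) * d \<omega>) + (d \<omega>)\<^sup>2 \<partial>M)"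
    proof (rule Bochner_Integration.integral_cong[OF refl])
      fix \<omega>
      have "(e l \<omega>)\<^sup>2 = 1" by (simp add: e_def)
      then show "(S (Suc l) \<omega>)\<^sup>2 = (S l \<omega>)\<^sup>2 + 2 * ((e l \<omega> * S l \<omega>) * d \<omega>) + (d \<omega>)\<^sup>2"
        by (simp add: S power2_sum power_mult_distrib algebra_simps)
    qed
    also have "\<dots> = (\<integral>\<omega>. (S l \<omega>)\<^sup>2 \<partial>M) + (\<integral>\<omega>. (d \<omega>)\<^sup>2 \<partial>M)"
      using sq_integrable_square[OF Ssq] sq_integrable_square[OF dsq] sq_integrable_mult_integrable[OF esq dsq]
        l2_martingale_orth[OF N c ZF esq] by (simp add: d_def)
    also have "(\<integral>\<omega>. (d \<omega>)\<^sup>2 \<partial>M) = (\<integral>\<omega>. (N (c (Suc l)) \<omega>)\<^sup>2 - (N (c l) \<omega>)\<^sup>2 - 2 * (N (c l) \<omega> * d \<omega>) \<partial>M)"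
      by (simp add: d_def power2_eq_square algebra_simps)
    also have "\<dots> = (\<integral>\<omega>. (N (c (Suc l)) \<omega>)\<^sup>2 \<partial>M) - (\<integral>\<omega>. (N (c l) \<omega>)\<^sup>2 \<partial>M)"
      using sq_integrable_square[OF Nsq(1)] sq_integrable_square[OF Nsq(2)] sq_integrable_mult_integrable[OF Nsq(1) dsq]
        l2_martingale_orth[OF N c l2_martingale_adapted[OF N c(1)] Nsq(1)] by (simp add: d_def)
    finally show ?case using Suc by simp
  qed
  moreover have "0 \<le> (\<integral>\<omega>. (N (c 0) \<omega>)\<^sup>2 \<partial>M)" by simp
  ultimately show ?thesis by (simp add: S_def c_def)
qed

text \<open>A continuous path is the limit of its values at times rounded down to dyadic grids, and
  on each grid only countably many random variables occur. Nothing is known at negative times, hence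
  \<open>max 0 s\<close>.\<close>

lemma continuous_process_measurable:
  assumes c: "continuous_paths M Y" and m: "\<And>t. 0 \<le> t \<Longrightarrow> Y t \<in> borel_measurable M"
  shows "(\<lambda>(\<omega>, s). Y (max 0 s) \<omega>) \<in> borel_measurable (M \<Otimes>\<^sub>M lborel)"
proof (rule borel_measurable_LIMSEQ_metric)
  fix n :: nat
  show "(\<lambda>x. Y (real (nat \<lfloor>max 0 (snd x) * (2::real) ^ n\<rfloor>) / 2 ^ n) (fst x)) \<in> borel_measurable (M \<Otimes>\<^sub>M lborel)"
  proof (rule measurable_compose_countable[where f = "\<lambda>i x. Y (real i / 2 ^ n) (fst x)"
        and g = "\<lambda>x. nat \<lfloor>max 0 (snd x) * (2::real) ^ n\<rfloor>"])
    show "(\<lambda>x. Y (real i / 2 ^ n) (fst x)) \<in> borel_measurable (M \<Otimes>\<^sub>M lborel)" for i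
      by (rule measurable_compose[OF measurable_fst m]) simp
    have "(\<lambda>s::real. nat \<lfloor>max 0 s * 2 ^ n\<rfloor>) \<in> measurable lborel (count_space UNIV)" by measurable
    then show "(\<lambda>x. nat \<lfloor>max 0 (snd x) * (2::real) ^ n\<rfloor>) \<in> measurable (M \<Otimes>\<^sub>M lborel) (count_space UNIV)"
      by (rule measurable_compose[OF measurable_snd])
  qed
next
  fix x assume "x \<in> space (M \<Otimes>\<^sub>M (lborel :: real measure))"
  then obtain \<omega> s where x: "x = (\<omega>, s)" "\<omega> \<in> space M" by (auto simp: space_pair_measure)
  have "continuous_on {0..} (\<lambda>t. Y t \<omega>)" using c x by (simp add: continuous_paths_def)
  then have "(\<lambda>n. Y (real (nat \<lfloor>max 0 s * 2 ^ n\<rfloor>) / 2 ^ n) \<omega>) \<longlonglongrightarrow> Y (max 0 s) \<omega>"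
    by (rule continuous_on_tendsto_compose[OF _ dyadic_floor_tendsto]) auto
  then show "(\<lambda>n. Y (real (nat \<lfloor>max 0 (snd x) * 2 ^ n\<rfloor>) / 2 ^ n) (fst x)) \<longlonglongrightarrow> (case x of (\<omega>, s) \<Rightarrow> Y (max 0 s) \<omega>)"
    by (simp add: x)
qed

text \<open>Dominated convergence is applied twice, in time for a fixed path and then over outcomes.
  The signs converge wherever \<open>Y\<close> is nonzero; the dominating constant 4 is the square
  of the largest distance between two numbers of modulus at most 1.\<close>

lemma sign_steps_L2_tendsto:
  assumes Y: "adapted_process F Y" "continuous_paths M Y"
    and nz: "AE \<omega> in M. AE s in lborel. 0 \<le> s \<longrightarrow> Y s \<omega> \<noteq> 0" and t: "0 \<le> t"
  shows "(\<lambda>n. \<integral>\<^sup>+\<omega>. (\<integral>\<^sup>+s\<in>{0..t}. ennreal ((simple_value (sign_steps Y n) s \<omega> - rsgn (Y s \<omega>))\<^sup>2) \<partial>lborel) \<partial>M) \<longlonglongrightarrow> 0"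
proof -
  define f where "f n \<omega> s = ennreal ((simple_value (sign_steps Y n) s \<omega> - rsgn (Y s \<omega>))\<^sup>2) * indicator {0..t} s"
    for n \<omega> s
  have Ym: "Y t \<in> borel_measurable M" if "0 \<le> t" for t
    by (rule adapted_process_measurable[OF Y(1) that])
  have fm: "(\<lambda>(\<omega>, s). f n \<omega> s) \<in> borel_measurable (M \<Otimes>\<^sub>M lborel)" for n
  proof -
    have 1: "(\<lambda>x. indicator {0..t} (snd x) :: ennreal) \<in> borel_measurable (M \<Otimes>\<^sub>M lborel)"
      by (rule measurable_compose[OF measurable_snd]) simp
    have "(\<lambda>x. ennreal (((case x of (\<omega>, s) \<Rightarrow> simple_value (sign_steps Y n) s \<omega>)
        - rsgn (case x of (\<omega>, s) \<Rightarrow> Y (max 0 s) \<omega>))\<^sup>2) * indicator {0..t} (snd x)) \<in> borel_measurable (M \<Otimes>\<^sub>M lborel)"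
      using 1 simple_value_measurable[OF simple_steps_sign_steps[OF Y(1)]] continuous_process_measurable[OF Y(2) Ym]
      by measurable
    also have "(\<lambda>x. ennreal (((case x of (\<omega>, s) \<Rightarrow> simple_value (sign_steps Y n) s \<omega>)
        - rsgn (case x of (\<omega>, s) \<Rightarrow> Y (max 0 s) \<omega>))\<^sup>2) * indicator {0..t} (snd x)) = (\<lambda>(\<omega>, s). f n \<omega> s)"
      by (auto simp: f_def indicator_def fun_eq_iff)
    finally show ?thesis .
  qed
  have fm1: "f n \<omega> \<in> borel_measurable lborel" if "\<omega> \<in> space M" for n \<omega>
    using measurable_compose[OF measurable_Pair1'[OF that] fm] by simp
  have fm2: "(\<lambda>\<omega>. \<integral>\<^sup>+s. f n \<omega> s \<partial>lborel) \<in> borel_measurable M" for n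
    by (rule lborel.borel_measurable_nn_integral[OF fm])
  have bd: "f n \<omega> s \<le> 4 * indicator {0..t} s" for n \<omega> s
  proof -
    have "\<bar>simple_value (sign_steps Y n) s \<omega> - rsgn (Y s \<omega>)\<bar> \<le> 2"
      using simple_value_sign_steps_abs_le[of Y n s \<omega>] rsgn_simps(1)[of "Y s \<omega>"] by linarith
    then have "\<bar>simple_value (sign_steps Y n) s \<omega> - rsgn (Y s \<omega>)\<bar>\<^sup>2 \<le> 2\<^sup>2" by (intro power_mono) auto
    then have "ennreal ((simple_value (sign_steps Y n) s \<omega> - rsgn (Y s \<omega>))\<^sup>2) \<le> ennreal 4"
      by (intro ennreal_leI) simp
    then show ?thesis by (auto simp: f_def indicator_def)
  qed
  have fin: "(\<integral>\<^sup>+s. 4 * indicator {0..t} s \<partial>lborel) = ennreal (4 * t)"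
    using t by (subst nn_integral_cmult) (auto simp: ennreal_mult)
  have inner: "AE \<omega> in M. (\<lambda>n. \<integral>\<^sup>+s. f n \<omega> s \<partial>lborel) \<longlonglongrightarrow> 0"
    using nz AE_space
  proof eventually_elim
    case (elim \<omega>)
    have c: "continuous_on {0..} (\<lambda>t. Y t \<omega>)" using Y(2) elim(2) by (simp add: continuous_paths_def)
    have "(\<lambda>n. \<integral>\<^sup>+s. f n \<omega> s \<partial>lborel) \<longlonglongrightarrow> (\<integral>\<^sup>+(s::real). 0 \<partial>lborel)"
    proof (rule nn_integral_dominated_convergence[where w = "\<lambda>s. 4 * indicator {0..t} s"])
      show "(\<integral>\<^sup>+s. 4 * indicator {0..t} s \<partial>lborel) < \<infinity>" unfolding fin by simp
      \<comment> \<open>Time 0 lies in no left-open grid interval and is discarded as a null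
        set.\<close>
      show "AE s in lborel. (\<lambda>n. f n \<omega> s) \<longlonglongrightarrow> 0"
        using elim(1) AE_lborel_singleton[of 0]
      proof eventually_elim
        case (elim s)
        show ?case
        proof (cases "0 < s")
          case True
          have "(\<lambda>n. simple_value (sign_steps Y n) s \<omega>) \<longlonglongrightarrow> rsgn (Y s \<omega>)"
            by (rule simple_value_sign_steps_tendsto[where Y = Y and \<omega> = \<omega>, OF c True]) (use elim True in simp)
          then have "(\<lambda>n. ennreal ((simple_value (sign_steps Y n) s \<omega> - rsgn (Y s \<omega>))\<^sup>2)) \<longlonglongrightarrow> ennreal ((rsgn (Y s \<omega>) - rsgn (Y s \<omega>))\<^sup>2)"
            by (intro tendsto_ennrealI tendsto_intros)
          then show ?thesis by (cases "s \<in> {0..t}") (simp_all add: f_def)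
        next
          case False
          then show ?thesis using elim by (simp add: f_def)
        qed
      qed
    qed (use fm1[OF elim(2)] bd in auto)
    then show ?case by simp
  qed
  have "(\<lambda>n. \<integral>\<^sup>+\<omega>. (\<integral>\<^sup>+s. f n \<omega> s \<partial>lborel) \<partial>M) \<longlonglongrightarrow> (\<integral>\<^sup>+\<omega>. 0 \<partial>M)"
  proof (rule nn_integral_dominated_convergence[where w = "\<lambda>_. ennreal (4 * t)"])
    show "AE \<omega> in M. (\<integral>\<^sup>+s. f n \<omega> s \<partial>lborel) \<le> ennreal (4 * t)" for n
      unfolding fin[symmetric] by (intro AE_I2 nn_integral_mono bd)
    show "(\<integral>\<^sup>+\<omega>. ennreal (4 * t) \<partial>M) < \<infinity>" by (simp add: emeasure_space_1)
  qed (use fm2 inner in auto)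
  then show ?thesis by (simp add: f_def)
qed

end

section \<open>A characterization of Brownian motion\<close>

text \<open>The convergence in \<open>ito_integral\<close> is stated with nonnegative integrals,
  which might be infinite. Finiteness for a single index already makes \<open>l\<close> square
  integrable, after which all terms are real integrals.\<close>

lemma sq_limit_of_nn_integral:
  assumes f: "\<And>n::nat. sq_integrable M (f n)" and l: "l \<in> borel_measurable M"
    and lim: "(\<lambda>n. \<integral>\<^sup>+\<omega>. ennreal ((f n \<omega> - l \<omega>)\<^sup>2) \<partial>M) \<longlonglongrightarrow> 0"
  shows "sq_integrable M l" and "(\<lambda>n. \<integral>\<omega>. (f n \<omega> - l \<omega>)\<^sup>2 \<partial>M) \<longlonglongrightarrow> 0"
proof -
  have "\<forall>\<^sub>F n in sequentially. (\<integral>\<^sup>+\<omega>. ennreal ((f n \<omega> - l \<omega>)\<^sup>2) \<partial>M) < \<infinity>"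
    using order_tendstoD(2)[OF lim, of \<infinity>] by simp
  then obtain n where n: "(\<integral>\<^sup>+\<omega>. ennreal ((f n \<omega> - l \<omega>)\<^sup>2) \<partial>M) < \<infinity>"
    by (auto simp: eventually_sequentially)
  have "sq_integrable M (\<lambda>\<omega>. f n \<omega> - l \<omega>)"
    by (rule sq_integrableI[OF _ n]) (use f[of n] l in \<open>auto simp: sq_integrable_def\<close>)
  from sq_integrable_diff[OF f[of n] this] show l: "sq_integrable M l" by simp
  have d: "sq_integrable M (\<lambda>\<omega>. f n \<omega> - l \<omega>)" for n by (rule sq_integrable_diff[OF f l])
  have "(\<lambda>n. ennreal (\<integral>\<omega>. (f n \<omega> - l \<omega>)\<^sup>2 \<partial>M)) \<longlonglongrightarrow> ennreal 0"
    using lim by (simp add: sq_integrable_nn_integral[OF d])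
  then show "(\<lambda>n. \<integral>\<omega>. (f n \<omega> - l \<omega>)\<^sup>2 \<partial>M) \<longlonglongrightarrow> 0"
    by (subst (asm) tendsto_ennreal_iff) auto
qed

lemma char_normal:
  assumes "0 < \<sigma>"
  shows "char (density lborel (normal_density 0 \<sigma>)) u = of_real (exp (- (u\<^sup>2 * \<sigma>\<^sup>2) / 2))"
proof -
  interpret N: prob_space std_normal_distribution by (rule prob_space_normal_density) simp
  have "distributed std_normal_distribution lborel (\<lambda>x. x) std_normal_density"
    unfolding distributed_def by (auto simp: distr_id2 intro!: distr_id2[symmetric])
  then have "distributed std_normal_distribution lborel (\<lambda>x. 0 + \<sigma> * x) (normal_density (0 + \<sigma> * 0) (\<bar>\<sigma>\<bar> * 1))"
    using assms by (intro N.normal_density_affine) auto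
  then have "distr std_normal_distribution lborel (\<lambda>x. \<sigma> * x) = density lborel (normal_density 0 \<sigma>)"
    using assms by (simp add: distributed_def)
  then have "char (density lborel (normal_density 0 \<sigma>)) u = (CLINT x|distr std_normal_distribution lborel (\<lambda>x. \<sigma> * x). iexp (u * x))"
    by (simp add: char_def)
  also have "\<dots> = (CLINT x|std_normal_distribution. iexp (u * (\<sigma> * x)))"
    by (subst integral_distr) auto
  also have "\<dots> = char std_normal_distribution (u * \<sigma>)"
    by (simp add: char_def mult.assoc)
  finally show ?thesis by (simp add: char_std_normal_distribution power_mult_distrib)
qed

context stochastic_basis
begin

text \<open>Testing against events of \<open>F s\<close> yields law and independence at once. For an
  event of positive probability the hypothesis states that under the conditional measure the
  increment has the normal characteristic function; by Levy's uniqueness theorem its conditional law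
  is normal, whatever the event.\<close>

lemma brownian_motionI_char:
  assumes ad: "adapted_process F B" and cont: "continuous_paths M B" and B0: "AE \<omega> in M. B 0 \<omega> = 0"
    and ch: "\<And>s t u A. 0 \<le> s \<Longrightarrow> s < t \<Longrightarrow> A \<in> sets (F s) \<Longrightarrow>
      (\<integral>\<omega>. complex_of_real (indicator A \<omega>) * iexp (u * (B t \<omega> - B s \<omega>)) \<partial>M)
        = of_real (prob A * exp (- (u\<^sup>2 * (t - s)) / 2))"
  shows "brownian_motion M F B"
proof -
  { fix s t :: real assume st: "0 \<le> s" "s < t"
    define \<nu> where "\<nu> = density lborel (\<lambda>z. ennreal (normal_density 0 (sqrt (t - s)) z))"
    define D where "D \<omega> = B t \<omega> - B s \<omega>" for \<omega>
    have Bm: "B r \<in> borel_measurable M" if "0 \<le> r" for r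
      by (rule adapted_process_measurable[OF ad that])
    have Dm[measurable]: "D \<in> borel_measurable M" unfolding D_def using Bm[of s] Bm[of t] st by simp
    have pos: "0 < sqrt (t - s)" using st by simp
    have \<nu>r: "real_distribution \<nu>"
      unfolding real_distribution_def real_distribution_axioms_def \<nu>_def
      using prob_space_normal_density[OF pos, of 0] by simp
    have key: "prob (A \<inter> (D -` C \<inter> space M)) = prob A * measure \<nu> C" if A: "A \<in> sets (F s)" and C: "C \<in> sets borel" for A C
    proof -
      have AM[measurable]: "A \<in> sets M" using A subalg[OF st(1)] by (auto simp: subalgebra_def)
      show ?thesis
      proof (cases "prob A = 0")
        case True
        have "prob (A \<inter> (D -` C \<inter> space M)) \<le> prob A" by (rule finite_measure_mono) auto
        then show ?thesis using True measure_nonneg[of M "A \<inter> (D -` C \<inter> space M)"] by simp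
      next
        case False
        then have pA: "0 < prob A" using measure_nonneg[of M A] by linarith
        define Q where "Q = density M (\<lambda>\<omega>. ennreal (indicator A \<omega> / prob A))"
        have Qem: "emeasure Q E = ennreal (prob (A \<inter> E) / prob A)" if E: "E \<in> sets M" for E
        proof -
          have "emeasure Q E = (\<integral>\<^sup>+\<omega>. ennreal (indicator A \<omega> / prob A) * indicator E \<omega> \<partial>M)"
            unfolding Q_def using E by (subst emeasure_density) auto
          also have "\<dots> = (\<integral>\<^sup>+\<omega>. ennreal (1 / prob A) * indicator (A \<inter> E) \<omega> \<partial>M)"
            by (intro nn_integral_cong) (auto simp: indicator_def)
          also have "\<dots> = ennreal (1 / prob A) * emeasure M (A \<inter> E)"
            using E by (subst nn_integral_cmult_indicator) auto
          also have "\<dots> = ennreal (prob (A \<inter> E) / prob A)"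
            by (simp add: emeasure_eq_measure ennreal_mult'[symmetric])
          finally show ?thesis .
        qed
        have "emeasure Q (space Q) = 1"
        proof -
          have "A \<inter> space M = A" using sets.sets_into_space[OF AM] by auto
          then show ?thesis using Qem[of "space M"] pA by (simp add: Q_def)
        qed
        then interpret Q: prob_space Q by (rule prob_spaceI)
        have DQ[measurable]: "D \<in> borel_measurable Q" by (simp add: Q_def)
        have "distr Q borel D = \<nu>"
        proof (rule Levy_uniqueness)
          show "real_distribution (distr Q borel D)" by (rule Q.real_distribution_distr) simp
          show "char (distr Q borel D) = char \<nu>"
          proof
            fix u
            have "char (distr Q borel D) u = (CLINT \<omega>|Q. iexp (u * D \<omega>))"
              unfolding char_def by (subst integral_distr) auto
            also have "\<dots> = (CLINT \<omega>|M. (indicator A \<omega> / prob A) *\<^sub>R iexp (u * D \<omega>))"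
              unfolding Q_def by (subst integral_density) auto
            also have "\<dots> = (CLINT \<omega>|M. complex_of_real (1 / prob A) * (complex_of_real (indicator A \<omega>) * iexp (u * (B t \<omega> - B s \<omega>))))"
              by (simp add: scaleR_conv_of_real D_def)
            also have "\<dots> = complex_of_real (1 / prob A) * of_real (prob A * exp (- (u\<^sup>2 * (t - s)) / 2))"
              by (subst integral_mult_right_zero) (simp only: ch[OF st A])
            also have "\<dots> = of_real (exp (- (u\<^sup>2 * (t - s)) / 2))" using pA by simp
            also have "\<dots> = char \<nu> u"
              unfolding \<nu>_def char_normal[OF pos] using st by simp
            finally show "char (distr Q borel D) u = char \<nu> u" .
          qed
        qed (rule \<nu>r)
        then have "measure \<nu> C = measure (distr Q borel D) C" by simp
        also have "\<dots> = measure Q (D -` C \<inter> space M)"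
          using C by (subst measure_distr) (auto simp: Q_def)
        also have "\<dots> = prob (A \<inter> (D -` C \<inter> space M)) / prob A"
          unfolding measure_def[of Q] using C by (subst Qem) auto
        finally show ?thesis using pA by simp
      qed
    qed
    have top: "space M \<in> sets (F s)" using sets.top[of "F s"] space_F[OF st(1)] by simp
    \<comment> \<open>The whole space as conditioning event gives the unconditional law, so that
      \<open>key\<close> becomes the product formula.\<close>
    have PD: "prob (D -` C \<inter> space M) = measure \<nu> C" if "C \<in> sets borel" for C
    proof -
      have "space M \<inter> (D -` C \<inter> space M) = D -` C \<inter> space M" by auto
      then show ?thesis using key[OF top that] by (simp add: prob_space)
    qed
    interpret N: real_distribution \<nu> by (rule \<nu>r)
    have "distr M lborel D = \<nu>"
    proof (rule measure_eqI)
      fix C assume "C \<in> sets (distr M lborel D)"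
      then have C: "C \<in> sets borel" by simp
      then have "emeasure (distr M lborel D) C = emeasure M (D -` C \<inter> space M)"
        by (subst emeasure_distr) auto
      also have "\<dots> = emeasure \<nu> C"
        using PD[OF C] by (simp add: emeasure_eq_measure N.emeasure_eq_measure)
      finally show "emeasure (distr M lborel D) C = emeasure \<nu> C" .
    qed (simp add: \<nu>_def)
    then have dist: "distributed M lborel D (\<lambda>z. ennreal (normal_density 0 (sqrt (t - s)) z))"
      by (auto simp: distributed_def \<nu>_def)
    have ind: "indep_set (sets (F s)) {D -` C \<inter> space M | C. C \<in> sets borel}"
      unfolding indep_sets2_eq
    proof (intro conjI ballI)
      show "sets (F s) \<subseteq> events" using subalg[OF st(1)] by (simp add: subalgebra_def)
      show "{D -` C \<inter> space M |C. C \<in> sets borel} \<subseteq> events" by auto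
      fix a b assume a: "a \<in> sets (F s)" and "b \<in> {D -` C \<inter> space M |C. C \<in> sets borel}"
      then obtain C where "b = D -` C \<inter> space M" "C \<in> sets borel" by auto
      then show "prob (a \<inter> b) = prob a * prob b" using key[OF a] PD by simp
    qed
    note dist[unfolded D_def] ind[unfolded D_def] }
  then show ?thesis
    unfolding brownian_motion_def using ad cont B0 by blast
qed

section \<open>Characteristic functions of sign-changed Brownian increments\<close>

lemma brownian_increment_char:
  assumes W: "brownian_motion M F W" and st: "0 \<le> s" "s < t"
  shows "(\<integral>\<omega>. iexp (u * (W t \<omega> - W s \<omega>)) \<partial>M) = of_real (exp (- (u\<^sup>2 * (t - s)) / 2))"
proof -
  note d = brownian_motionD(4)[OF W st]
  have m: "(\<lambda>\<omega>. W t \<omega> - W s \<omega>) \<in> measurable M lborel"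
    using d by (simp add: distributed_def)
  have "(\<integral>\<omega>. iexp (u * (W t \<omega> - W s \<omega>)) \<partial>M) = char (distr M lborel (\<lambda>\<omega>. W t \<omega> - W s \<omega>)) u"
    unfolding char_def by (subst integral_distr[OF m]) auto
  also have "distr M lborel (\<lambda>\<omega>. W t \<omega> - W s \<omega>) = density lborel (\<lambda>z. ennreal (normal_density 0 (sqrt (t - s)) z))"
    using d by (simp add: distributed_def)
  finally show ?thesis using st by (simp add: char_normal)
qed

text \<open>A sign change that is known at the start of an increment does not affect its conditional law,
  because the normal distribution is symmetric.\<close>

lemma brownian_signed_increment_char:
  fixes Z :: "'a \<Rightarrow> complex" and e :: "'a \<Rightarrow> real"
  assumes W: "brownian_motion M F W" and st: "0 \<le> s" "s < t"
    and Z: "Z \<in> borel_measurable (F s)" and Zb: "\<And>\<omega>. \<omega> \<in> space M \<Longrightarrow> norm (Z \<omega>) \<le> K"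
    and e: "e \<in> borel_measurable (F s)" and e1: "\<And>\<omega>. e \<omega> = 1 \<or> e \<omega> = -1"
  shows "(\<integral>\<omega>. Z \<omega> * iexp (u * (e \<omega> * (W t \<omega> - W s \<omega>))) \<partial>M) = (\<integral>\<omega>. Z \<omega> \<partial>M) * of_real (exp (- (u\<^sup>2 * (t - s)) / 2))"
proof -
  \<comment> \<open>\<open>P\<close> and \<open>R\<close> are the parts of \<open>Z\<close> on the
    events \<open>e = 1\<close> and \<open>e = -1\<close>. On each of them the sign is constant and
    at most replaces \<open>u\<close> by \<open>- u\<close>.\<close>
  define P where "P \<omega> = Z \<omega> * of_real ((1 + e \<omega>) / 2)" for \<omega>
  define R where "R \<omega> = Z \<omega> * of_real ((1 - e \<omega>) / 2)" for \<omega>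
  have PF[measurable]: "P \<in> borel_measurable (F s)" "R \<in> borel_measurable (F s)"
    using Z e unfolding P_def R_def by measurable
  have PM[measurable]: "P \<in> borel_measurable M" "R \<in> borel_measurable M"
    by (auto intro!: F_measurable_M[OF st(1)])
  have b: "norm (P \<omega>) \<le> K" "norm (R \<omega>) \<le> K" if "\<omega> \<in> space M" for \<omega>
    using e1[of \<omega>] Zb[OF that] norm_ge_zero[of "Z \<omega>"] by (auto simp: P_def R_def simp del: norm_ge_zero)
  have PI: "integrable M P" "integrable M R"
    using b by (auto intro!: integrable_const_bound[of _ K] AE_I2)
  have Wm[measurable]: "W s \<in> borel_measurable M" "W t \<in> borel_measurable M"
    using st by (auto intro!: F_measurable_M[OF _ brownian_motionD(1)[OF W]])
  have ei: "integrable M (\<lambda>\<omega>. iexp (v * (W t \<omega> - W s \<omega>)))" for v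
    by (rule integrable_const_bound[of _ 1]) auto
  have i1: "(\<integral>\<omega>. Q \<omega> * iexp (v * (W t \<omega> - W s \<omega>)) \<partial>M) = (\<integral>\<omega>. Q \<omega> \<partial>M) * of_real (exp (- (v\<^sup>2 * (t - s)) / 2))"
    "integrable M (\<lambda>\<omega>. Q \<omega> * iexp (v * (W t \<omega> - W s \<omega>)))"
    if "Q \<in> borel_measurable (F s)" "integrable M Q" for Q :: "'a \<Rightarrow> complex" and v
  proof -
    have iv: "indep_var borel Q borel (\<lambda>\<omega>. iexp (v * (W t \<omega> - W s \<omega>)))"
      by (rule brownian_indep_var[OF W st that(1), of "\<lambda>x. iexp (v * x)"]) measurable
    show "(\<integral>\<omega>. Q \<omega> * iexp (v * (W t \<omega> - W s \<omega>)) \<partial>M) = (\<integral>\<omega>. Q \<omega> \<partial>M) * of_real (exp (- (v\<^sup>2 * (t - s)) / 2))"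
      using indep_var_lebesgue_integral[OF iv that(2) ei] by (simp only: brownian_increment_char[OF W st])
    show "integrable M (\<lambda>\<omega>. Q \<omega> * iexp (v * (W t \<omega> - W s \<omega>)))"
      by (rule indep_var_integrable[OF iv that(2) ei])
  qed
  have "(\<integral>\<omega>. Z \<omega> * iexp (u * (e \<omega> * (W t \<omega> - W s \<omega>))) \<partial>M)
     = (\<integral>\<omega>. P \<omega> * iexp (u * (W t \<omega> - W s \<omega>)) + R \<omega> * iexp ((- u) * (W t \<omega> - W s \<omega>)) \<partial>M)"
  proof (rule Bochner_Integration.integral_cong[OF refl])
    fix \<omega> show "Z \<omega> * iexp (u * (e \<omega> * (W t \<omega> - W s \<omega>)))
      = P \<omega> * iexp (u * (W t \<omega> - W s \<omega>)) + R \<omega> * iexp ((- u) * (W t \<omega> - W s \<omega>))"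
      using e1[of \<omega>]
    proof
      assume e: "e \<omega> = 1"
      show ?thesis by (simp add: P_def R_def e)
    next
      assume e: "e \<omega> = -1"
      have x: "u * (- 1 * (W t \<omega> - W s \<omega>)) = (- u) * (W t \<omega> - W s \<omega>)"
        by (simp add: algebra_simps)
      show ?thesis unfolding P_def R_def e x by simp
    qed
  qed
  also have "\<dots> = (\<integral>\<omega>. P \<omega> \<partial>M) * of_real (exp (- (u\<^sup>2 * (t - s)) / 2)) + (\<integral>\<omega>. R \<omega> \<partial>M) * of_real (exp (- (u\<^sup>2 * (t - s)) / 2))"
    by (simp only: Bochner_Integration.integral_add[OF i1(2)[OF PF(1) PI(1)] i1(2)[OF PF(2) PI(2)]]
        i1(1)[OF PF(1) PI(1)] i1(1)[OF PF(2) PI(2)] power2_minus)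
  also have "\<dots> = (\<integral>\<omega>. P \<omega> + R \<omega> \<partial>M) * of_real (exp (- (u\<^sup>2 * (t - s)) / 2))"
    using PI by (simp add: distrib_right)
  also have "(\<lambda>\<omega>. P \<omega> + R \<omega>) = Z"
  proof
    fix \<omega> show "P \<omega> + R \<omega> = Z \<omega>"
      using e1[of \<omega>] by (elim disjE) (simp_all add: P_def R_def)
  qed
  finally show ?thesis .
qed

text \<open>All that happens before the last interval is a bounded variable known at its start and
  is absorbed into \<open>Z\<close>. So each interval contributes one Gaussian factor, and the
  exponents add up.\<close>

lemma sign_steps_char:
  assumes W: "brownian_motion M F W" and Y: "adapted_process F Y" and jl: "j \<le> l" "l \<le> n * 2 ^ n"
    and A: "A \<in> sets (F (real j / 2 ^ n))"
  shows "(\<integral>\<omega>. complex_of_real (indicator A \<omega>) * iexp (u * (simple_integral (sign_steps Y n) W (real l / 2 ^ n) \<omega>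
        - simple_integral (sign_steps Y n) W (real j / 2 ^ n) \<omega>)) \<partial>M)
      = of_real (prob A * exp (- (u\<^sup>2 * (real l / 2 ^ n - real j / 2 ^ n)) / 2))"
  using jl
proof (induction l rule: dec_induct)
  case base
  have AM: "A \<in> sets M" using A subalg[of "real j / 2 ^ n"] by (auto simp: subalgebra_def)
  have "(\<integral>\<omega>. complex_of_real (indicator A \<omega>) \<partial>M) = of_real (prob A)"
    using AM by simp
  then show ?case by simp
next
  case (step l)
  define c where "c i = real i / 2 ^ n" for i
  have c: "0 \<le> c i" "c i < c (Suc i)" for i by (auto simp: c_def divide_strict_right_mono)
  define S where "S l = simple_integral (sign_steps Y n) W (c l)" for l
  define e where "e \<omega> = rsgn (Y (c l) \<omega>)" for \<omega>
  define Z where "Z \<omega> = complex_of_real (indicator A \<omega>) * iexp (u * (S l \<omega> - S j \<omega>))" for \<omega>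
  have Sm: "l2_martingale (simple_integral (sign_steps Y n) W)"
    by (rule l2_martingale_simple_integral[OF brownian_l2_martingale[OF W] simple_steps_sign_steps[OF Y]])
  have cj: "c j \<le> c l" using step by (simp add: c_def divide_right_mono)
  have em: "e \<in> borel_measurable (F (c l))"
    using Y c[of l] unfolding e_def adapted_process_def by (auto intro!: measurable_compose[OF _ rsgn_measurable])
  have [measurable]: "S l \<in> borel_measurable (F (c l))" "S j \<in> borel_measurable (F (c l))" "A \<in> sets (F (c l))"
    using l2_martingale_adapted[OF Sm] F_measurable_mono[OF l2_martingale_adapted[OF Sm c(1)] c(1) cj] c
      A filt_mono[OF c(1) cj] by (auto simp: S_def c_def)
  have Zm: "Z \<in> borel_measurable (F (c l))" unfolding Z_def by measurable
  have S: "S (Suc l) \<omega> = S l \<omega> + e \<omega> * (W (c (Suc l)) \<omega> - W (c l) \<omega>)" for \<omega>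
    using step.prems by (simp add: S_def c_def e_def simple_integral_sign_steps_dyadic del: of_nat_Suc)
  have "(\<integral>\<omega>. complex_of_real (indicator A \<omega>) * iexp (u * (S (Suc l) \<omega> - S j \<omega>)) \<partial>M)
     = (\<integral>\<omega>. Z \<omega> * iexp (u * (e \<omega> * (W (c (Suc l)) \<omega> - W (c l) \<omega>))) \<partial>M)"
    by (intro Bochner_Integration.integral_cong refl)
       (simp add: Z_def S exp_add[symmetric] mult.assoc algebra_simps)
  also have "\<dots> = (\<integral>\<omega>. Z \<omega> \<partial>M) * of_real (exp (- (u\<^sup>2 * (c (Suc l) - c l)) / 2))"
    by (rule brownian_signed_increment_char[OF W c Zm _ em, of 1])
       (auto simp: Z_def norm_mult indicator_def e_def rsgn_def)
  also have "(\<integral>\<omega>. Z \<omega> \<partial>M) = of_real (prob A * exp (- (u\<^sup>2 * (c l - c j)) / 2))"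
    using step.IH step.prems by (simp add: Z_def S_def c_def)
  also have "of_real (prob A * exp (- (u\<^sup>2 * (c l - c j)) / 2)) * complex_of_real (exp (- (u\<^sup>2 * (c (Suc l) - c l)) / 2))
     = of_real (prob A * exp (- (u\<^sup>2 * (c (Suc l) - c j)) / 2))"
    by (simp only: of_real_mult[symmetric] mult.assoc exp_add[symmetric]) (simp add: field_simps)
  finally show ?case unfolding S_def c_def .
qed

text \<open>At dyadic times the identity for characteristic functions is exact on all fine grids and
  hence survives the L2 limit. All other times are approached from the right, using continuity of
  \<open>B\<close>.\<close>

lemma sign_transform_brownian:
  assumes W: "brownian_motion M F W" and Y: "adapted_process F Y"
    and ad: "adapted_process F B" and cont: "continuous_paths M B" and B0: "\<And>\<omega>. \<omega> \<in> space M \<Longrightarrow> B 0 \<omega> = 0"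
    and lim: "\<And>t. 0 \<le> t \<Longrightarrow> (\<lambda>n. \<integral>\<^sup>+\<omega>. ennreal ((simple_integral (sign_steps Y n) W t \<omega> - B t \<omega>)\<^sup>2) \<partial>M) \<longlonglongrightarrow> 0"
  shows "brownian_motion M F B"
proof (rule brownian_motionI_char[OF ad cont])
  show "AE \<omega> in M. B 0 \<omega> = 0" using B0 by simp
  define S where "S n = simple_integral (sign_steps Y n) W" for n
  have Sm: "l2_martingale (S n)" for n
    unfolding S_def by (rule l2_martingale_simple_integral[OF brownian_l2_martingale[OF W] simple_steps_sign_steps[OF Y]])
  have Bm[measurable]: "B t \<in> borel_measurable M" if "0 \<le> t" for t
    by (rule adapted_process_measurable[OF ad that])
  have Ssq: "sq_integrable M (S n t)" if "0 \<le> t" for n t by (rule l2_martingale_sq[OF Sm that])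
  have Bsq: "sq_integrable M (B t)" and BL: "(\<lambda>n. \<integral>\<omega>. (S n t \<omega> - B t \<omega>)\<^sup>2 \<partial>M) \<longlonglongrightarrow> 0" if "0 \<le> t" for t
    using sq_limit_of_nn_integral[of M "\<lambda>n. S n t" "B t", OF Ssq[OF that] Bm[OF that]] lim[OF that] by (auto simp: S_def)
  have dyadic: "(\<integral>\<omega>. complex_of_real (indicator A \<omega>) * iexp (u * (B (real l / 2 ^ k) \<omega> - B (real j / 2 ^ k) \<omega>)) \<partial>M)
      = of_real (prob A * exp (- (u\<^sup>2 * (real l / 2 ^ k - real j / 2 ^ k)) / 2))"
    if jl: "j \<le> l" and A: "A \<in> sets (F (real j / 2 ^ k))" for j l k u A
  proof -
    define a b where "a = real j / 2 ^ k" and "b = real l / 2 ^ k"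
    have ab: "0 \<le> a" "0 \<le> b" by (auto simp: a_def b_def)
    have AM[measurable]: "A \<in> sets M" using A subalg[OF ab(1)] by (auto simp: subalgebra_def a_def)
    have "(\<lambda>n. \<integral>\<omega>. ((S n b \<omega> - S n a \<omega>) - (B b \<omega> - B a \<omega>))\<^sup>2 \<partial>M) \<longlonglongrightarrow> 0"
    proof (rule Lim_null_comparison)
      show "(\<lambda>n. 2 * (\<integral>\<omega>. (S n b \<omega> - B b \<omega>)\<^sup>2 \<partial>M) + 2 * (\<integral>\<omega>. (S n a \<omega> - B a \<omega>)\<^sup>2 \<partial>M)) \<longlonglongrightarrow> 0"
        using tendsto_add[OF tendsto_mult_right_zero[OF BL[OF ab(2)], of 2] tendsto_mult_right_zero[OF BL[OF ab(1)], of 2]] by simp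
      show "\<forall>\<^sub>F n in sequentially. norm (\<integral>\<omega>. ((S n b \<omega> - S n a \<omega>) - (B b \<omega> - B a \<omega>))\<^sup>2 \<partial>M)
        \<le> 2 * (\<integral>\<omega>. (S n b \<omega> - B b \<omega>)\<^sup>2 \<partial>M) + 2 * (\<integral>\<omega>. (S n a \<omega> - B a \<omega>)\<^sup>2 \<partial>M)"
      proof (intro always_eventually allI)
        fix n
        have "(\<integral>\<omega>. ((S n b \<omega> - B b \<omega>) + (B a \<omega> - S n a \<omega>))\<^sup>2 \<partial>M)
          \<le> 2 * (\<integral>\<omega>. (S n b \<omega> - B b \<omega>)\<^sup>2 \<partial>M) + 2 * (\<integral>\<omega>. (B a \<omega> - S n a \<omega>)\<^sup>2 \<partial>M)"
          by (rule integral_sq_add_le[OF sq_integrable_diff[OF Ssq Bsq] sq_integrable_diff[OF Bsq Ssq]]) (use ab in auto)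
        then show "norm (\<integral>\<omega>. ((S n b \<omega> - S n a \<omega>) - (B b \<omega> - B a \<omega>))\<^sup>2 \<partial>M)
          \<le> 2 * (\<integral>\<omega>. (S n b \<omega> - B b \<omega>)\<^sup>2 \<partial>M) + 2 * (\<integral>\<omega>. (S n a \<omega> - B a \<omega>)\<^sup>2 \<partial>M)"
          by (simp add: power2_commute[of "B a _"] algebra_simps)
      qed
    qed
    then obtain r :: "nat \<Rightarrow> nat" where r: "strict_mono r"
      and AEr: "AE \<omega> in M. (\<lambda>n. S (r n) b \<omega> - S (r n) a \<omega>) \<longlonglongrightarrow> B b \<omega> - B a \<omega>"
      using sq_tendsto_AE_subseq[of M "\<lambda>n \<omega>. S n b \<omega> - S n a \<omega>" "\<lambda>\<omega>. B b \<omega> - B a \<omega>"]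
        sq_integrable_diff[OF sq_integrable_diff[OF Ssq Ssq] sq_integrable_diff[OF Bsq Bsq]] ab by blast
    have [measurable]: "S n t \<in> borel_measurable M" if "0 \<le> t" for n t
      using Ssq[OF that] by (rule sq_integrable_measurable)
    have L1: "(\<lambda>n. \<integral>\<omega>. complex_of_real (indicator A \<omega>) * iexp (u * (S (r n) b \<omega> - S (r n) a \<omega>)) \<partial>M)
        \<longlonglongrightarrow> (\<integral>\<omega>. complex_of_real (indicator A \<omega>) * iexp (u * (B b \<omega> - B a \<omega>)) \<partial>M)"
    proof (rule integral_dominated_convergence[where w = "\<lambda>_. 1"])
      show "AE \<omega> in M. (\<lambda>n. complex_of_real (indicator A \<omega>) * iexp (u * (S (r n) b \<omega> - S (r n) a \<omega>)))
        \<longlonglongrightarrow> complex_of_real (indicator A \<omega>) * iexp (u * (B b \<omega> - B a \<omega>))"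
        using AEr
      proof eventually_elim
        case (elim \<omega>)
        from isCont_tendsto_compose[OF isCont_iexp tendsto_mult[OF tendsto_const elim, of u]]
        show ?case by (intro tendsto_mult tendsto_const)
      qed
      show "AE \<omega> in M. norm (complex_of_real (indicator A \<omega>) * iexp (u * (S (r n) b \<omega> - S (r n) a \<omega>))) \<le> 1" for n
        by (auto simp: norm_mult indicator_def)
    qed (use ab in \<open>auto intro!: borel_measurable_times\<close>)
    have "\<forall>\<^sub>F n in sequentially. (\<integral>\<omega>. complex_of_real (indicator A \<omega>) * iexp (u * (S n b \<omega> - S n a \<omega>)) \<partial>M)
       = of_real (prob A * exp (- (u\<^sup>2 * (b - a)) / 2))"
      using eventually_ge_at_top[of "max k l"]
    proof eventually_elim
      case (elim n)
      then have n: "k \<le> n" "l \<le> n" by auto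
      \<comment> \<open>Both dyadic times lie on this grid, so the sequence of integrals is constant
        from \<open>max k l\<close> on.\<close>
      define j' l' where "j' = j * 2 ^ (n - k)" and "l' = l * 2 ^ (n - k)"
      have e: "a = real j' / 2 ^ n" "b = real l' / 2 ^ n"
        unfolding a_def b_def j'_def l'_def by (rule dyadic_refine(1)[OF n(1)])+
      have "l' \<le> n * 2 ^ n" unfolding l'_def by (rule dyadic_refine(2)[OF n])
      moreover have "j' \<le> l'" using jl by (simp add: j'_def l'_def)
      ultimately show ?case
        using sign_steps_char[OF W Y, of j' l' n A u] A unfolding S_def e[symmetric] a_def[symmetric] by simp
    qed
    then have "\<forall>\<^sub>F n in sequentially. (\<integral>\<omega>. complex_of_real (indicator A \<omega>) * iexp (u * (S (r n) b \<omega> - S (r n) a \<omega>)) \<partial>M)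
       = of_real (prob A * exp (- (u\<^sup>2 * (b - a)) / 2))"
      by (rule eventually_subseq[OF r])
    then have "(\<lambda>n. \<integral>\<omega>. complex_of_real (indicator A \<omega>) * iexp (u * (S (r n) b \<omega> - S (r n) a \<omega>)) \<partial>M)
       \<longlonglongrightarrow> of_real (prob A * exp (- (u\<^sup>2 * (b - a)) / 2))" by (rule tendsto_eventually)
    from LIMSEQ_unique[OF L1 this] show ?thesis by (simp add: a_def b_def)
  qed
  fix s t u A assume st: "0 \<le> s" "s < t" and A: "A \<in> sets (F s)"
  have AM[measurable]: "A \<in> sets M" using A subalg[OF st(1)] by (auto simp: subalgebra_def)
  \<comment> \<open>Rounding up matters: \<open>s \<le> c s k\<close> keeps the event
    \<open>A\<close> in \<open>F (c s k)\<close>, so that the dyadic case applies to it.\<close>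
  define c where "c x k = real (Suc (nat \<lfloor>x * 2 ^ k\<rfloor>)) / 2 ^ k" for x :: real and k :: nat
  have c_lim: "c x \<longlonglongrightarrow> x" if "0 \<le> x" for x
  proof -
    have "\<bar>x * 2 ^ k - real (Suc (nat \<lfloor>x * 2 ^ k\<rfloor>))\<bar> \<le> 1" for k
    proof -
      have "0 \<le> \<lfloor>x * 2 ^ k\<rfloor>" using that by simp
      then show ?thesis by linarith
    qed
    then show ?thesis unfolding c_def[abs_def] by (rule dyadic_tendsto)
  qed
  have c_ge: "x \<le> c x k" if "0 \<le> x" for x k
  proof -
    have "0 \<le> \<lfloor>x * 2 ^ k\<rfloor>" using that by simp
    then have "x * 2 ^ k \<le> real (Suc (nat \<lfloor>x * 2 ^ k\<rfloor>))" by simp linarith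
    then show ?thesis by (simp add: c_def pos_le_divide_eq del: of_nat_Suc)
  qed
  have c0: "0 \<le> c x k" for x k by (simp add: c_def)
  have eq: "(\<integral>\<omega>. complex_of_real (indicator A \<omega>) * iexp (u * (B (c t k) \<omega> - B (c s k) \<omega>)) \<partial>M)
      = of_real (prob A * exp (- (u\<^sup>2 * (c t k - c s k)) / 2))" for k
    unfolding c_def
  proof (rule dyadic)
    show "Suc (nat \<lfloor>s * 2 ^ k\<rfloor>) \<le> Suc (nat \<lfloor>t * 2 ^ k\<rfloor>)"
      using st by (intro Suc_leI le_imp_less_Suc nat_mono floor_mono mult_right_mono) auto
    show "A \<in> sets (F (real (Suc (nat \<lfloor>s * 2 ^ k\<rfloor>)) / 2 ^ k))"
      using A filt_mono[OF st(1) c_ge[OF st(1)], of k] unfolding c_def by blast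
  qed
  have t0: "0 \<le> t" using st by simp
  have "(\<lambda>k. \<integral>\<omega>. complex_of_real (indicator A \<omega>) * iexp (u * (B (c t k) \<omega> - B (c s k) \<omega>)) \<partial>M)
     \<longlonglongrightarrow> (\<integral>\<omega>. complex_of_real (indicator A \<omega>) * iexp (u * (B t \<omega> - B s \<omega>)) \<partial>M)"
  proof (rule integral_dominated_convergence[where w = "\<lambda>_. 1"])
    show "AE \<omega> in M. (\<lambda>k. complex_of_real (indicator A \<omega>) * iexp (u * (B (c t k) \<omega> - B (c s k) \<omega>)))
      \<longlonglongrightarrow> complex_of_real (indicator A \<omega>) * iexp (u * (B t \<omega> - B s \<omega>))"
    proof (rule AE_I2)
      fix \<omega> assume "\<omega> \<in> space M"
      then have cB: "continuous_on {0..} (\<lambda>t. B t \<omega>)" using cont by (simp add: continuous_paths_def)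
      have "(\<lambda>k. B (c x k) \<omega>) \<longlonglongrightarrow> B x \<omega>" if "0 \<le> x" for x
        by (rule continuous_on_tendsto_compose[OF cB c_lim[OF that]]) (use that c0 in auto)
      then show "(\<lambda>k. complex_of_real (indicator A \<omega>) * iexp (u * (B (c t k) \<omega> - B (c s k) \<omega>)))
        \<longlonglongrightarrow> complex_of_real (indicator A \<omega>) * iexp (u * (B t \<omega> - B s \<omega>))"
        using st t0 by (intro tendsto_intros) auto
    qed
    show "AE \<omega> in M. norm (complex_of_real (indicator A \<omega>) * iexp (u * (B (c t k) \<omega> - B (c s k) \<omega>))) \<le> 1" for k
      by (auto simp: norm_mult indicator_def)
  qed (use c0 st t0 in \<open>auto intro!: borel_measurable_times\<close>)
  moreover have "(\<lambda>k. complex_of_real (prob A * exp (- (u\<^sup>2 * (c t k - c s k)) / 2)))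
     \<longlonglongrightarrow> of_real (prob A * exp (- (u\<^sup>2 * (t - s)) / 2))"
    by (intro tendsto_intros c_lim st t0) auto
  ultimately show "(\<integral>\<omega>. complex_of_real (indicator A \<omega>) * iexp (u * (B t \<omega> - B s \<omega>)) \<partial>M)
      = of_real (prob A * exp (- (u\<^sup>2 * (t - s)) / 2))"
    unfolding eq by (rule LIMSEQ_unique)
qed

end

section \<open>Tanaka's formula\<close>

lemma mono_on_locally_bounded_variation:
  assumes "mono_on {0..} f"
  shows "locally_bounded_variation f"
  unfolding locally_bounded_variation_def
proof (intro allI impI exI)
  fix t :: real and n :: nat and \<tau> :: "nat \<Rightarrow> real"
  assume t: "0 \<le> t" and \<tau>: "(\<forall>i\<le>n. \<tau> i \<in> {0..t}) \<and> (\<forall>i<n. \<tau> i \<le> \<tau> (Suc i))"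
  have "(\<Sum>i<n. \<bar>f (\<tau> (Suc i)) - f (\<tau> i)\<bar>) = (\<Sum>i<n. f (\<tau> (Suc i)) - f (\<tau> i))"
  proof (intro sum.cong refl)
    fix i assume "i \<in> {..<n}"
    then have "f (\<tau> i) \<le> f (\<tau> (Suc i))" using \<tau> by (intro mono_onD[OF assms]) auto
    then show "\<bar>f (\<tau> (Suc i)) - f (\<tau> i)\<bar> = f (\<tau> (Suc i)) - f (\<tau> i)" by simp
  qed
  also have "\<dots> = f (\<tau> n) - f (\<tau> 0)" by (rule sum_lessThan_telescope)
  also have "\<dots> \<le> f t - f 0"
    using \<tau> by (intro diff_mono mono_onD[OF assms]) auto
  finally show "(\<Sum>i<n. \<bar>f (\<tau> (Suc i)) - f (\<tau> i)\<bar>) \<le> f t - f 0" .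
qed

lemma set_integral_continuous:
  assumes "\<And>t. 0 \<le> t \<Longrightarrow> set_integrable lborel {0..t} (f :: real \<Rightarrow> real)"
  shows "continuous_on {0..} (\<lambda>t. LBINT s:{0..t}. f s)"
proof (rule continuous_on_nonnegI)
  fix T :: real assume T: "0 \<le> T"
  have "f integrable_on {0..T}" by (rule set_borel_integral_eq_integral(1)[OF assms[OF T]])
  then have "continuous_on {0..T} (\<lambda>t. integral {0..t} f)" by (rule indefinite_integral_continuous_1)
  then show "continuous_on {0..T} (\<lambda>t. LBINT s:{0..t}. f s)"
    by (rule continuous_on_eq) (simp add: set_borel_integral_eq_integral(2)[OF assms])
qed

lemma continuous_on_max_measurable:
  assumes "continuous_on {0..} (f :: real \<Rightarrow> real)"
  shows "(\<lambda>s. f (max 0 s)) \<in> borel_measurable borel"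
proof (rule borel_measurable_continuous_onI)
  show "continuous_on UNIV (\<lambda>s. f (max 0 s))"
    by (rule continuous_on_compose2[OF assms]) (auto intro!: continuous_intros)
qed

text \<open>For an absolutely continuous integrator the elementary integral is an ordinary one. The
  constant \<open>c\<close>, an initial value, cancels in the increments.\<close>

lemma simple_integral_set_integral:
  assumes D: "\<And>i. i < length D \<Longrightarrow> 0 \<le> fst (D ! i) \<and> fst (D ! i) \<le> fst (snd (D ! i))"
    and g: "set_integrable lborel {0..t} (g :: real \<Rightarrow> real)" and t: "0 \<le> t"
    and N: "\<And>r. 0 \<le> r \<Longrightarrow> r \<le> t \<Longrightarrow> N r \<omega> = c + (LBINT s:{0..r}. g s)"
  shows "simple_integral D N t \<omega> = (LBINT s:{0..t}. simple_value D s \<omega> * g s)"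
proof -
  define x u v where "x i = snd (snd (D ! i)) \<omega>" and "u i = fst (D ! i)" and "v i = fst (snd (D ! i))" for i
  have gi: "integrable lborel (\<lambda>s. indicator {u i<..v i} s * (indicator {0..t} s * g s))" for i
    using integrable_mult_indicator[OF _ g[unfolded set_integrable_def], of "{u i<..v i}"] by simp
  have step: "N (min (v i) t) \<omega> - N (min (u i) t) \<omega> = (\<integral>s. indicator {u i<..v i} s * (indicator {0..t} s * g s) \<partial>lborel)"
    if i: "i < length D" for i
  proof -
    have uv: "0 \<le> u i" "u i \<le> v i" using D[OF i] by (auto simp: u_def v_def)
    have int: "integrable lborel (\<lambda>s. indicator {0..min y t} s * g s)" for y
      using set_integrable_subset[OF g, of "{0..min y t}"] by (simp add: set_integrable_def)
    have "N (min (v i) t) \<omega> - N (min (u i) t) \<omega> = (\<integral>s. indicator {0..min (v i) t} s * g s \<partial>lborel) - (\<integral>s. indicator {0..min (u i) t} s * g s \<partial>lborel)"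
      using uv t by (simp add: N set_lebesgue_integral_def)
    also have "\<dots> = (\<integral>s. indicator {0..min (v i) t} s * g s - indicator {0..min (u i) t} s * g s \<partial>lborel)"
      by (rule Bochner_Integration.integral_diff[symmetric]) (rule int)+
    also have "\<dots> = (\<integral>s. indicator {u i<..v i} s * (indicator {0..t} s * g s) \<partial>lborel)"
      using uv by (intro Bochner_Integration.integral_cong refl) (auto simp: indicator_def)
    finally show ?thesis .
  qed
  have "simple_integral D N t \<omega> = (\<Sum>i<length D. x i * (\<integral>s. indicator {u i<..v i} s * (indicator {0..t} s * g s) \<partial>lborel))"
    unfolding simple_integral_nth using step by (intro sum.cong refl) (simp add: x_def u_def v_def)
  also have "\<dots> = (\<integral>s. (\<Sum>i<length D. x i * (indicator {u i<..v i} s * (indicator {0..t} s * g s))) \<partial>lborel)"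
    by (subst Bochner_Integration.integral_sum) (auto intro: gi)
  also have "\<dots> = (LBINT s:{0..t}. simple_value D s \<omega> * g s)"
    unfolding set_lebesgue_integral_def simple_value_nth
    by (intro Bochner_Integration.integral_cong refl)
       (simp only: x_def u_def v_def sum_distrib_right sum_distrib_left real_scaleR_def mult_ac)
  finally show ?thesis .
qed

text \<open>The signs are bounded by 1, so \<open>g\<close> itself dominates. Integrability of the
  limit is recorded because it gives continuity of the drift part of the formula.\<close>

lemma sign_steps_set_integral_tendsto:
  assumes c: "continuous_on {0..} (\<lambda>t. Y t \<omega>)" and nz: "AE s in lborel. 0 \<le> s \<longrightarrow> Y s \<omega> \<noteq> 0"
    and g: "set_integrable lborel {0..t} (g :: real \<Rightarrow> real)"
  shows "(\<lambda>n. LBINT s:{0..t}. simple_value (sign_steps Y n) s \<omega> * g s) \<longlonglongrightarrow> (LBINT s:{0..t}. rsgn (Y s \<omega>) * g s)"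
    and "set_integrable lborel {0..t} (\<lambda>s. rsgn (Y s \<omega>) * g s)"
proof -
  have gi: "integrable lborel (\<lambda>s. indicator {0..t} s * g s)" using g by (simp add: set_integrable_def)
  have m: "(\<lambda>s. rsgn (Y (max 0 s) \<omega>)) \<in> borel_measurable borel"
    by (rule measurable_compose[OF continuous_on_max_measurable[OF c] rsgn_measurable])
  have eq: "indicator {0..t} s * (rsgn (Y s \<omega>) * g s) = rsgn (Y (max 0 s) \<omega>) * (indicator {0..t} s * g s)" for s
    by (auto simp: indicator_def)
  have lim_m: "(\<lambda>s. indicator {0..t} s * (rsgn (Y s \<omega>) * g s)) \<in> borel_measurable lborel"
    unfolding eq using m gi by auto
  show "set_integrable lborel {0..t} (\<lambda>s. rsgn (Y s \<omega>) * g s)"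
    unfolding set_integrable_def
    by (rule Bochner_Integration.integrable_bound[OF gi]) (use lim_m in \<open>auto simp: abs_mult\<close>)
  have sv: "(\<lambda>s. simple_value (sign_steps Y n) s \<omega>) \<in> borel_measurable borel" for n
    unfolding simple_value_sign_steps_sum by measurable
  have "(\<lambda>n. \<integral>s. indicator {0..t} s * (simple_value (sign_steps Y n) s \<omega> * g s) \<partial>lborel)
     \<longlonglongrightarrow> (\<integral>s. indicator {0..t} s * (rsgn (Y s \<omega>) * g s) \<partial>lborel)"
  proof (rule integral_dominated_convergence[where w = "\<lambda>s. \<bar>indicator {0..t} s * g s\<bar>"])
    show "integrable lborel (\<lambda>s. \<bar>indicator {0..t} s * g s\<bar>)" using gi by simp
    have "(\<lambda>s. simple_value (sign_steps Y n) s \<omega> * (indicator {0..t} s * g s)) \<in> borel_measurable lborel" for n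
      using sv[of n] gi by auto
    then show "(\<lambda>s. indicator {0..t} s * (simple_value (sign_steps Y n) s \<omega> * g s)) \<in> borel_measurable lborel" for n
      by (simp add: mult.left_commute)
    show "AE s in lborel. (\<lambda>n. indicator {0..t} s * (simple_value (sign_steps Y n) s \<omega> * g s))
       \<longlonglongrightarrow> indicator {0..t} s * (rsgn (Y s \<omega>) * g s)"
      using nz AE_lborel_singleton[of 0]
    proof eventually_elim
      case (elim s)
      show ?case
      proof (cases "s \<in> {0..t}")
        case True
        then have s: "0 < s" "Y s \<omega> \<noteq> 0" using elim by auto
        have "(\<lambda>n. simple_value (sign_steps Y n) s \<omega>) \<longlonglongrightarrow> rsgn (Y s \<omega>)"
          by (rule simple_value_sign_steps_tendsto[where Y = Y and \<omega> = \<omega>, OF c s])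
        then show ?thesis by (intro tendsto_intros)
      qed simp
    qed
    show "AE s in lborel. norm (indicator {0..t} s * (simple_value (sign_steps Y n) s \<omega> * g s)) \<le> \<bar>indicator {0..t} s * g s\<bar>" for n
    proof (rule AE_I2)
      fix s
      have "\<bar>simple_value (sign_steps Y n) s \<omega>\<bar> * \<bar>g s\<bar> \<le> 1 * \<bar>g s\<bar>"
        by (rule mult_right_mono[OF simple_value_sign_steps_abs_le]) simp
      then show "norm (indicator {0..t} s * (simple_value (sign_steps Y n) s \<omega> * g s)) \<le> \<bar>indicator {0..t} s * g s\<bar>"
        by (auto simp: abs_mult indicator_def)
    qed
  qed (rule lim_m)
  then show "(\<lambda>n. LBINT s:{0..t}. simple_value (sign_steps Y n) s \<omega> * g s) \<longlonglongrightarrow> (LBINT s:{0..t}. rsgn (Y s \<omega>) * g s)"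
    by (simp add: set_lebesgue_integral_def)
qed

section \<open>Passage to the limit in iterated stochastic integrals\<close>

context stochastic_basis
begin

text \<open>For a fixed simple process the integral is a finite combination of values of the
  integrator with bounded coefficients, so mean square convergence at each single time
  suffices.\<close>

lemma simple_integral_L2_tendsto:
  assumes G: "simple_steps F G" and t: "0 \<le> t"
    and N: "\<And>n t. 0 \<le> t \<Longrightarrow> sq_integrable M (N n t)"
    and lim: "\<And>t. 0 \<le> t \<Longrightarrow> (\<lambda>n::nat. \<integral>\<omega>. (N n t \<omega>)\<^sup>2 \<partial>M) \<longlonglongrightarrow> 0"
  shows "(\<lambda>n. \<integral>\<omega>. (simple_integral G (N n) t \<omega>)\<^sup>2 \<partial>M) \<longlonglongrightarrow> 0 \<and> (\<forall>n. sq_integrable M (simple_integral G (N n) t))"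
  using G
proof (induction G)
  case Nil
  then show ?case by (simp add: simple_integral_def[abs_def] sq_integrable_zero)
next
  case (Cons e D)
  obtain u v \<xi> where e: "e = (u, v, \<xi>)" by (cases e) auto
  obtain K where u: "0 \<le> u" "u \<le> v" "\<xi> \<in> borel_measurable (F u)" and K: "\<And>\<omega>. \<omega> \<in> space M \<Longrightarrow> \<bar>\<xi> \<omega>\<bar> \<le> K"
    and D: "simple_steps F D"
    using Cons.prems unfolding e simple_steps_Cons by blast
  define a b where "a = min v t" and "b = min u t"
  have ab: "0 \<le> a" "0 \<le> b" using u t by (auto simp: a_def b_def)
  define f where "f n \<omega> = \<xi> \<omega> * (N n a \<omega> - N n b \<omega>)" for n \<omega>
  have dsq: "sq_integrable M (\<lambda>\<omega>. N n a \<omega> - N n b \<omega>)" for n by (rule sq_integrable_diff[OF N N]) (use ab in auto)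
  have fsq: "sq_integrable M (f n)" for n
    unfolding f_def by (rule sq_integrable_bounded_mult[OF dsq F_measurable_M[OF u(1,3)] K])
  have flim: "(\<lambda>n. \<integral>\<omega>. (f n \<omega>)\<^sup>2 \<partial>M) \<longlonglongrightarrow> 0"
  proof (rule Lim_null_comparison)
    show "\<forall>\<^sub>F n in sequentially. norm (\<integral>\<omega>. (f n \<omega>)\<^sup>2 \<partial>M)
        \<le> K\<^sup>2 * (2 * (\<integral>\<omega>. (N n a \<omega>)\<^sup>2 \<partial>M) + 2 * (\<integral>\<omega>. (N n b \<omega>)\<^sup>2 \<partial>M))"
    proof (intro always_eventually allI)
      fix n
      have "(\<integral>\<omega>. (f n \<omega>)\<^sup>2 \<partial>M) \<le> (\<integral>\<omega>. K\<^sup>2 * (N n a \<omega> - N n b \<omega>)\<^sup>2 \<partial>M)"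
      proof (rule integral_mono)
        show "integrable M (\<lambda>\<omega>. (f n \<omega>)\<^sup>2)" by (rule sq_integrable_square[OF fsq])
        show "integrable M (\<lambda>\<omega>. K\<^sup>2 * (N n a \<omega> - N n b \<omega>)\<^sup>2)" using sq_integrable_square[OF dsq] by simp
        fix \<omega> assume "\<omega> \<in> space M"
        then have "\<bar>\<xi> \<omega>\<bar>\<^sup>2 \<le> K\<^sup>2" using K by (intro power_mono) auto
        then show "(f n \<omega>)\<^sup>2 \<le> K\<^sup>2 * (N n a \<omega> - N n b \<omega>)\<^sup>2"
          by (simp add: f_def power_mult_distrib mult_right_mono)
      qed
      also have "\<dots> = K\<^sup>2 * (\<integral>\<omega>. (N n a \<omega> + - 1 * N n b \<omega>)\<^sup>2 \<partial>M)" by simp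
      also have "\<dots> \<le> K\<^sup>2 * (2 * (\<integral>\<omega>. (N n a \<omega>)\<^sup>2 \<partial>M) + 2 * (\<integral>\<omega>. (- 1 * N n b \<omega>)\<^sup>2 \<partial>M))"
        by (intro mult_left_mono integral_sq_add_le[OF N[OF ab(1)] sq_integrable_cmult[OF N[OF ab(2)]]]) simp
      finally show "norm (\<integral>\<omega>. (f n \<omega>)\<^sup>2 \<partial>M) \<le> K\<^sup>2 * (2 * (\<integral>\<omega>. (N n a \<omega>)\<^sup>2 \<partial>M) + 2 * (\<integral>\<omega>. (N n b \<omega>)\<^sup>2 \<partial>M))" by simp
    qed
    have "(\<lambda>n. K\<^sup>2 * (2 * (\<integral>\<omega>. (N n a \<omega>)\<^sup>2 \<partial>M) + 2 * (\<integral>\<omega>. (N n b \<omega>)\<^sup>2 \<partial>M))) \<longlonglongrightarrow> K\<^sup>2 * (2 * 0 + 2 * 0)"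
      by (intro tendsto_intros lim ab)
    then show "(\<lambda>n. K\<^sup>2 * (2 * (\<integral>\<omega>. (N n a \<omega>)\<^sup>2 \<partial>M) + 2 * (\<integral>\<omega>. (N n b \<omega>)\<^sup>2 \<partial>M))) \<longlonglongrightarrow> 0" by simp
  qed
  have IH: "(\<lambda>n. \<integral>\<omega>. (simple_integral D (N n) t \<omega>)\<^sup>2 \<partial>M) \<longlonglongrightarrow> 0" "sq_integrable M (simple_integral D (N n) t)" for n
    using Cons.IH[OF D] by auto
  have eq: "simple_integral (e # D) (N n) t = (\<lambda>\<omega>. f n \<omega> + simple_integral D (N n) t \<omega>)" for n
    by (auto simp: e simple_integral_Cons f_def a_def b_def)
  have "(\<lambda>n. \<integral>\<omega>. (f n \<omega> + simple_integral D (N n) t \<omega>)\<^sup>2 \<partial>M) \<longlonglongrightarrow> 0"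
  proof (rule Lim_null_comparison)
    show "\<forall>\<^sub>F n in sequentially. norm (\<integral>\<omega>. (f n \<omega> + simple_integral D (N n) t \<omega>)\<^sup>2 \<partial>M)
      \<le> 2 * (\<integral>\<omega>. (f n \<omega>)\<^sup>2 \<partial>M) + 2 * (\<integral>\<omega>. (simple_integral D (N n) t \<omega>)\<^sup>2 \<partial>M)"
      using integral_sq_add_le[OF fsq IH(2)] by simp
    have "(\<lambda>n. 2 * (\<integral>\<omega>. (f n \<omega>)\<^sup>2 \<partial>M) + 2 * (\<integral>\<omega>. (simple_integral D (N n) t \<omega>)\<^sup>2 \<partial>M)) \<longlonglongrightarrow> 2 * 0 + 2 * 0"
      by (intro tendsto_intros flim IH(1))
    then show "(\<lambda>n. 2 * (\<integral>\<omega>. (f n \<omega>)\<^sup>2 \<partial>M) + 2 * (\<integral>\<omega>. (simple_integral D (N n) t \<omega>)\<^sup>2 \<partial>M)) \<longlonglongrightarrow> 0" by simp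
  qed
  then show ?case using sq_integrable_add[OF fsq IH(2)] unfolding eq by blast
qed

text \<open>Associativity \<open>\<integral> e dI = \<integral> H d(\<integral> e dW)\<close> of the Ito integral, for the sign process \<open>e\<close>: both
  sides agree if \<open>e\<close> and \<open>H\<close> are simple, and the passage to the limit in \<open>H\<close> is uniform in \<open>e\<close>.\<close>

lemma sign_steps_integral_tendsto:
  assumes I: "l2_martingale I" and W: "l2_martingale W" and B: "l2_martingale B" and Y: "adapted_process F Y"
    and G: "\<And>k::nat. simple_steps F (G k)" and Jsq: "sq_integrable M (J (real l / 2 ^ m))"
    and BL: "\<And>t. 0 \<le> t \<Longrightarrow> (\<lambda>n. \<integral>\<omega>. (simple_integral (sign_steps Y n) W t \<omega> - B t \<omega>)\<^sup>2 \<partial>M) \<longlonglongrightarrow> 0"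
    and IL: "(\<lambda>k. \<integral>\<omega>. (simple_integral (G k) W (real l / 2 ^ m) \<omega> - I (real l / 2 ^ m) \<omega>)\<^sup>2 \<partial>M) \<longlonglongrightarrow> 0"
    and JL: "(\<lambda>k. \<integral>\<omega>. (simple_integral (G k) B (real l / 2 ^ m) \<omega> - J (real l / 2 ^ m) \<omega>)\<^sup>2 \<partial>M) \<longlonglongrightarrow> 0"
  shows "(\<lambda>n. \<integral>\<omega>. (simple_integral (sign_steps Y n) I (real l / 2 ^ m) \<omega> - J (real l / 2 ^ m) \<omega>)\<^sup>2 \<partial>M) \<longlonglongrightarrow> 0"
proof -
  define t where "t = real l / 2 ^ m"
  have t: "0 \<le> t" by (simp add: t_def)
  define D where "D n = sign_steps Y n" for n
  define p where "p k = (\<integral>\<omega>. (simple_integral (G k) W t \<omega> - I t \<omega>)\<^sup>2 \<partial>M)" for k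
  define q where "q k n = (\<integral>\<omega>. (simple_integral (G k) (\<lambda>t \<omega>. simple_integral (D n) W t \<omega> - B t \<omega>) t \<omega>)\<^sup>2 \<partial>M)" for k n
  define r where "r k = (\<integral>\<omega>. (simple_integral (G k) B t \<omega> - J t \<omega>)\<^sup>2 \<partial>M)" for k
  define e where "e n = (\<integral>\<omega>. (simple_integral (D n) I t \<omega> - J t \<omega>)\<^sup>2 \<partial>M)" for n
  have DS: "simple_steps F (D n)" for n unfolding D_def by (rule simple_steps_sign_steps[OF Y])
  have DW: "l2_martingale (simple_integral (D n) W)" for n by (rule l2_martingale_simple_integral[OF W DS])
  have GW: "l2_martingale (simple_integral (G k) W)" for k by (rule l2_martingale_simple_integral[OF W G])
  have GB: "l2_martingale (simple_integral (G k) B)" for k by (rule l2_martingale_simple_integral[OF B G])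
  have dm: "l2_martingale (\<lambda>t \<omega>. simple_integral (D n) W t \<omega> - B t \<omega>)" for n by (rule l2_martingale_diff[OF DW B])
  have im: "l2_martingale (\<lambda>t \<omega>. I t \<omega> - simple_integral (G k) W t \<omega>)" for k by (rule l2_martingale_diff[OF I GW])
  have q: "(\<lambda>n. q k n) \<longlonglongrightarrow> 0" for k
    unfolding q_def
    by (rule simple_integral_L2_tendsto[OF G t, THEN conjunct1])
       (use l2_martingale_sq[OF dm] BL in \<open>auto simp: D_def\<close>)
  have bound: "e n \<le> 2 * p k + (4 * q k n + 4 * r k)" if n: "max m l \<le> n" for n k
  proof -
    define f where "f = simple_integral (D n) (\<lambda>t \<omega>. I t \<omega> - simple_integral (G k) W t \<omega>) t"
    define g where "g = simple_integral (G k) (\<lambda>t \<omega>. simple_integral (D n) W t \<omega> - B t \<omega>) t"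
    define h where "h \<omega> = simple_integral (G k) B t \<omega> - J t \<omega>" for \<omega>
    have fs: "sq_integrable M f" unfolding f_def by (rule l2_martingale_sq[OF l2_martingale_simple_integral[OF im DS] t])
    have gs: "sq_integrable M g" unfolding g_def by (rule l2_martingale_sq[OF l2_martingale_simple_integral[OF dm G] t])
    have hs: "sq_integrable M h" unfolding h_def
      by (rule sq_integrable_diff[OF l2_martingale_sq[OF GB t]]) (use Jsq in \<open>simp add: t_def\<close>)
    \<comment> \<open>After exchanging \<open>D n\<close> and \<open>G k\<close> the error has three
      parts: that of \<open>G k\<close> against \<open>W\<close>, transformed by signs; that of the
      signs against \<open>W\<close>, integrated by \<open>G k\<close>; and that of
      \<open>G k\<close> against \<open>B\<close>. The first is bounded uniformly in
      \<open>n\<close> by the contraction property.\<close>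
    have eq: "simple_integral (D n) I t \<omega> - J t \<omega> = f \<omega> + (g \<omega> + h \<omega>)" for \<omega>
      by (simp add: f_def g_def h_def simple_integral_diff_integrator simple_integral_commute[of "D n"])
    define l' where "l' = l * 2 ^ (n - m)"
    have l't: "t = real l' / 2 ^ n" unfolding t_def l'_def by (rule dyadic_refine(1)) (use n in simp)
    have l'n: "l' \<le> n * 2 ^ n" unfolding l'_def by (rule dyadic_refine(2)) (use n in auto)
    have "(\<integral>\<omega>. (f \<omega>)\<^sup>2 \<partial>M) \<le> (\<integral>\<omega>. (I t \<omega> - simple_integral (G k) W t \<omega>)\<^sup>2 \<partial>M)"
      using simple_integral_sign_steps_contraction[OF im Y l'n, of k] unfolding f_def D_def l't .
    then have f: "(\<integral>\<omega>. (f \<omega>)\<^sup>2 \<partial>M) \<le> p k" by (simp add: p_def power2_commute)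
    have "e n = (\<integral>\<omega>. (f \<omega> + (g \<omega> + h \<omega>))\<^sup>2 \<partial>M)" by (simp add: e_def eq)
    also have "\<dots> \<le> 2 * (\<integral>\<omega>. (f \<omega>)\<^sup>2 \<partial>M) + 2 * (\<integral>\<omega>. (g \<omega> + h \<omega>)\<^sup>2 \<partial>M)"
      by (rule integral_sq_add_le[OF fs sq_integrable_add[OF gs hs]])
    also have "(\<integral>\<omega>. (g \<omega> + h \<omega>)\<^sup>2 \<partial>M) \<le> 2 * q k n + 2 * r k"
      using integral_sq_add_le[OF gs hs] by (simp add: q_def r_def g_def h_def)
    finally show ?thesis using f by simp
  qed
  have pr: "(\<lambda>k. 2 * p k + 4 * r k) \<longlonglongrightarrow> 2 * 0 + 4 * 0"
    using IL JL unfolding p_def r_def t_def by (intro tendsto_intros)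
  have "e \<longlonglongrightarrow> 0"
  proof (rule LIMSEQ_I)
    \<comment> \<open>The order of choices is essential: \<open>p k\<close> and \<open>r k\<close>
      do not depend on \<open>n\<close>, so \<open>k\<close> is fixed first and the grid is refined
      afterwards.\<close>
    fix \<epsilon> :: real assume \<epsilon>: "0 < \<epsilon>"
    have "\<forall>\<^sub>F k in sequentially. 2 * p k + 4 * r k < \<epsilon> / 2"
      by (rule order_tendstoD(2)[OF pr]) (use \<epsilon> in simp)
    then obtain k where k: "2 * p k + 4 * r k < \<epsilon> / 2" by (auto simp: eventually_sequentially)
    have "\<forall>\<^sub>F n in sequentially. q k n < \<epsilon> / 8"
      by (rule order_tendstoD(2)[OF q]) (use \<epsilon> in simp)
    then obtain n0 where n0: "\<And>n. n0 \<le> n \<Longrightarrow> q k n < \<epsilon> / 8" by (auto simp: eventually_sequentially)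
    show "\<exists>no. \<forall>n\<ge>no. norm (e n - 0) < \<epsilon>"
    proof (intro exI allI impI)
      fix n assume "max n0 (max m l) \<le> n"
      then have "max m l \<le> n" "n0 \<le> n" by auto
      moreover have "0 \<le> e n" by (simp add: e_def)
      ultimately show "norm (e n - 0) < \<epsilon>" using bound[of n k] n0[of n] k by simp
    qed
  qed
  then show ?thesis by (simp add: e_def[abs_def] D_def t_def)
qed

lemma progressively_measurable_joint:
  assumes H: "progressively_measurable F H" and t: "0 \<le> t"
  shows "(\<lambda>(\<omega>, s). indicator {0..t} s * H s \<omega>) \<in> borel_measurable (M \<Otimes>\<^sub>M lborel)"
proof -
  \<comment> \<open>Clamping sends all times into the restricted space \<open>{0..t}\<close>; the
    indicator erases the change made outside.\<close>
  define c where "c s = max 0 (min t s)" for s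
  have cm: "c \<in> measurable lborel (restrict_space borel {0..t})"
    by (rule measurable_restrict_space2) (use t in \<open>auto simp: c_def[abs_def]\<close>)
  have id: "(\<lambda>\<omega>. \<omega>) \<in> measurable M (F t)"
    using subalg[OF t] by (auto simp: measurable_def subalgebra_def sets.Int_space_eq2)
  have "(\<lambda>x. (c (snd x), fst x)) \<in> measurable (M \<Otimes>\<^sub>M lborel) (restrict_space borel {0..t} \<Otimes>\<^sub>M F t)"
    by (rule measurable_Pair[OF measurable_compose[OF measurable_snd cm] measurable_compose[OF measurable_fst id]])
  moreover have "(\<lambda>(s, \<omega>). H s \<omega>) \<in> borel_measurable (restrict_space borel {0..t} \<Otimes>\<^sub>M F t)"
    using H t by (simp add: progressively_measurable_def)
  ultimately have 1: "(\<lambda>x. H (c (snd x)) (fst x)) \<in> borel_measurable (M \<Otimes>\<^sub>M lborel)"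
    by (auto dest: measurable_compose)
  have 2: "(\<lambda>x. indicat_real {0..t} (snd x)) \<in> borel_measurable (M \<Otimes>\<^sub>M lborel)"
    by (rule measurable_compose[OF measurable_snd]) simp
  have "(\<lambda>x. indicat_real {0..t} (snd x) * H (c (snd x)) (fst x)) \<in> borel_measurable (M \<Otimes>\<^sub>M lborel)"
    using 1 2 by measurable
  also have "(\<lambda>x. indicat_real {0..t} (snd x) * H (c (snd x)) (fst x)) = (\<lambda>(\<omega>, s). indicator {0..t} s * H s \<omega>)"
    by (auto simp: fun_eq_iff indicator_def c_def max_def min_def)
  finally show ?thesis .
qed

text \<open>Stated for any continuous sum of an Ito integral and an absolutely continuous drift; the
  law of the process enters only through the last hypothesis. The integrand \<open>H\<close> is the
  same against \<open>W\<close> and against \<open>B\<close>, since the sign is carried by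
  \<open>B\<close> alone.\<close>

theorem tanaka_formula:
  fixes Y H g :: "real \<Rightarrow> 'a \<Rightarrow> real"
  assumes W: "brownian_motion M F W" and Y: "adapted_process F Y" "continuous_paths M Y"
    and I: "ito_integral M F W H I"
    and g: "AE \<omega> in M. \<forall>t\<ge>0. set_integrable lborel {0..t} (\<lambda>s. g s \<omega>)"
    and eq: "AE \<omega> in M. \<forall>t\<ge>0. Y t \<omega> = Y 0 \<omega> + I t \<omega> + (LBINT s:{0..t}. g s \<omega>)"
    and nz: "AE \<omega> in M. AE s in lborel. 0 \<le> s \<longrightarrow> Y s \<omega> \<noteq> 0"
  shows "\<exists>B L J. brownian_motion M F B \<and> adapted_process F L \<and>
    (\<forall>\<omega>\<in>space M. (\<forall>t\<ge>0. 0 \<le> L t \<omega>) \<and> mono_on {0..} (\<lambda>t. L t \<omega>) \<and> locally_bounded_variation (\<lambda>t. L t \<omega>)) \<and>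
    ito_integral M F B H J \<and>
    (AE \<omega> in M. \<forall>t\<ge>0. \<bar>Y t \<omega>\<bar> = \<bar>Y 0 \<omega>\<bar> + J t \<omega> + (LBINT s:{0..t}. g s \<omega> * sgn (Y s \<omega>)) + L t \<omega>)"
proof -
  obtain G where G: "\<And>k. simple_steps F (G k)"
    and GH: "\<And>t. 0 \<le> t \<Longrightarrow> (\<lambda>n. \<integral>\<^sup>+\<omega>. (\<integral>\<^sup>+s\<in>{0..t}. ennreal ((simple_value (G n) s \<omega> - H s \<omega>)\<^sup>2) \<partial>lborel) \<partial>M) \<longlonglongrightarrow> 0"
    and GI: "\<And>t. 0 \<le> t \<Longrightarrow> (\<lambda>n. \<integral>\<^sup>+\<omega>. ennreal ((simple_integral (G n) W t \<omega> - I t \<omega>)\<^sup>2) \<partial>M) \<longlonglongrightarrow> 0"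
    and Iad: "adapted_process F I" and Hpm: "progressively_measurable F H"
    and Hfin: "\<forall>t\<ge>0. (\<integral>\<^sup>+\<omega>. (\<integral>\<^sup>+s\<in>{0..t}. ennreal ((H s \<omega>)\<^sup>2) \<partial>lborel) \<partial>M) < \<infinity>"
    using I unfolding ito_integral_def by blast
  have Ym: "Y t \<in> borel_measurable M" if "0 \<le> t" for t
    by (rule adapted_process_measurable[OF Y(1) that])
  have Im: "I t \<in> borel_measurable M" if "0 \<le> t" for t
    by (rule adapted_process_measurable[OF Iad that])
  note WM = brownian_l2_martingale[OF W]
  define D where "D n = sign_steps Y n" for n
  have DS: "simple_steps F (D n)" for n unfolding D_def by (rule simple_steps_sign_steps[OF Y(1)])

  have GW: "sq_integrable M (simple_integral (G k) W t)" if "0 \<le> t" for k t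
    by (rule l2_martingale_sq[OF l2_martingale_simple_integral[OF WM G] that])
  have Isq: "sq_integrable M (I t)" and IL: "(\<lambda>k. \<integral>\<omega>. (simple_integral (G k) W t \<omega> - I t \<omega>)\<^sup>2 \<partial>M) \<longlonglongrightarrow> 0" if "0 \<le> t" for t
    using sq_limit_of_nn_integral[of M "\<lambda>k. simple_integral (G k) W t" "I t", OF GW[OF that] Im[OF that] GI[OF that]] by auto
  have IM: "l2_martingale I"
    by (rule l2_martingale_limit[OF l2_martingale_simple_integral[OF WM G] _ Isq IL])
       (use Iad in \<open>auto simp: adapted_process_def\<close>)

  have eHm: "(\<lambda>(\<omega>, s). indicator {0..t} s * rsgn (Y s \<omega>)) \<in> borel_measurable (M \<Otimes>\<^sub>M lborel)" for t
  proof -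
    have 2: "(\<lambda>x. indicat_real {0..t} (snd x)) \<in> borel_measurable (M \<Otimes>\<^sub>M lborel)"
      by (rule measurable_compose[OF measurable_snd]) simp
    have "(\<lambda>x. indicat_real {0..t} (snd x) * rsgn (case x of (\<omega>, s) \<Rightarrow> Y (max 0 s) \<omega>)) \<in> borel_measurable (M \<Otimes>\<^sub>M lborel)"
      using 2 continuous_process_measurable[OF Y(2) Ym] by measurable
    also have "(\<lambda>x. indicat_real {0..t} (snd x) * rsgn (case x of (\<omega>, s) \<Rightarrow> Y (max 0 s) \<omega>)) = (\<lambda>(\<omega>, s). indicator {0..t} s * rsgn (Y s \<omega>))"
      by (auto simp: fun_eq_iff indicator_def)
    finally show ?thesis .
  qed
  obtain B where B: "adapted_process F B" "continuous_paths M B" "\<And>\<omega>. \<omega> \<in> space M \<Longrightarrow> B 0 \<omega> = 0"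
    and DB: "\<And>t. 0 \<le> t \<Longrightarrow> (\<lambda>n. \<integral>\<^sup>+\<omega>. ennreal ((simple_integral (D n) W t \<omega> - B t \<omega>)\<^sup>2) \<partial>M) \<longlonglongrightarrow> 0"
    using ito_limit_exists[OF W DS eHm sign_steps_L2_tendsto[OF Y nz, folded D_def]] by blast
  have BB: "brownian_motion M F B"
    by (rule sign_transform_brownian[OF W Y(1) B]) (use DB in \<open>auto simp: D_def\<close>)
  note BM = brownian_l2_martingale[OF BB]
  have BL: "(\<lambda>n. \<integral>\<omega>. (simple_integral (D n) W t \<omega> - B t \<omega>)\<^sup>2 \<partial>M) \<longlonglongrightarrow> 0" if "0 \<le> t" for t
    by (rule sq_limit_of_nn_integral(2)[OF l2_martingale_sq[OF l2_martingale_simple_integral[OF WM DS] that]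
      sq_integrable_measurable[OF l2_martingale_sq[OF BM that]] DB[OF that]])

  \<comment> \<open>The approximation of \<open>H\<close> by \<open>G\<close> makes no reference to
    the driving Brownian motion, so the same \<open>G\<close> can be integrated against
    \<open>B\<close>.\<close>
  obtain J where J: "adapted_process F J" "continuous_paths M J" "\<And>\<omega>. \<omega> \<in> space M \<Longrightarrow> J 0 \<omega> = 0"
    and GJ: "\<And>t. 0 \<le> t \<Longrightarrow> (\<lambda>n. \<integral>\<^sup>+\<omega>. ennreal ((simple_integral (G n) B t \<omega> - J t \<omega>)\<^sup>2) \<partial>M) \<longlonglongrightarrow> 0"
    using ito_limit_exists[OF BB G progressively_measurable_joint[OF Hpm] GH] by blast
  have Jm: "J t \<in> borel_measurable M" if "0 \<le> t" for t
    by (rule adapted_process_measurable[OF J(1) that])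
  have GBs: "sq_integrable M (simple_integral (G k) B t)" if "0 \<le> t" for k t
    by (rule l2_martingale_sq[OF l2_martingale_simple_integral[OF BM G] that])
  have Jsq: "sq_integrable M (J t)" and JL: "(\<lambda>k. \<integral>\<omega>. (simple_integral (G k) B t \<omega> - J t \<omega>)\<^sup>2 \<partial>M) \<longlonglongrightarrow> 0" if "0 \<le> t" for t
    using sq_limit_of_nn_integral[of M "\<lambda>k. simple_integral (G k) B t" "J t", OF GBs[OF that] Jm[OF that] GJ[OF that]] by auto
  have itoJ: "ito_integral M F B H J"
    unfolding ito_integral_def
    by (intro conjI exI[of _ G]) (use Hpm Hfin J(1,2) G GH GJ in simp_all)

  \<comment> \<open>As a difference \<open>A\<close> is adapted by construction, while its form as
    an integral of \<open>g\<close> is used path by path. Adaptedness of \<open>E\<close> is then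
    inherited from the sums over \<open>A\<close>.\<close>
  define A where "A t \<omega> = Y t \<omega> - I t \<omega>" for t \<omega>
  define E where "E t \<omega> = (LBINT s:{0..t}. rsgn (Y s \<omega>) * g s \<omega>)" for t \<omega>
  define C where "C t \<omega> = \<bar>Y t \<omega>\<bar> - \<bar>Y 0 \<omega>\<bar> - J t \<omega> - E t \<omega>" for t \<omega>
  define reg where "reg \<omega> \<longleftrightarrow> \<omega> \<in> space M \<and> (\<forall>t\<ge>0. set_integrable lborel {0..t} (\<lambda>s. g s \<omega>))
      \<and> (\<forall>t\<ge>0. Y t \<omega> = Y 0 \<omega> + I t \<omega> + (LBINT s:{0..t}. g s \<omega>)) \<and> (AE s in lborel. 0 \<le> s \<longrightarrow> Y s \<omega> \<noteq> 0)" for \<omega>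
  have AEreg: "AE \<omega> in M. reg \<omega>" using g eq nz AE_space unfolding reg_def by eventually_elim (intro conjI; assumption)
  have regD: "\<omega> \<in> space M" "0 \<le> t \<Longrightarrow> set_integrable lborel {0..t} (\<lambda>s. g s \<omega>)"
    "0 \<le> t \<Longrightarrow> Y t \<omega> = Y 0 \<omega> + I t \<omega> + (LBINT s:{0..t}. g s \<omega>)"
    "AE s in lborel. 0 \<le> s \<longrightarrow> Y s \<omega> \<noteq> 0" "continuous_on {0..} (\<lambda>t. Y t \<omega>)" if "reg \<omega>" for \<omega> t
    using that Y(2) unfolding reg_def continuous_paths_def by blast+
  have Ec: "(\<lambda>n. simple_integral (D n) A t \<omega>) \<longlonglongrightarrow> E t \<omega>" if t: "0 \<le> t" and \<omega>: "reg \<omega>" for t \<omega>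
  proof -
    have "simple_integral (D n) A t \<omega> = (LBINT s:{0..t}. simple_value (D n) s \<omega> * g s \<omega>)" for n
    proof (rule simple_integral_set_integral[where c = "Y 0 \<omega>", OF _ regD(2)[OF \<omega> t] t])
      show "A r \<omega> = Y 0 \<omega> + (LBINT s:{0..r}. g s \<omega>)" if "0 \<le> r" for r
        using regD(3)[OF \<omega> that] unfolding A_def by linarith
    qed (use simple_steps_nth(1,2)[OF DS[of n]] in auto)
    then show ?thesis
      using sign_steps_set_integral_tendsto(1)[where Y = Y and \<omega> = \<omega>, OF regD(5)[OF \<omega>] regD(4)[OF \<omega>] regD(2)[OF \<omega> t]]
      unfolding E_def D_def by simp
  qed
  have Ead: "E t \<in> borel_measurable (F t)" if t: "0 \<le> t" for t
  proof (rule F_measurable_AE_limit[OF t])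
    show "simple_integral (D n) A t \<in> borel_measurable (F t)" for n
    proof (rule simple_integral_adapted[OF _ DS t])
      fix t :: real assume "0 \<le> t"
      then have "Y t \<in> borel_measurable (F t)" "I t \<in> borel_measurable (F t)"
        using Y(1) Iad by (auto simp: adapted_process_def)
      then show "A t \<in> borel_measurable (F t)" unfolding A_def[abs_def] by simp
    qed
    show "AE \<omega> in M. (\<lambda>n. simple_integral (D n) A t \<omega>) \<longlonglongrightarrow> E t \<omega>"
      using AEreg by eventually_elim (rule Ec[OF t])
  qed
  have Cad: "C t \<in> borel_measurable (F t)" if t: "0 \<le> t" for t
  proof -
    have "Y 0 \<in> borel_measurable (F t)" using Y(1) t by (auto simp: adapted_process_def intro: F_measurable_mono)
    moreover have "Y t \<in> borel_measurable (F t)" "J t \<in> borel_measurable (F t)"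
      using Y(1) J(1) t by (auto simp: adapted_process_def)
    ultimately show ?thesis using Ead[OF t] unfolding C_def[abs_def] by simp
  qed
  have Ccont: "continuous_on {0..} (\<lambda>t. C t \<omega>)" if \<omega>: "reg \<omega>" for \<omega>
  proof -
    have c: "continuous_on {0..} (\<lambda>t. Y t \<omega>)" "continuous_on {0..} (\<lambda>t. J t \<omega>)"
      using regD(5)[OF \<omega>] J(2) regD(1)[OF \<omega>] by (auto simp: continuous_paths_def)
    have "continuous_on {0..} (\<lambda>t. E t \<omega>)"
      unfolding E_def
      by (rule set_integral_continuous,
          rule sign_steps_set_integral_tendsto(2)[where Y = Y and \<omega> = \<omega>, OF c(1) regD(4)[OF \<omega>] regD(2)[OF \<omega>]])
    with c show ?thesis unfolding C_def by (intro continuous_intros)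
  qed
  \<comment> \<open>The exceptional null set depends on the pair of dyadic times, of which there are
    only countably many.\<close>
  have dy: "AE \<omega> in M. C (real j / 2 ^ m) \<omega> \<le> C (real l / 2 ^ m) \<omega>" if jl: "j \<le> l" for j l m
  proof -
    define a b where "a = real j / 2 ^ m" and "b = real l / 2 ^ m"
    have ab: "0 \<le> a" "0 \<le> b" by (auto simp: a_def b_def)
    have La: "(\<lambda>n. \<integral>\<omega>. (simple_integral (D n) I a \<omega> - J a \<omega>)\<^sup>2 \<partial>M) \<longlonglongrightarrow> 0"
      unfolding a_def D_def
      by (rule sign_steps_integral_tendsto[where I = I and W = W and B = B and Y = Y and G = G and J = J and l = j and m = m,
            OF IM WM BM Y(1) G Jsq BL[unfolded D_def] IL JL]) auto
    have Lb: "(\<lambda>n. \<integral>\<omega>. (simple_integral (D n) I b \<omega> - J b \<omega>)\<^sup>2 \<partial>M) \<longlonglongrightarrow> 0"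
      unfolding b_def D_def
      by (rule sign_steps_integral_tendsto[where I = I and W = W and B = B and Y = Y and G = G and J = J and l = l and m = m,
            OF IM WM BM Y(1) G Jsq BL[unfolded D_def] IL JL]) auto
    have sq: "sq_integrable M (\<lambda>\<omega>. simple_integral (D n) I t \<omega> - J t \<omega>)" if "0 \<le> t" for n t
      by (rule sq_integrable_diff[OF l2_martingale_sq[OF l2_martingale_simple_integral[OF IM DS] that] Jsq[OF that]])
    obtain r where r: "strict_mono r" and ra: "AE \<omega> in M. (\<lambda>n. simple_integral (D (r n)) I a \<omega>) \<longlonglongrightarrow> J a \<omega>"
      using sq_tendsto_AE_subseq[OF sq[OF ab(1)] La] by blast
    have Lb': "(\<lambda>n. \<integral>\<omega>. (simple_integral (D (r n)) I b \<omega> - J b \<omega>)\<^sup>2 \<partial>M) \<longlonglongrightarrow> 0"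
      using LIMSEQ_subseq_LIMSEQ[OF Lb r] by (simp add: o_def)
    \<comment> \<open>A further subsequence for the second time, so that the sums at both times
      converge along one sequence \<open>z\<close>.\<close>
    obtain r' where r': "strict_mono r'" and rb: "AE \<omega> in M. (\<lambda>n. simple_integral (D (r (r' n))) I b \<omega>) \<longlonglongrightarrow> J b \<omega>"
      using sq_tendsto_AE_subseq[where f = "\<lambda>n. simple_integral (D (r n)) I b", OF sq[OF ab(2)] Lb'] by blast
    define z where "z n = r (r' n)" for n
    have zm: "strict_mono z" using strict_mono_o[OF r r'] by (simp add: z_def[abs_def] o_def)
    show ?thesis
      using ra rb AEreg unfolding a_def[symmetric] b_def[symmetric]
    proof eventually_elim
      case (elim \<omega>)
      have 1: "(\<lambda>n. simple_integral (D (z n)) I a \<omega>) \<longlonglongrightarrow> J a \<omega>"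
        using LIMSEQ_subseq_LIMSEQ[OF elim(1) r'] by (simp add: o_def z_def)
      have 2: "(\<lambda>n. simple_integral (D (z n)) I b \<omega>) \<longlonglongrightarrow> J b \<omega>" using elim(2) by (simp add: z_def)
      have 3: "(\<lambda>n. simple_integral (D (z n)) A a \<omega>) \<longlonglongrightarrow> E a \<omega>" "(\<lambda>n. simple_integral (D (z n)) A b \<omega>) \<longlonglongrightarrow> E b \<omega>"
        using LIMSEQ_subseq_LIMSEQ[OF Ec[OF _ elim(3)] zm] ab by (auto simp: o_def)
      have lim: "(\<lambda>n. (simple_integral (D (z n)) I b \<omega> - simple_integral (D (z n)) I a \<omega>)
          + (simple_integral (D (z n)) A b \<omega> - simple_integral (D (z n)) A a \<omega>)) \<longlonglongrightarrow> (J b \<omega> - J a \<omega>) + (E b \<omega> - E a \<omega>)"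
        by (intro tendsto_intros 1 2 3)
      have ev: "\<forall>\<^sub>F n in sequentially. (simple_integral (D n) I b \<omega> - simple_integral (D n) I a \<omega>)
          + (simple_integral (D n) A b \<omega> - simple_integral (D n) A a \<omega>) \<le> \<bar>Y b \<omega>\<bar> - \<bar>Y a \<omega>\<bar>"
        using eventually_ge_at_top[of "max m l"]
      proof eventually_elim
        case (elim n)
        then have n: "m \<le> n" "l \<le> n" by auto
        define j' l' where "j' = j * 2 ^ (n - m)" and "l' = l * 2 ^ (n - m)"
        have e: "a = real j' / 2 ^ n" "b = real l' / 2 ^ n"
          unfolding a_def b_def j'_def l'_def by (rule dyadic_refine(1)[OF n(1)])+
        have "l' \<le> n * 2 ^ n" unfolding l'_def by (rule dyadic_refine(2)[OF n])
        moreover have "j' \<le> l'" using jl by (simp add: j'_def l'_def)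
        ultimately have "simple_integral (D n) Y b \<omega> - simple_integral (D n) Y a \<omega> \<le> \<bar>Y b \<omega>\<bar> - \<bar>Y a \<omega>\<bar>"
          using simple_integral_sign_steps_le[of j' l' n Y \<omega>] unfolding D_def e[symmetric] by simp
        moreover have "simple_integral (D n) A t \<omega> = simple_integral (D n) Y t \<omega> - simple_integral (D n) I t \<omega>" for t
          unfolding A_def[abs_def] by (rule simple_integral_diff_integrator)
        ultimately show ?case by simp
      qed
      have "(J b \<omega> - J a \<omega>) + (E b \<omega> - E a \<omega>) \<le> \<bar>Y b \<omega>\<bar> - \<bar>Y a \<omega>\<bar>"
        by (rule tendsto_upperbound[OF lim eventually_subseq[OF zm ev]]) simp
      then show ?case by (simp add: C_def)
    qed
  qed
  have "AE \<omega> in M. \<forall>m j l. j \<le> l \<longrightarrow> C (real j / 2 ^ m) \<omega> \<le> C (real l / 2 ^ m) \<omega>"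
    unfolding AE_all_countable using dy by auto
  then have AEmono: "AE \<omega> in M. reg \<omega> \<and> mono_on {0..} (\<lambda>t. C t \<omega>)"
    using AEreg
  proof eventually_elim
    case (elim \<omega>)
    \<comment> \<open>Rounding both times down on the same grid preserves their order.\<close>
    have "C s \<omega> \<le> C t \<omega>" if st: "0 \<le> s" "s \<le> t" for s t
    proof (rule LIMSEQ_le)
      show "(\<lambda>n. C (real (nat \<lfloor>s * 2 ^ n\<rfloor>) / 2 ^ n) \<omega>) \<longlonglongrightarrow> C s \<omega>"
        by (rule continuous_on_tendsto_compose[OF Ccont[OF elim(2)] dyadic_floor_tendsto]) (use st in auto)
      show "(\<lambda>n. C (real (nat \<lfloor>t * 2 ^ n\<rfloor>) / 2 ^ n) \<omega>) \<longlonglongrightarrow> C t \<omega>"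
        by (rule continuous_on_tendsto_compose[OF Ccont[OF elim(2)] dyadic_floor_tendsto]) (use st in auto)
      have "nat \<lfloor>s * 2 ^ n\<rfloor> \<le> nat \<lfloor>t * 2 ^ n\<rfloor>" for n
        using st by (intro nat_mono floor_mono mult_right_mono) auto
      then show "\<exists>N. \<forall>n\<ge>N. C (real (nat \<lfloor>s * 2 ^ n\<rfloor>) / 2 ^ n) \<omega> \<le> C (real (nat \<lfloor>t * 2 ^ n\<rfloor>) / 2 ^ n) \<omega>"
        using elim(1) by blast
    qed
    with elim(2) show ?case by (auto intro!: mono_onI)
  qed
  \<comment> \<open>Monotonicity is the property that \<open>L\<close> must have for every outcome.
    Together with \<open>C 0 = 0\<close>, which holds on all of \<open>space M\<close>, it gives
    nonnegativity.\<close>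
  define ok where "ok \<omega> \<longleftrightarrow> \<omega> \<in> space M \<and> mono_on {0..} (\<lambda>t. C t \<omega>)" for \<omega>
  define L where "L t \<omega> = (if ok \<omega> then C t \<omega> else 0)" for t \<omega>
  have AEok: "AE \<omega> in M. ok \<omega>" using AEmono by eventually_elim (use regD(1) in \<open>auto simp: ok_def\<close>)
  have C0: "C 0 \<omega> = 0" if "\<omega> \<in> space M" for \<omega>
  proof -
    have "E 0 \<omega> = 0"
      unfolding E_def set_lebesgue_integral_def
      by (rule integral_eq_zero_AE) (use AE_lborel_singleton[of 0] in \<open>auto elim!: eventually_mono\<close>)
    then show ?thesis using J(3)[OF that] by (simp add: C_def)
  qed
  have Lmono: "mono_on {0..} (\<lambda>t. L t \<omega>)" for \<omega>
  proof (cases "ok \<omega>")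
    case True
    then have "(\<lambda>t. L t \<omega>) = (\<lambda>t. C t \<omega>)" by (simp add: L_def)
    then show ?thesis using True by (simp add: ok_def)
  next
    case False
    then show ?thesis by (simp add: L_def mono_on_def)
  qed
  show ?thesis
  proof (intro exI conjI)
    show "brownian_motion M F B" by (rule BB)
    show "ito_integral M F B H J" by (rule itoJ)
    show "adapted_process F L"
      unfolding adapted_process_def
    proof (intro allI impI)
      fix t :: real assume t: "0 \<le> t"
      show "L t \<in> borel_measurable (F t)"
        by (rule F_measurable_AE_eq[OF t Cad[OF t]]) (use AEok in \<open>auto elim!: eventually_mono simp: L_def\<close>)
    qed
    show "\<forall>\<omega>\<in>space M. (\<forall>t\<ge>0. 0 \<le> L t \<omega>) \<and> mono_on {0..} (\<lambda>t. L t \<omega>) \<and> locally_bounded_variation (\<lambda>t. L t \<omega>)"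
    proof (intro ballI conjI allI impI)
      fix \<omega> t assume \<omega>: "\<omega> \<in> space M" and t: "0 \<le> (t::real)"
      have "L 0 \<omega> = 0" using C0[OF \<omega>] by (simp add: L_def)
      then show "0 \<le> L t \<omega>" using mono_onD[OF Lmono, of 0 t \<omega>] t by simp
    qed (use Lmono mono_on_locally_bounded_variation in auto)
    show "AE \<omega> in M. \<forall>t\<ge>0. \<bar>Y t \<omega>\<bar> = \<bar>Y 0 \<omega>\<bar> + J t \<omega> + (LBINT s:{0..t}. g s \<omega> * sgn (Y s \<omega>)) + L t \<omega>"
      using AEok AEreg
    proof eventually_elim
      case (elim \<omega>)
      show ?case
      proof (intro allI impI)
        fix t :: real assume t: "0 \<le> t"
        have c: "continuous_on {0..} (\<lambda>t. Y t \<omega>)" by (rule regD(5)[OF elim(2)])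
        have gi: "set_integrable lborel {0..t} (\<lambda>s. g s \<omega>)" by (rule regD(2)[OF elim(2) t])
        have gm: "(\<lambda>s. indicator {0..t} s * g s \<omega>) \<in> borel_measurable lborel"
          using gi by (auto simp: set_integrable_def)
        have ri: "(\<lambda>s. indicator {0..t} s *\<^sub>R (rsgn (Y s \<omega>) * g s \<omega>)) \<in> borel_measurable lborel"
          using sign_steps_set_integral_tendsto(2)[where Y = Y and \<omega> = \<omega>, OF c regD(4)[OF elim(2)] gi]
          by (auto simp: set_integrable_def)
        have sm: "(\<lambda>s. indicator {0..t} s *\<^sub>R (g s \<omega> * sgn (Y s \<omega>))) \<in> borel_measurable lborel"
        proof -
          have "(\<lambda>s. (indicator {0..t} s * g s \<omega>) * sgn (Y (max 0 s) \<omega>)) \<in> borel_measurable lborel"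
            using gm continuous_on_max_measurable[OF c] by measurable
          also have "(\<lambda>s. (indicator {0..t} s * g s \<omega>) * sgn (Y (max 0 s) \<omega>)) = (\<lambda>s. indicator {0..t} s *\<^sub>R (g s \<omega> * sgn (Y s \<omega>)))"
            by (auto simp: indicator_def fun_eq_iff)
          finally show ?thesis .
        qed
        have "E t \<omega> = (LBINT s:{0..t}. g s \<omega> * sgn (Y s \<omega>))"
          unfolding E_def set_lebesgue_integral_def
        proof (rule integral_cong_AE[OF ri sm])
          show "AE s in lborel. indicator {0..t} s *\<^sub>R (rsgn (Y s \<omega>) * g s \<omega>) = indicator {0..t} s *\<^sub>R (g s \<omega> * sgn (Y s \<omega>))"
            using regD(4)[OF elim(2)] by eventually_elim (auto simp: indicator_def rsgn_eq_sgn)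
        qed
        moreover have "L t \<omega> = C t \<omega>" using elim by (simp add: L_def)
        ultimately show "\<bar>Y t \<omega>\<bar> = \<bar>Y 0 \<omega>\<bar> + J t \<omega> + (LBINT s:{0..t}. g s \<omega> * sgn (Y s \<omega>)) + L t \<omega>"
          by (simp add: C_def)
      qed
    qed
  qed
qed

end

section \<open>The Barenblatt coefficients\<close>

definition decay :: "real \<Rightarrow> real \<Rightarrow> real \<Rightarrow> real" where
  "decay p m t = t powr (- 1 / beta p m)"

text \<open>The factor of the coefficient that depends on time alone, left as the product of powers
  in which it arises, because only the dependence on \<open>r\<close> is ever
  differentiated.\<close>

definition diff_scale :: "real \<Rightarrow> real \<Rightarrow> real \<Rightarrow> real" where
  "diff_scale p m t = m powr (p - 1) * (decay p m t * (gamma p m * (kappa p m * (p / (p - 1) * decay p m t)))) powr (p - 2)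
     * decay p m t powr ((p - 2) / (p - 1)) * decay p m t powr ((m - 1) * (p - 1))"

definition barenblatt_bracket :: "real \<Rightarrow> real \<Rightarrow> real \<Rightarrow> real \<Rightarrow> real" where
  "barenblatt_bracket p m t r = mass_const p m - kappa p m * (decay p m t * r) powr (p / (p - 1))"

definition diff_formula :: "real \<Rightarrow> real \<Rightarrow> real \<Rightarrow> real \<Rightarrow> real" where
  "diff_formula p m t r = diff_scale p m t * (r powr ((p - 2) / (p - 1)) * barenblatt_bracket p m t r)"

definition diff_formula_r :: "real \<Rightarrow> real \<Rightarrow> real \<Rightarrow> real \<Rightarrow> real" where
  "diff_formula_r p m t r = diff_scale p m t *
     ((p - 2) / (p - 1) * r powr ((p - 2) / (p - 1) - 1) * barenblatt_bracket p m t r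
      - r powr ((p - 2) / (p - 1)) *
        (kappa p m * (p / (p - 1) * (decay p m t * r) powr (p / (p - 1) - 1) * decay p m t)))"

context
  fixes p m :: real
  assumes pm: "2 < p" "0 < m" "1 < m * (p - 1)" and C: "0 < mass_const p m"
begin

lemma barenblatt_params_pos: "0 < beta p m" "0 < gamma p m" "0 < kappa p m" "0 < p / (p - 1)"
proof -
  show b: "0 < beta p m" using pm by (simp add: beta_def)
  show "0 < gamma p m" using pm by (simp add: gamma_def)
  show "0 < kappa p m" using pm b by (simp add: kappa_def)
  show "0 < p / (p - 1)" using pm by simp
qed

lemma decay_pos: "0 < t \<Longrightarrow> 0 < decay p m t"
  by (simp add: decay_def)

lemma profile_eq: "profile p m t r = decay p m t * (max (barenblatt_bracket p m t r) 0) powr gamma p m"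
  by (simp add: profile_def profile_with_const_def decay_def barenblatt_bracket_def)

text \<open>The time scaling turns \<open>front\<close> into \<open>rho\<close>, which is the
  positive zero of the bracket in the scaled variable.\<close>

lemma barenblatt_bracket_pos:
  assumes t: "0 < t" and r: "0 < r" "r < front p m t"
  shows "0 < barenblatt_bracket p m t r"
proof -
  have "decay p m t * r < decay p m t * front p m t"
    using r decay_pos[OF t] by (intro mult_strict_left_mono)
  also have "decay p m t * front p m t = rho p m"
    using t by (simp add: decay_def front_def powr_minus field_simps)
  finally have "(decay p m t * r) powr (p / (p - 1)) < rho p m powr (p / (p - 1))"
    using r decay_pos[OF t] barenblatt_params_pos by (intro powr_less_mono2) auto
  also have "rho p m powr (p / (p - 1)) = mass_const p m / kappa p m"
    using pm C barenblatt_params_pos unfolding rho_def by (simp add: powr_powr)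
  finally show ?thesis
    using barenblatt_params_pos by (simp add: barenblatt_bracket_def field_simps)
qed

lemma barenblatt_bracket_deriv:
  assumes "0 < t" "0 < r"
  shows "(barenblatt_bracket p m t has_real_derivative
      - (kappa p m * (p / (p - 1) * (decay p m t * r) powr (p / (p - 1) - 1) * decay p m t))) (at r)"
  unfolding barenblatt_bracket_def[abs_def]
  using assms decay_pos[of t] by (auto intro!: derivative_eq_intros)

text \<open>The power of the bracket is exactly 1 by the choice of \<open>gamma\<close>: with
  \<open>gamma * (m * (p - 1) - 1) = p - 1\<close> the exponents
  \<open>(gamma - 1) * (p - 2)\<close> and \<open>gamma * (m - 1) * (p - 1)\<close> add up to
  \<open>(p - 1) - (p - 2)\<close>. The power of \<open>r\<close> comes from differentiating
  \<open>r powr (p / (p - 1))\<close> and raising to \<open>p - 2\<close>.\<close>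

lemma diff_coeff_eq:
  assumes t: "0 < t" and r: "0 < r" "r < front p m t"
  shows "diff_coeff p m t r = diff_formula p m t r"
proof -
  define T S g P k where "T = decay p m t" and "S = barenblatt_bracket p m t r" and "g = gamma p m"
    and "P = p / (p - 1)" and "k = kappa p m"
  have pos: "0 < T" "0 < S" "0 < g" "0 < P" "0 < k"
    using decay_pos[OF t] barenblatt_bracket_pos[OF t r] barenblatt_params_pos
    by (auto simp: T_def S_def g_def P_def k_def)
  have P1: "P - 1 = 1 / (p - 1)" using pm by (simp add: P_def field_simps)
  have "((\<lambda>r. T * barenblatt_bracket p m t r powr g) has_real_derivative
      T * (g * S powr (g - 1) * - (k * (P * (T * r) powr (P - 1) * T)))) (at r)"
    using barenblatt_bracket_deriv[OF t r(1)] pos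
    by (auto intro!: derivative_eq_intros simp: T_def S_def g_def P_def k_def powr_diff)
  \<comment> \<open>Inside the front the positive part in the profile is inactive, on an open
    set.\<close>
  then have "(profile p m t has_real_derivative T * (g * S powr (g - 1) * - (k * (P * (T * r) powr (P - 1) * T)))) (at r)"
  proof (rule has_field_derivative_transform_within_open[where S = "{0<..<front p m t}"])
    fix z assume "z \<in> {0<..<front p m t}"
    then have "0 < barenblatt_bracket p m t z" using barenblatt_bracket_pos[OF t] by simp
    then show "T * barenblatt_bracket p m t z powr g = profile p m t z"
      by (simp add: profile_eq T_def g_def)
  qed (use r in auto)
  then have "deriv (profile p m t) r = T * (g * S powr (g - 1) * - (k * (P * (T * r) powr (P - 1) * T)))"
    by (rule DERIV_imp_deriv)
  then have "\<bar>deriv (profile p m t) r\<bar> = (T * (g * (k * (P * T)))) * (S powr (g - 1) * (T * r) powr (P - 1))"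
    using pos r by (simp add: abs_mult algebra_simps)
  then have "\<bar>deriv (profile p m t) r\<bar> powr (p - 2)
     = (T * (g * (k * (P * T)))) powr (p - 2) * (S powr ((g - 1) * (p - 2)) * (T * r) powr ((P - 1) * (p - 2)))"
    using pos r by (simp add: powr_mult powr_powr)
  also have "(T * r) powr ((P - 1) * (p - 2)) = T powr ((p - 2) / (p - 1)) * r powr ((p - 2) / (p - 1))"
    using pos r by (simp add: P1 powr_mult)
  finally have 1: "\<bar>deriv (profile p m t) r\<bar> powr (p - 2)
     = (T * (g * (k * (P * T)))) powr (p - 2) * (S powr ((g - 1) * (p - 2)) * (T powr ((p - 2) / (p - 1)) * r powr ((p - 2) / (p - 1))))" .
  have 2: "profile p m t r powr ((m - 1) * (p - 1)) = T powr ((m - 1) * (p - 1)) * S powr (g * ((m - 1) * (p - 1)))"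
    using pos by (simp add: profile_eq T_def[symmetric] S_def[symmetric] g_def[symmetric] powr_mult powr_powr)
  have g: "g * (m * (p - 1) - 1) = p - 1" using pm by (simp add: g_def gamma_def)
  have "(g - 1) * (p - 2) + g * ((m - 1) * (p - 1)) = g * (m * (p - 1) - 1) - (p - 2)"
    by (simp add: algebra_simps)
  also have "\<dots> = 1" unfolding g by simp
  finally have 3: "S powr ((g - 1) * (p - 2)) * S powr (g * ((m - 1) * (p - 1))) = S"
    using pos by (simp add: powr_add[symmetric])
  have "diff_coeff p m t r = m powr (p - 1) * \<bar>deriv (profile p m t) r\<bar> powr (p - 2) * profile p m t r powr ((m - 1) * (p - 1))"
    using r by (simp add: diff_coeff_def)
  also have "\<dots> = m powr (p - 1) * (T * (g * (k * (P * T)))) powr (p - 2) * T powr ((p - 2) / (p - 1)) * T powr ((m - 1) * (p - 1))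
     * (r powr ((p - 2) / (p - 1)) * (S powr ((g - 1) * (p - 2)) * S powr (g * ((m - 1) * (p - 1)))))"
    unfolding 1 2 by (simp only: mult_ac)
  also have "\<dots> = diff_formula p m t r"
    unfolding 3 by (simp add: diff_formula_def diff_scale_def T_def S_def g_def k_def P_def)
  finally show ?thesis .
qed

lemma diff_formula_deriv:
  assumes "0 < t" "0 < r"
  shows "(diff_formula p m t has_real_derivative diff_formula_r p m t r) (at r)"
  unfolding diff_formula_def[abs_def] diff_formula_r_def
  using barenblatt_bracket_deriv[OF assms] assms
  by (auto intro!: derivative_eq_intros simp: algebra_simps)

text \<open>The generator contains second derivatives of the coefficient, which cancel in the end;
  hence existence is enough and the value is left open.\<close>

lemma diff_formula_r_differentiable:
  assumes "0 < t" "0 < r"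
  shows "\<exists>D. (diff_formula_r p m t has_real_derivative D) (at r)"
proof -
  have pw: "((\<lambda>r. (c * r) powr b) has_real_derivative b * (c * r) powr (b - 1) * c) (at r)" if "0 < c" for b c
    using assms that by (auto intro!: derivative_eq_intros)
  have pw1: "((\<lambda>r. r powr b) has_real_derivative b * r powr (b - 1)) (at r)" for b
    by (rule has_real_derivative_powr[OF assms(2)])
  show ?thesis
    unfolding diff_formula_r_def[abs_def]
    by (rule exI) (rule DERIV_cmult DERIV_diff DERIV_mult DERIV_cmult_right pw1
      pw[OF decay_pos[OF assms(1)]] barenblatt_bracket_deriv[OF assms])+
qed

lemma diff_coeff_r_eq:
  assumes t: "0 < t" and r: "0 < r" "r < front p m t"
  shows "diff_coeff_r p m t r = diff_formula_r p m t r"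
proof -
  have "(diff_coeff p m t has_real_derivative diff_formula_r p m t r) (at r)"
    using diff_formula_deriv[OF t r(1)]
  proof (rule has_field_derivative_transform_within_open[where S = "{0<..<front p m t}"])
    fix z assume "z \<in> {0<..<front p m t}"
    then show "diff_formula p m t z = diff_coeff p m t z" using diff_coeff_eq[OF t] by simp
  qed (use r in auto)
  then show ?thesis using r by (simp add: diff_coeff_r_def DERIV_imp_deriv)
qed

text \<open>A definition through \<open>deriv\<close> hides measurability, so inside the front the
  closed formula is used in its place.\<close>

lemma diff_coeff_r_measurable:
  "(\<lambda>(s, y). if 0 \<le> s then diff_coeff_r p m s y else 0) \<in> borel_measurable (borel \<Otimes>\<^sub>M borel)"
proof -
  have "(\<lambda>(s, y). if 0 < s \<and> 0 < y \<and> y < front p m s then diff_formula_r p m s y else 0) \<in> borel_measurable (borel \<Otimes>\<^sub>M borel)"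
    unfolding diff_formula_r_def diff_scale_def barenblatt_bracket_def decay_def front_def by measurable
  \<comment> \<open>At time 0 the front is 0, because \<open>0 powr b\<close> is 0, so both sides
    vanish there.\<close>
  also have "(\<lambda>(s, y). if 0 < s \<and> 0 < y \<and> y < front p m s then diff_formula_r p m s y else 0)
      = (\<lambda>(s, y). if 0 \<le> s then diff_coeff_r p m s y else 0)"
    using diff_coeff_r_eq by (auto simp: fun_eq_iff diff_coeff_r_def front_def order_le_less)
  finally show ?thesis .
qed

end

text \<open>With \<open>u\<close> affine near \<open>y\<close>, the product rule gives
  \<open>A'' u + 2 A' h\<close> for the first term and \<open>A'' u + A' h\<close> for the second.
  Identities on a whole neighbourhood are required because the inner derivatives are differentiated
  once more, whereas \<open>A''\<close> has to exist at \<open>y\<close> only.\<close>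

lemma generator_linear:
  fixes A A1 u :: "real \<Rightarrow> real"
  assumes N: "open N" "y \<in> N" and A: "\<And>z. z \<in> N \<Longrightarrow> (A has_real_derivative A1 z) (at z)"
    and A1: "(A1 has_real_derivative D) (at y)" and u: "\<And>z. z \<in> N \<Longrightarrow> u z = h * (z - q)"
  shows "deriv (deriv (\<lambda>z. A z * u z)) y - deriv (\<lambda>z. deriv A z * u z) y = A1 y * h"
proof -
  have ev: "\<forall>\<^sub>F z in nhds y. z \<in> N" using N by (rule eventually_nhds_in_open)
  have du: "(u has_real_derivative h) (at z)" if "z \<in> N" for z
    by (rule has_field_derivative_transform_within_open[where f = "\<lambda>z. h * (z - q)" and S = N])
       (use N that u in \<open>auto intro!: derivative_eq_intros\<close>)
  have "deriv (\<lambda>z. A z * u z) z = A1 z * u z + A z * h" if "z \<in> N" for z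
    by (rule DERIV_imp_deriv) (rule derivative_eq_intros A[OF that] du[OF that] | simp)+
  then have "deriv (deriv (\<lambda>z. A z * u z)) y = deriv (\<lambda>z. A1 z * u z + A z * h) y"
    by (intro deriv_cong_ev eventually_mono[OF ev]) auto
  also have "\<dots> = (D * u y + A1 y * h) + A1 y * h"
    by (rule DERIV_imp_deriv) (rule derivative_eq_intros A[OF N(2)] A1 du[OF N(2)] | simp)+
  finally have 1: "deriv (deriv (\<lambda>z. A z * u z)) y = (D * u y + A1 y * h) + A1 y * h" .
  have "deriv (\<lambda>z. deriv A z * u z) y = deriv (\<lambda>z. A1 z * u z) y"
    by (intro deriv_cong_ev eventually_mono[OF ev]) (auto simp: DERIV_imp_deriv[OF A])
  also have "\<dots> = D * u y + A1 y * h"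
    by (rule DERIV_imp_deriv) (rule derivative_eq_intros A1 du[OF N(2)] | simp)+
  finally show ?thesis using 1 by simp
qed

text \<open>Away from \<open>x\<close>, \<open>q\<close> and the front, both absolute values are
  affine near \<open>y\<close>, and the coefficient is either given by the closed formula or
  identically 0. So the computation for affine functions applies in both regions.\<close>

lemma generator_abs:
  assumes pm: "2 < p" "0 < m" "1 < m * (p - 1)" and C: "0 < mass_const p m"
    and t: "0 \<le> t" and reg: "regular_point p m x q t y"
  shows "generator p m x (\<lambda>y. \<bar>y - q\<bar>) t y = diff_coeff_r p m t \<bar>y - x\<bar> * sgn (y - x) * sgn (y - q)"
proof -
  define \<sigma> h where "\<sigma> = sgn (y - x)" and "h = sgn (y - q)"
  have y: "y \<noteq> x" "y \<noteq> q" "\<bar>y - x\<bar> \<noteq> front p m t" using reg by (auto simp: regular_point_def)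
  have \<sigma>1: "\<sigma> * \<sigma> = 1" using y by (simp add: \<sigma>_def sgn_if)
  define N0 where "N0 = {z. 0 < \<sigma> * (z - x) \<and> 0 < h * (z - q)}"
  have N0: "open N0" unfolding N0_def by (intro open_Collect_conj open_Collect_less continuous_intros)
  have yN0: "y \<in> N0" using y by (auto simp: N0_def \<sigma>_def h_def sgn_if)
  have ax: "\<bar>z - x\<bar> = \<sigma> * (z - x)" and aq: "\<bar>z - q\<bar> = h * (z - q)" if "z \<in> N0" for z
    using that by (auto simp: N0_def \<sigma>_def h_def sgn_if split: if_splits)
  show ?thesis
  proof (cases "\<bar>y - x\<bar> < front p m t")
    case True
    \<comment> \<open>The front is 0 at time 0, so a point inside it forces a positive time.\<close>
    have "t \<noteq> 0" using True by (auto simp: front_def)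
    then have t: "0 < t" using t by simp
    define N where "N = N0 \<inter> {z. \<sigma> * (z - x) < front p m t}"
    have N: "open N" "y \<in> N"
      unfolding N_def using N0 yN0 ax[OF yN0] True by (auto intro!: open_Collect_less continuous_intros)
    have A: "((\<lambda>v. diff_coeff p m t \<bar>v - x\<bar>) has_real_derivative \<sigma> * diff_formula_r p m t (\<sigma> * (z - x))) (at z)"
      if z: "z \<in> N" for z
    proof (rule has_field_derivative_transform_within_open[where f = "\<lambda>v. diff_formula p m t (\<sigma> * (v - x))" and S = N])
      have "0 < \<sigma> * (z - x)" using z by (simp add: N_def N0_def)
      from diff_formula_deriv[OF pm C t this]
      have "(diff_formula p m t has_real_derivative diff_formula_r p m t (\<sigma> * (z - x))) (at (\<sigma> * (z - x)))" .
      then have "((\<lambda>v. diff_formula p m t (\<sigma> * (v - x))) has_real_derivative diff_formula_r p m t (\<sigma> * (z - x)) * \<sigma>) (at z)"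
        by (rule DERIV_chain2) (auto intro!: derivative_eq_intros)
      then show "((\<lambda>v. diff_formula p m t (\<sigma> * (v - x))) has_real_derivative \<sigma> * diff_formula_r p m t (\<sigma> * (z - x))) (at z)"
        by (simp add: mult.commute)
      fix v assume v: "v \<in> N"
      then have "0 < \<sigma> * (v - x)" "\<sigma> * (v - x) < front p m t" by (auto simp: N_def N0_def)
      then show "diff_formula p m t (\<sigma> * (v - x)) = diff_coeff p m t \<bar>v - x\<bar>"
        using ax[of v] v diff_coeff_eq[OF pm C t] by (simp add: N_def)
    qed (use N z in auto)
    have r0: "0 < \<sigma> * (y - x)" using yN0 by (simp add: N0_def)
    obtain D where D: "(diff_formula_r p m t has_real_derivative D) (at (\<sigma> * (y - x)))"
      using diff_formula_r_differentiable[OF pm C t r0] by blast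
    have "((\<lambda>v. diff_formula_r p m t (\<sigma> * (v - x))) has_real_derivative D * \<sigma>) (at y)"
      by (rule DERIV_chain2[where f = "diff_formula_r p m t" and g = "\<lambda>v. \<sigma> * (v - x)", OF D]) (auto intro!: derivative_eq_intros)
    then have A1: "((\<lambda>v. \<sigma> * diff_formula_r p m t (\<sigma> * (v - x))) has_real_derivative \<sigma> * (D * \<sigma>)) (at y)"
      by (rule DERIV_cmult)
    have "generator p m x (\<lambda>y. \<bar>y - q\<bar>) t y = \<sigma> * diff_formula_r p m t (\<sigma> * (y - x)) * h"
      unfolding generator_def
      by (rule generator_linear[OF N A A1, of "\<lambda>y. \<bar>y - q\<bar>" h q]) (use aq in \<open>auto simp: N_def\<close>)
    also have "diff_formula_r p m t (\<sigma> * (y - x)) = diff_coeff_r p m t \<bar>y - x\<bar>"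
      using diff_coeff_r_eq[OF pm C t _ True] y ax[OF yN0] by simp
    finally show ?thesis by (simp add: \<sigma>_def h_def)
  next
    case False
    define N where "N = N0 \<inter> {z. front p m t < \<sigma> * (z - x)}"
    have N: "open N" "y \<in> N"
      unfolding N_def using N0 yN0 ax[OF yN0] False y(3) by (auto intro!: open_Collect_less continuous_intros)
    have A: "((\<lambda>v. diff_coeff p m t \<bar>v - x\<bar>) has_real_derivative 0) (at z)" if z: "z \<in> N" for z
    proof (rule has_field_derivative_transform_within_open[where f = "\<lambda>v. 0" and S = N])
      fix v assume "v \<in> N"
      then have "front p m t < \<bar>v - x\<bar>" using ax[of v] by (simp add: N_def)
      then show "0 = diff_coeff p m t \<bar>v - x\<bar>" by (simp add: diff_coeff_def)
    qed (use N z in auto)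
    have "generator p m x (\<lambda>y. \<bar>y - q\<bar>) t y = 0 * h"
      unfolding generator_def
      by (rule generator_linear[OF N A, of 0 "\<lambda>y. \<bar>y - q\<bar>" h q]) (use aq in \<open>auto simp: N_def\<close>)
    then show ?thesis using False by (simp add: diff_coeff_r_def)
  qed
qed

text \<open>\<open>mass_const\<close> is a definite description, so its sign cannot be read off
  without knowing that it denotes. A density of total mass 1 supplies the sign without evaluating
  the normalizing integral.\<close>

lemma mass_const_pos:
  assumes pm: "2 < p" "0 < m" "1 < m * (p - 1)" and M: "prob_space M"
    and Z: "distributed M lborel Z (\<lambda>y. ennreal (barenblatt p m x t y))"
  shows "0 < mass_const p m"
proof (rule ccontr)
  assume "\<not> 0 < mass_const p m"
  then have C: "mass_const p m \<le> 0" by simp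
  interpret prob_space M by (rule M)
  have "0 < beta p m" using pm by (simp add: beta_def)
  then have "0 < kappa p m" using pm by (simp add: kappa_def)
  then have "0 \<le> kappa p m * z powr (p / (p - 1))" for z by simp
  then have "mass_const p m - kappa p m * z powr (p / (p - 1)) \<le> 0" for z
    using C order_trans[of "mass_const p m" 0] by (metis diff_le_0_iff_le)
  then have "barenblatt p m x t y = 0" for y
    by (simp add: barenblatt_def profile_def profile_with_const_def max_absorb2)
  then have "emeasure M (Z -` UNIV \<inter> space M) = 0"
    using distributed_emeasure[OF Z, of UNIV] by simp
  then show False using emeasure_space_1 by simp
qed

lemma distributed_AE_not_in_finite:
  fixes Z :: "'a \<Rightarrow> real"
  assumes Z: "distributed M lborel Z f" and T: "finite T"
  shows "AE \<omega> in M. Z \<omega> \<notin> T"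
proof -
  have Zm: "Z \<in> measurable M lborel" using Z by (simp add: distributed_def)
  have Tb: "T \<in> sets lborel" using finite_imp_closed[OF T] by simp
  have "emeasure M (Z -` T \<inter> space M) = (\<integral>\<^sup>+y. f y * indicator T y \<partial>lborel)"
    by (rule distributed_emeasure[OF Z Tb])
  also have "\<dots> = (\<integral>\<^sup>+y. 0 \<partial>(lborel :: real measure))"
  proof (rule nn_integral_cong_AE)
    have "T \<in> null_sets lborel" by (rule finite_imp_null_set_lborel[OF T])
    then have "AE y in lborel. y \<notin> T" by (rule AE_not_in)
    then show "AE y in lborel. f y * indicator T y = 0" by eventually_elim simp
  qed
  finally have "Z -` T \<inter> space M \<in> null_sets M"
    using measurable_sets[OF Zm Tb] by (simp add: null_sets_def)
  then have "AE \<omega> in M. \<omega> \<notin> Z -` T \<inter> space M" by (rule AE_not_in)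
  then show ?thesis using AE_space by eventually_elim auto
qed

theorem theorem3p8:
  fixes p m q x :: real
    and M :: "'a measure" and F :: "real \<Rightarrow> 'a measure"
    and W X :: "real \<Rightarrow> 'a \<Rightarrow> real"
  assumes "1 < p" and "0 < m" and "1 < m * (p - 1)" and "2 < p"
    and "x \<noteq> q"
    and "weak_solution p m x M F W X"
  shows "\<exists>B L J :: real \<Rightarrow> 'a \<Rightarrow> real.
    brownian_motion M F B \<and>
    adapted_process F L \<and>
    (\<forall>\<omega>\<in>space M. (\<forall>t\<ge>0. 0 \<le> L t \<omega>) \<and> mono_on {0..} (\<lambda>t. L t \<omega>) \<and>
       locally_bounded_variation (\<lambda>t. L t \<omega>)) \<and>
    ito_integral M F B (\<lambda>s \<omega>. sqrt (2 * diff_coeff p m s \<bar>X s \<omega> - x\<bar>)) J \<and>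
    (AE \<omega> in M. AE s in lborel. 0 \<le> s \<longrightarrow> regular_point p m x q s (X s \<omega>)) \<and>
    (AE \<omega> in M. \<forall>t\<ge>0.
       \<bar>X t \<omega> - q\<bar> = \<bar>X 0 \<omega> - q\<bar> + J t \<omega>
         + (LBINT s:{0..t}. diff_coeff_r p m s \<bar>X s \<omega> - x\<bar> * sgn (X s \<omega> - x) * sgn (X s \<omega> - q))
         + L t \<omega> \<and>
       \<bar>X t \<omega> - q\<bar> = \<bar>X 0 \<omega> - q\<bar> + J t \<omega>
         + (LBINT s:{s \<in> {0..t}. regular_point p m x q s (X s \<omega>)}.
              generator p m x (\<lambda>y. \<bar>y - q\<bar>) s (X s \<omega>))
         + L t \<omega>)"
proof -
  let ?H = "\<lambda>s \<omega>. sqrt (2 * diff_coeff p m s \<bar>X s \<omega> - x\<bar>)"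
  note pm = assms(4,2,3)
  obtain I where sb: "stochastic_basis M F" and W: "brownian_motion M F W"
    and X: "adapted_process F X" "continuous_paths M X"
    and fin: "\<And>t. 0 < t \<Longrightarrow> (\<integral>\<^sup>+\<omega>. (\<integral>\<^sup>+s\<in>{0..t}. ennreal \<bar>diff_coeff_r p m s \<bar>X s \<omega> - x\<bar>\<bar> \<partial>lborel) \<partial>M) < \<infinity>"
    and I: "ito_integral M F W ?H I"
    and eq: "AE \<omega> in M. \<forall>t\<ge>0. X t \<omega> = X 0 \<omega> + I t \<omega> +
            (LBINT s:{0..t}. diff_coeff_r p m s \<bar>X s \<omega> - x\<bar> * sgn (X s \<omega> - x))"
    and law: "\<And>t. 0 < t \<Longrightarrow> distributed M lborel (X t) (\<lambda>y. ennreal (barenblatt p m x t y))"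
    using assms(6) unfolding weak_solution_def by blast
  interpret stochastic_basis M F by (rule sb)
  interpret P: pair_sigma_finite M "lborel :: real measure" ..
  have C: "0 < mass_const p m"
    by (rule mass_const_pos[OF pm prob_space_axioms law[of 1]]) simp
  define g where "g s \<omega> = diff_coeff_r p m s \<bar>X s \<omega> - x\<bar> * sgn (X s \<omega> - x)" for s \<omega>
  define Y where "Y s \<omega> = X s \<omega> - q" for s \<omega>
  have Xm: "X t \<in> borel_measurable M" if "0 \<le> t" for t
    by (rule adapted_process_measurable[OF X(1) that])
  have Xj: "(\<lambda>z. X (max 0 (snd z)) (fst z)) \<in> borel_measurable (M \<Otimes>\<^sub>M lborel)"
    using continuous_process_measurable[OF X(2) Xm] by (simp add: case_prod_unfold)
  have sj: "(\<lambda>z. snd z) \<in> borel_measurable (M \<Otimes>\<^sub>M (lborel :: real measure))"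
    using measurable_snd[of M "lborel :: real measure"] by simp
  have Rj: "(\<lambda>z. (case (snd z, \<bar>X (max 0 (snd z)) (fst z) - x\<bar>) of (s, y) \<Rightarrow> if 0 \<le> s then diff_coeff_r p m s y else 0))
      \<in> borel_measurable (M \<Otimes>\<^sub>M lborel)"
    by (rule measurable_compose[OF measurable_Pair diff_coeff_r_measurable[OF pm C]])
       (use Xj sj in measurable)

  \<comment> \<open>Fubini's theorem exchanges almost all outcomes and almost all times. The joint
    measurability that it asks for is known for the process clamped at negative times, which gives
    the same set because of the premise \<open>0 \<le> s\<close>.\<close>
  have regular: "AE \<omega> in M. AE s in lborel. 0 \<le> s \<longrightarrow> regular_point p m x q s (X s \<omega>)"
  proof (subst P.AE_commute)
    have "(\<lambda>z. front p m (snd z)) \<in> borel_measurable (M \<Otimes>\<^sub>M lborel)"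
      by (rule measurable_compose[OF sj]) (simp add: front_def)
    then have "{z \<in> space (M \<Otimes>\<^sub>M lborel). 0 \<le> snd z \<longrightarrow> regular_point p m x q (snd z) (X (max 0 (snd z)) (fst z))} \<in> sets (M \<Otimes>\<^sub>M lborel)"
      using Xj sj unfolding regular_point_def by measurable
    also have "{z \<in> space (M \<Otimes>\<^sub>M lborel). 0 \<le> snd z \<longrightarrow> regular_point p m x q (snd z) (X (max 0 (snd z)) (fst z))}
      = {z \<in> space (M \<Otimes>\<^sub>M lborel). 0 \<le> snd z \<longrightarrow> regular_point p m x q (snd z) (X (snd z) (fst z))}"
      by auto
    finally show "{z \<in> space (M \<Otimes>\<^sub>M lborel). 0 \<le> snd z \<longrightarrow> regular_point p m x q (snd z) (X (snd z) (fst z))} \<in> sets (M \<Otimes>\<^sub>M lborel)" .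
    have "AE \<omega> in M. 0 \<le> s \<longrightarrow> regular_point p m x q s (X s \<omega>)" if s: "s \<noteq> 0" for s
    proof (cases "0 < s")
      case True
      \<comment> \<open>These four points contain every position that \<open>regular_point\<close>
        excludes at time \<open>s\<close>.\<close>
      have "AE \<omega> in M. X s \<omega> \<notin> {x, q, x + front p m s, x - front p m s}"
        by (rule distributed_AE_not_in_finite[OF law[OF True]]) simp
      then show ?thesis by eventually_elim (auto simp: regular_point_def abs_if split: if_splits)
    qed (use s in auto)
    then show "AE s in lborel. AE \<omega> in M. 0 \<le> s \<longrightarrow> regular_point p m x q s (X s \<omega>)"
      using AE_lborel_singleton[of 0] by (auto elim!: eventually_mono)
  qed

  have gint: "AE \<omega> in M. \<forall>t\<ge>0. set_integrable lborel {0..t} (\<lambda>s. g s \<omega>)"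
  proof -
    \<comment> \<open>The horizons \<open>Suc n\<close> are positive, as the integrability condition
      demands, and unbounded, so countably many of them settle all \<open>t\<close>.\<close>
    define f where "f n z = ennreal \<bar>case (snd z, \<bar>X (max 0 (snd z)) (fst z) - x\<bar>) of (s, y) \<Rightarrow> if 0 \<le> s then diff_coeff_r p m s y else 0\<bar>
        * indicator {0..real (Suc n)} (snd z)" for n z
    have fm: "f n \<in> borel_measurable (M \<Otimes>\<^sub>M lborel)" for n
    proof -
      have "(\<lambda>z. indicator {0..real (Suc n)} (snd z) :: ennreal) \<in> borel_measurable (M \<Otimes>\<^sub>M lborel)"
        by (rule measurable_compose[OF sj]) simp
      then show ?thesis unfolding f_def using Rj by measurable
    qed
    have fe: "f n (\<omega>, s) = ennreal \<bar>diff_coeff_r p m s \<bar>X s \<omega> - x\<bar>\<bar> * indicator {0..real (Suc n)} s" for n \<omega> s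
      by (auto simp: f_def indicator_def)
    have "AE \<omega> in M. (\<integral>\<^sup>+s. f n (\<omega>, s) \<partial>lborel) \<noteq> \<infinity>" for n
    proof (rule nn_integral_PInf_AE)
      show "(\<lambda>\<omega>. \<integral>\<^sup>+s. f n (\<omega>, s) \<partial>lborel) \<in> borel_measurable M"
        using lborel.borel_measurable_nn_integral[of "\<lambda>\<omega> s. f n (\<omega>, s)" M] fm[of n] by simp
      show "(\<integral>\<^sup>+\<omega>. (\<integral>\<^sup>+s. f n (\<omega>, s) \<partial>lborel) \<partial>M) \<noteq> \<infinity>"
        unfolding fe using fin[of "real (Suc n)"] by simp
    qed
    then have "AE \<omega> in M. \<forall>n. (\<integral>\<^sup>+s. f n (\<omega>, s) \<partial>lborel) \<noteq> \<infinity>" by (simp add: AE_all_countable)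
    then show ?thesis using AE_space
    proof eventually_elim
      case (elim \<omega>)
      show ?case
      proof (intro allI impI)
        fix t :: real assume t: "0 \<le> t"
        obtain n where n: "t \<le> real n" using real_arch_simple by blast
        have R1: "(\<lambda>s. if 0 \<le> s then diff_coeff_r p m s \<bar>X (max 0 s) \<omega> - x\<bar> else 0) \<in> borel_measurable lborel"
          using measurable_compose[OF measurable_Pair1'[OF elim(2)] Rj] by simp
        have X1: "(\<lambda>s. X (max 0 s) \<omega>) \<in> borel_measurable lborel"
          using measurable_compose[OF measurable_Pair1'[OF elim(2)] Xj] by simp
        have "set_integrable lborel {0..real (Suc n)} (\<lambda>s. g s \<omega>)"
          unfolding set_integrable_def
        proof (rule integrableI_bounded)
          have "(\<lambda>s. indicator {0..real (Suc n)} s * ((if 0 \<le> s then diff_coeff_r p m s \<bar>X (max 0 s) \<omega> - x\<bar> else 0) * sgn (X (max 0 s) \<omega> - x)))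
             \<in> borel_measurable lborel"
            using R1 X1 by measurable
          also have "(\<lambda>s. indicator {0..real (Suc n)} s * ((if 0 \<le> s then diff_coeff_r p m s \<bar>X (max 0 s) \<omega> - x\<bar> else 0) * sgn (X (max 0 s) \<omega> - x)))
             = (\<lambda>s. indicator {0..real (Suc n)} s *\<^sub>R g s \<omega>)"
            by (auto simp: g_def indicator_def fun_eq_iff)
          finally show "(\<lambda>s. indicator {0..real (Suc n)} s *\<^sub>R g s \<omega>) \<in> borel_measurable lborel" .
          have "(\<integral>\<^sup>+s. ennreal (norm (indicator {0..real (Suc n)} s *\<^sub>R g s \<omega>)) \<partial>lborel) \<le> (\<integral>\<^sup>+s. f n (\<omega>, s) \<partial>lborel)"
            unfolding fe by (intro nn_integral_mono) (auto simp: g_def abs_mult sgn_if indicator_def)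
          also have "\<dots> < \<infinity>" using elim(1) by (simp add: less_top)
          finally show "(\<integral>\<^sup>+s. ennreal (norm (indicator {0..real (Suc n)} s *\<^sub>R g s \<omega>)) \<partial>lborel) < \<infinity>" .
        qed
        then show "set_integrable lborel {0..t} (\<lambda>s. g s \<omega>)"
          by (rule set_integrable_subset) (use n in auto)
      qed
    qed
  qed

  have Y: "adapted_process F Y" "continuous_paths M Y"
    using X unfolding Y_def[abs_def] adapted_process_def continuous_paths_def by (auto intro!: continuous_intros)
  have Yeq: "AE \<omega> in M. \<forall>t\<ge>0. Y t \<omega> = Y 0 \<omega> + I t \<omega> + (LBINT s:{0..t}. g s \<omega>)"
    using eq
  proof eventually_elim
    case (elim \<omega>)
    show ?case
    proof (intro allI impI)
      fix t :: real assume "0 \<le> t"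
      then show "Y t \<omega> = Y 0 \<omega> + I t \<omega> + (LBINT s:{0..t}. g s \<omega>)"
        using elim[rule_format, of t] unfolding Y_def g_def by linarith
    qed
  qed
  have Ynz: "AE \<omega> in M. AE s in lborel. 0 \<le> s \<longrightarrow> Y s \<omega> \<noteq> 0"
    using regular by (auto elim!: eventually_mono simp: regular_point_def Y_def)
  obtain B L J where BLJ: "brownian_motion M F B" "adapted_process F L"
    "\<forall>\<omega>\<in>space M. (\<forall>t\<ge>0. 0 \<le> L t \<omega>) \<and> mono_on {0..} (\<lambda>t. L t \<omega>) \<and> locally_bounded_variation (\<lambda>t. L t \<omega>)"
    "ito_integral M F B ?H J"
    and tanaka: "AE \<omega> in M. \<forall>t\<ge>0. \<bar>Y t \<omega>\<bar> = \<bar>Y 0 \<omega>\<bar> + J t \<omega> + (LBINT s:{0..t}. g s \<omega> * sgn (Y s \<omega>)) + L t \<omega>"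
    using tanaka_formula[OF W Y I gint Yeq Ynz] by blast
  \<comment> \<open>The identity holds for every outcome, because at the excluded points the
    integrand on the right vanishes too: \<open>sgn\<close> is 0 at \<open>q\<close>, and
    \<open>diff_coeff_r\<close> is 0 at \<open>x\<close> and on the front. Restricting the domain of
    integration therefore loses nothing.\<close>
  have gen: "(LBINT s:{s \<in> {0..t}. regular_point p m x q s (X s \<omega>)}. generator p m x (\<lambda>y. \<bar>y - q\<bar>) s (X s \<omega>))
     = (LBINT s:{0..t}. g s \<omega> * sgn (Y s \<omega>))" for t \<omega>
    unfolding set_lebesgue_integral_def
  proof (rule Bochner_Integration.integral_cong[OF refl])
    fix s
    show "indicator {s \<in> {0..t}. regular_point p m x q s (X s \<omega>)} s *\<^sub>R generator p m x (\<lambda>y. \<bar>y - q\<bar>) s (X s \<omega>)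
      = indicator {0..t} s *\<^sub>R (g s \<omega> * sgn (Y s \<omega>))"
    proof (cases "s \<in> {0..t} \<and> regular_point p m x q s (X s \<omega>)")
      case True
      then show ?thesis using generator_abs[OF pm C, of s x q "X s \<omega>"] by (simp add: g_def Y_def)
    next
      case False
      have "g s \<omega> * sgn (Y s \<omega>) = 0" if "\<not> regular_point p m x q s (X s \<omega>)"
        using that by (auto simp: regular_point_def g_def Y_def diff_coeff_r_def)
      then show ?thesis using False by (auto simp: indicator_def)
    qed
  qed
  show ?thesis
  proof (intro exI conjI)
    show "AE \<omega> in M. \<forall>t\<ge>0.
       \<bar>X t \<omega> - q\<bar> = \<bar>X 0 \<omega> - q\<bar> + J t \<omega>
         + (LBINT s:{0..t}. diff_coeff_r p m s \<bar>X s \<omega> - x\<bar> * sgn (X s \<omega> - x) * sgn (X s \<omega> - q))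
         + L t \<omega> \<and>
       \<bar>X t \<omega> - q\<bar> = \<bar>X 0 \<omega> - q\<bar> + J t \<omega>
         + (LBINT s:{s \<in> {0..t}. regular_point p m x q s (X s \<omega>)}.
              generator p m x (\<lambda>y. \<bar>y - q\<bar>) s (X s \<omega>))
         + L t \<omega>"
      using tanaka unfolding gen unfolding g_def Y_def by eventually_elim (intro allI impI conjI; blast)
  qed (rule BLJ regular)+
qed

end
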